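(* Let $A$ be a split finite-dimensional algebra over a field with Jacobson radical $J$ satisfying $J^3=0$. Then every self-orthogonal generator over $A$ is projective; that is, if $G$ is a finitely generated left $A$-module with $A\in\operatorname{add}G$ and $\operatorname{Ext}_A^i(G,G)=0$ for every $i>0$, then $G$ is projective.
   Context: All modules are finitely generated left modules. A finite-dimensional algebra over a field $k$ is called split if the endomorphism ring of every simple module is $k$. For a module $G$, $\operatorname{add}G$ denotes the full subcategory of direct summands of finite direct sums of copies of $G$. A module $G$ is a generator if $A\in\operatorname{add}G$, and is self-orthogonal if $\operatorname{Ext}_A^i(G,G)=0$ for every $i>0$. *)

theory Defs
  imports "HOL-Algebra.Algebra"
begin

text \<open>
  The locale \<^locale>\<open>module\<close> requires a commutative ring of scalars, so unital left modules over
  an arbitrary ring are introduced here, on the same record type.  As in the library, the fields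
  \<^const>\<open>mult\<close> and \<^const>\<open>one\<close> of a module record carry no meaning; \<^locale>\<open>submodule\<close> does not
  mention commutativity and is used unchanged.
\<close>

locale left_module = R?: ring R + M?: abelian_group M
  for R :: "('a, 'c) ring_scheme" (structure) and M :: "('a, 'm, 'd) module_scheme" (structure) +
  assumes smult_closed [simp, intro]:
      "\<lbrakk>a \<in> carrier R; x \<in> carrier M\<rbrakk> \<Longrightarrow> a \<odot>\<^bsub>M\<^esub> x \<in> carrier M"
    and smult_l_distr:
      "\<lbrakk>a \<in> carrier R; b \<in> carrier R; x \<in> carrier M\<rbrakk> \<Longrightarrow>
        (a \<oplus>\<^bsub>R\<^esub> b) \<odot>\<^bsub>M\<^esub> x = a \<odot>\<^bsub>M\<^esub> x \<oplus>\<^bsub>M\<^esub> b \<odot>\<^bsub>M\<^esub> x"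
    and smult_r_distr:
      "\<lbrakk>a \<in> carrier R; x \<in> carrier M; y \<in> carrier M\<rbrakk> \<Longrightarrow>
        a \<odot>\<^bsub>M\<^esub> (x \<oplus>\<^bsub>M\<^esub> y) = a \<odot>\<^bsub>M\<^esub> x \<oplus>\<^bsub>M\<^esub> a \<odot>\<^bsub>M\<^esub> y"
    and smult_assoc1:
      "\<lbrakk>a \<in> carrier R; b \<in> carrier R; x \<in> carrier M\<rbrakk> \<Longrightarrow>
        (a \<otimes>\<^bsub>R\<^esub> b) \<odot>\<^bsub>M\<^esub> x = a \<odot>\<^bsub>M\<^esub> (b \<odot>\<^bsub>M\<^esub> x)"
    and smult_one [simp]:
      "x \<in> carrier M \<Longrightarrow> \<one>\<^bsub>R\<^esub> \<odot>\<^bsub>M\<^esub> x = x"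

definition finitely_generated ::
    "('a, 'c) ring_scheme \<Rightarrow> ('a, 'm, 'd) module_scheme \<Rightarrow> bool" where
  "finitely_generated R M \<longleftrightarrow>
    (\<exists>S. finite S \<and> S \<subseteq> carrier M \<and>
      carrier M = {(\<Oplus>\<^bsub>M\<^esub>s\<in>S. c s \<odot>\<^bsub>M\<^esub> s) | c. c \<in> S \<rightarrow> carrier R})"

text \<open>
  The \<open>K\<close>-algebra \<open>A\<close> is a single record: its ring structure is that of the underlying ring record,
  and its \<^const>\<open>smult\<close> is the action of \<open>K\<close>.  In contrast to the locale \<^locale>\<open>algebra\<close>, the ring
  \<open>A\<close> need not be commutative.
\<close>

locale fin_dim_algebra = K: field K + V: module K A + A: ring A
  for K :: "('k, 'c) ring_scheme" (structure) and A :: "('k, 'a, 'd) module_scheme" (structure) +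
  assumes smult_mult_left:
      "\<lbrakk>c \<in> carrier K; x \<in> carrier A; y \<in> carrier A\<rbrakk> \<Longrightarrow>
        (c \<odot>\<^bsub>A\<^esub> x) \<otimes>\<^bsub>A\<^esub> y = c \<odot>\<^bsub>A\<^esub> (x \<otimes>\<^bsub>A\<^esub> y)"
    and smult_mult_right:
      "\<lbrakk>c \<in> carrier K; x \<in> carrier A; y \<in> carrier A\<rbrakk> \<Longrightarrow>
        x \<otimes>\<^bsub>A\<^esub> (c \<odot>\<^bsub>A\<^esub> y) = c \<odot>\<^bsub>A\<^esub> (x \<otimes>\<^bsub>A\<^esub> y)"
    and finite_dim: "finitely_generated K A"

definition module_hom ::
    "('a, 'c) ring_scheme \<Rightarrow> ('a, 'm) module \<Rightarrow> ('a, 'n) module \<Rightarrow> ('m \<Rightarrow> 'n) set" where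
  "module_hom R M N = {f \<in> carrier M \<rightarrow> carrier N.
    (\<forall>x\<in>carrier M. \<forall>y\<in>carrier M. f (x \<oplus>\<^bsub>M\<^esub> y) = f x \<oplus>\<^bsub>N\<^esub> f y) \<and>
    (\<forall>a\<in>carrier R. \<forall>x\<in>carrier M. f (a \<odot>\<^bsub>M\<^esub> x) = a \<odot>\<^bsub>N\<^esub> f x)}"

definition module_iso ::
    "('a, 'c) ring_scheme \<Rightarrow> ('a, 'm) module \<Rightarrow> ('a, 'n) module \<Rightarrow> bool" where
  "module_iso R M N \<longleftrightarrow> (\<exists>f\<in>module_hom R M N. bij_betw f (carrier M) (carrier N))"

text \<open>
  Elements of the Hom group are taken to be extensional on the carrier of the source, so that
  homomorphisms with the same values are equal.
\<close>

definition hom_group ::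
    "('a, 'c) ring_scheme \<Rightarrow> ('a, 'm) module \<Rightarrow> ('a, 'n) module \<Rightarrow> ('m \<Rightarrow> 'n) monoid" where
  "hom_group R M N = \<lparr>
    carrier = module_hom R M N \<inter> extensional (carrier M),
    monoid.mult = (\<lambda>f g. \<lambda>x\<in>carrier M. f x \<oplus>\<^bsub>N\<^esub> g x),
    monoid.one = (\<lambda>x\<in>carrier M. \<zero>\<^bsub>N\<^esub>)\<rparr>"

definition regular_module :: "('a, 'c) ring_scheme \<Rightarrow> ('a, 'a) module" where
  "regular_module R = \<lparr>
    carrier = carrier R,
    monoid.mult = undefined, monoid.one = undefined,
    ring.zero = \<zero>\<^bsub>R\<^esub>, ring.add = ring.add R,
    smult = monoid.mult R\<rparr>"

text \<open>The direct sum of \<open>n\<close> copies of \<open>M\<close>.\<close>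

definition direct_power :: "('a, 'm) module \<Rightarrow> nat \<Rightarrow> ('a, nat \<Rightarrow> 'm) module" where
  "direct_power M n = \<lparr>
    carrier = {..<n} \<rightarrow>\<^sub>E carrier M,
    monoid.mult = undefined, monoid.one = undefined,
    ring.zero = (\<lambda>i\<in>{..<n}. \<zero>\<^bsub>M\<^esub>),
    ring.add = (\<lambda>x y. \<lambda>i\<in>{..<n}. x i \<oplus>\<^bsub>M\<^esub> y i),
    smult = (\<lambda>a x. \<lambda>i\<in>{..<n}. a \<odot>\<^bsub>M\<^esub> x i)\<rparr>"

text \<open>As usual, direct summands are understood up to isomorphism.\<close>

definition direct_summand ::
    "('a, 'c) ring_scheme \<Rightarrow> ('a, 'm) module \<Rightarrow> ('a, 'n) module \<Rightarrow> bool" where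
  "direct_summand R M N \<longleftrightarrow>
    (\<exists>U V. submodule U R N \<and> submodule V R N \<and>
      U \<inter> V = {\<zero>\<^bsub>N\<^esub>} \<and> U <+>\<^bsub>N\<^esub> V = carrier N \<and>
      module_iso R M (N\<lparr>carrier := U\<rparr>))"

definition in_add ::
    "('a, 'c) ring_scheme \<Rightarrow> ('a, 'm) module \<Rightarrow> ('a, 'g) module \<Rightarrow> bool" where
  "in_add R M G \<longleftrightarrow> left_module R M \<and> (\<exists>n. direct_summand R M (direct_power G n))"

definition generator :: "('a, 'c) ring_scheme \<Rightarrow> ('a, 'g) module \<Rightarrow> bool" where
  "generator R G \<longleftrightarrow> in_add R (regular_module R) G"

definition simple_module :: "('a, 'c) ring_scheme \<Rightarrow> ('a, 'm) module \<Rightarrow> bool" where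
  "simple_module R S \<longleftrightarrow> left_module R S \<and> carrier S \<noteq> {\<zero>\<^bsub>S\<^esub>} \<and>
    (\<forall>U. submodule U R S \<longrightarrow> U = {\<zero>\<^bsub>S\<^esub>} \<or> U = carrier S)"

text \<open>
  The endomorphism ring of \<open>S\<close> is \<open>K\<close> when the canonical map from \<open>K\<close>, sending \<open>c\<close> to
  multiplication by \<open>c \<cdot> 1\<close>, is bijective.  A simple module is isomorphic to a quotient of the
  regular module by a maximal left ideal, whose elements are cosets, so simple modules with
  elements of type \<^typ>\<open>'a set\<close> represent all isomorphism classes.
\<close>

definition split_algebra :: "('k, 'c) ring_scheme \<Rightarrow> ('k, 'a) module \<Rightarrow> bool" where
  "split_algebra K A \<longleftrightarrow>
    (\<forall>S :: ('a, 'a set) module. simple_module A S \<longrightarrow>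
      bij_betw (\<lambda>c. \<lambda>x\<in>carrier S. (c \<odot>\<^bsub>A\<^esub> \<one>\<^bsub>A\<^esub>) \<odot>\<^bsub>S\<^esub> x)
        (carrier K) (carrier (hom_group A S S)))"

definition maximal_left_ideal :: "('a, 'c) ring_scheme \<Rightarrow> 'a set \<Rightarrow> bool" where
  "maximal_left_ideal R I \<longleftrightarrow>
    submodule I R (regular_module R) \<and> I \<noteq> carrier R \<and>
    (\<forall>L. submodule L R (regular_module R) \<and> I \<subseteq> L \<longrightarrow> L = I \<or> L = carrier R)"

definition jacobson_radical :: "('a, 'c) ring_scheme \<Rightarrow> 'a set" where
  "jacobson_radical R = {x \<in> carrier R. \<forall>I. maximal_left_ideal R I \<longrightarrow> x \<in> I}"

text \<open>
  A resolution \<open>\<dots> \<rightarrow> P 2 \<rightarrow> P 1 \<rightarrow> P 0 \<rightarrow> M \<rightarrow> 0\<close> by finitely generated free modules, with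
  differentials \<open>d n : P (n + 1) \<rightarrow> P n\<close> and augmentation \<open>e\<close>.
\<close>

definition free_resolution ::
    "('a, 'c) ring_scheme \<Rightarrow> ('a, 'm) module \<Rightarrow> (nat \<Rightarrow> ('a, nat \<Rightarrow> 'a) module) \<Rightarrow>
      (nat \<Rightarrow> (nat \<Rightarrow> 'a) \<Rightarrow> (nat \<Rightarrow> 'a)) \<Rightarrow> ((nat \<Rightarrow> 'a) \<Rightarrow> 'm) \<Rightarrow> bool" where
  "free_resolution R M P d e \<longleftrightarrow>
    (\<forall>n. \<exists>r. P n = direct_power (regular_module R) r) \<and>
    (\<forall>n. d n \<in> module_hom R (P (Suc n)) (P n)) \<and>
    e \<in> module_hom R (P 0) M \<and>
    e ` carrier (P 0) = carrier M \<and>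
    d 0 ` carrier (P 1) = a_kernel (P 0) M e \<and>
    (\<forall>n. d (Suc n) ` carrier (P (Suc (Suc n))) = a_kernel (P (Suc n)) (P n) (d n))"

definition hom_differential ::
    "(nat \<Rightarrow> ('a, 'p) module) \<Rightarrow> (nat \<Rightarrow> 'p \<Rightarrow> 'p) \<Rightarrow> nat \<Rightarrow> ('p \<Rightarrow> 'n) \<Rightarrow> 'p \<Rightarrow> 'n" where
  "hom_differential P d n f = (\<lambda>x\<in>carrier (P (Suc n)). f (d n x))"

definition hom_cocycles ::
    "('a, 'c) ring_scheme \<Rightarrow> (nat \<Rightarrow> ('a, 'p) module) \<Rightarrow> (nat \<Rightarrow> 'p \<Rightarrow> 'p) \<Rightarrow>
      ('a, 'n) module \<Rightarrow> nat \<Rightarrow> ('p \<Rightarrow> 'n) set" where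
  "hom_cocycles R P d N n =
    kernel (hom_group R (P n) N) (hom_group R (P (Suc n)) N) (hom_differential P d n)"

fun hom_coboundaries ::
    "('a, 'c) ring_scheme \<Rightarrow> (nat \<Rightarrow> ('a, 'p) module) \<Rightarrow> (nat \<Rightarrow> 'p \<Rightarrow> 'p) \<Rightarrow>
      ('a, 'n) module \<Rightarrow> nat \<Rightarrow> ('p \<Rightarrow> 'n) set" where
  "hom_coboundaries R P d N 0 = {\<one>\<^bsub>hom_group R (P 0) N\<^esub>}"
| "hom_coboundaries R P d N (Suc n) = hom_differential P d n ` carrier (hom_group R (P n) N)"

definition hom_cohomology ::
    "('a, 'c) ring_scheme \<Rightarrow> (nat \<Rightarrow> ('a, 'p) module) \<Rightarrow> (nat \<Rightarrow> 'p \<Rightarrow> 'p) \<Rightarrow>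
      ('a, 'n) module \<Rightarrow> nat \<Rightarrow> ('p \<Rightarrow> 'n) set monoid" where
  "hom_cohomology R P d N n =
    (hom_group R (P n) N)\<lparr>carrier := hom_cocycles R P d N n\<rparr> Mod hom_coboundaries R P d N n"

text \<open>
  Ext is computed from a chosen resolution of the first argument; up to isomorphism the choice is
  immaterial.  Over a left noetherian ring, in particular over a finite-dimensional algebra, every
  finitely generated module has a resolution of this kind.  The definition is meaningful only for
  modules that admit such a resolution.
\<close>

definition Ext ::
    "('a, 'c) ring_scheme \<Rightarrow> nat \<Rightarrow> ('a, 'm) module \<Rightarrow> ('a, 'n) module \<Rightarrow>
      ((nat \<Rightarrow> 'a) \<Rightarrow> 'n) set monoid" where
  "Ext R n M N =
    (let (P, d) = (SOME (P, d). \<exists>e. free_resolution R M P d e) in hom_cohomology R P d N n)"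

definition self_orthogonal :: "('a, 'c) ring_scheme \<Rightarrow> ('a, 'm) module \<Rightarrow> bool" where
  "self_orthogonal R G \<longleftrightarrow> (\<forall>i>0. trivial_group (Ext R i G G))"

text \<open>
  Projectivity is the lifting property against surjections \<open>g : L \<rightarrow> N\<close>.  A definition cannot
  quantify over types, so the element types of \<open>L\<close> and \<open>N\<close> are parameters; a theorem that leaves
  them as type variables asserts the lifting property for modules of every type.
\<close>

definition projective_module ::
    "'x itself \<Rightarrow> 'y itself \<Rightarrow> ('a, 'c) ring_scheme \<Rightarrow> ('a, 'm) module \<Rightarrow> bool" where
  "projective_module _ _ R M \<longleftrightarrow> left_module R M \<and>
    (\<forall>(L :: ('a, 'x) module) (N :: ('a, 'y) module) g f.
      left_module R L \<and> left_module R N \<and>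
      g \<in> module_hom R L N \<and> g ` carrier L = carrier N \<and> f \<in> module_hom R M N \<longrightarrow>
      (\<exists>h\<in>module_hom R M L. \<forall>m\<in>carrier M. g (h m) = f m))"

end

theory Submission
  imports Defs
begin

text \<open>
  Let \<open>Z n\<close> be the syzygy of index \<open>n + 1\<close> in a minimal projective resolution of \<open>G\<close>.  By minimality,
  \<open>Z n\<close> lies in the radical of a projective module, so \<open>J\<^sup>3 = 0\<close> gives \<open>J\<^sup>2 (Z n) = 0\<close>: both \<open>J (Z n)\<close> and
  \<open>Z n / J (Z n)\<close> are semisimple.  Since \<open>G\<close> is a self-orthogonal generator, Ext from \<open>G\<close> to \<open>G\<close> and to
  projective modules vanishes in positive degrees, and dimension shifting shows that, for \<open>n > m\<close>,
  every homomorphism from \<open>Z n\<close> to \<open>Z m\<close> extends to the projective module around \<open>Z n\<close>.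

  Suppose that no \<open>Z n\<close> is zero.  The connecting homomorphism of the sequence
  \<open>0 \<rightarrow> J (Z m) \<rightarrow> Z m \<rightarrow> Z m / J (Z m) \<rightarrow> 0\<close> maps \<open>Hom (Z n, Z m / J (Z m))\<close> to
  \<open>Hom (Z (n + 1), J (Z m))\<close>.  It is surjective for \<open>n \<ge> m\<close>.  For \<open>n > m\<close> it is bijective, because a
  homomorphism from \<open>Z n\<close> to \<open>Z m\<close> that extends to the projective module around \<open>Z n\<close> has its image
  in \<open>J (Z m)\<close>.  For \<open>n = m\<close> it is not, because its kernel contains the projection of \<open>Z m\<close> onto
  \<open>Z m / J (Z m)\<close>.  This is \<open>hom_len_syzygies_eq\<close> and \<open>hom_len_syzygies_less\<close>.

  Let \<open>S\<close> range over a finite set of simple modules that contains all isomorphism classes, and let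
  \<open>w n\<close> be the vector of the dimensions of all \<open>Hom (Z n, S)\<close> and \<open>Hom (Z (n + 1), S)\<close>.  The
  multiplicities of the simple modules in \<open>Z m / J (Z m)\<close> and, with negative sign, in \<open>J (Z m)\<close>
  define a linear functional that vanishes on \<open>w n\<close> for \<open>n > m\<close> but not on \<open>w m\<close>.  So the infinitely
  many vectors \<open>w n\<close> of one finite-dimensional space are linearly independent, which is absurd
  (\<open>no_triangular_family\<close>, \<open>syzygy_zero\<close>).  Hence some \<open>Z n\<close> is zero.  Going back along the resolution
  (\<open>syzygy_zero_pred\<close>), already \<open>Z 0 = 0\<close>, and \<open>G\<close> is projective.

  Dimensions are treated as lengths of chains of submodules.  The comparison of the minimal
  resolution with the resolution that defines Ext is proved directly (\<open>comparison\<close>,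
  \<open>extend_from_syzygy\<close>).
\<close>

section \<open>Left modules, submodules and homomorphisms\<close>

text \<open>The free left module of rank \<open>n\<close>.\<close>

abbreviation free_module :: "('a, 'c) ring_scheme \<Rightarrow> nat \<Rightarrow> ('a, nat \<Rightarrow> 'a) module" where
  "free_module R n \<equiv> direct_power (regular_module R) n"

text \<open>Additive inverses need not be checked separately: they are given by the action of \<open>-1\<close>.\<close>

lemma left_moduleI:
  fixes R (structure) and M (structure)
  assumes "ring R"
    and zero: "\<zero>\<^bsub>M\<^esub> \<in> carrier M"
    and closed: "\<And>x y. x \<in> carrier M \<Longrightarrow> y \<in> carrier M \<Longrightarrow> x \<oplus>\<^bsub>M\<^esub> y \<in> carrier M"
    and assoc: "\<And>x y z. x \<in> carrier M \<Longrightarrow> y \<in> carrier M \<Longrightarrow> z \<in> carrier M \<Longrightarrow>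
      x \<oplus>\<^bsub>M\<^esub> y \<oplus>\<^bsub>M\<^esub> z = x \<oplus>\<^bsub>M\<^esub> (y \<oplus>\<^bsub>M\<^esub> z)"
    and comm: "\<And>x y. x \<in> carrier M \<Longrightarrow> y \<in> carrier M \<Longrightarrow> x \<oplus>\<^bsub>M\<^esub> y = y \<oplus>\<^bsub>M\<^esub> x"
    and l_zero: "\<And>x. x \<in> carrier M \<Longrightarrow> \<zero>\<^bsub>M\<^esub> \<oplus>\<^bsub>M\<^esub> x = x"
    and smult_closed: "\<And>a x. a \<in> carrier R \<Longrightarrow> x \<in> carrier M \<Longrightarrow> a \<odot>\<^bsub>M\<^esub> x \<in> carrier M"
    and l_distr: "\<And>a b x. a \<in> carrier R \<Longrightarrow> b \<in> carrier R \<Longrightarrow> x \<in> carrier M \<Longrightarrow>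
      (a \<oplus>\<^bsub>R\<^esub> b) \<odot>\<^bsub>M\<^esub> x = a \<odot>\<^bsub>M\<^esub> x \<oplus>\<^bsub>M\<^esub> b \<odot>\<^bsub>M\<^esub> x"
    and r_distr: "\<And>a x y. a \<in> carrier R \<Longrightarrow> x \<in> carrier M \<Longrightarrow> y \<in> carrier M \<Longrightarrow>
      a \<odot>\<^bsub>M\<^esub> (x \<oplus>\<^bsub>M\<^esub> y) = a \<odot>\<^bsub>M\<^esub> x \<oplus>\<^bsub>M\<^esub> a \<odot>\<^bsub>M\<^esub> y"
    and smult_assoc: "\<And>a b x. a \<in> carrier R \<Longrightarrow> b \<in> carrier R \<Longrightarrow> x \<in> carrier M \<Longrightarrow>
      (a \<otimes>\<^bsub>R\<^esub> b) \<odot>\<^bsub>M\<^esub> x = a \<odot>\<^bsub>M\<^esub> (b \<odot>\<^bsub>M\<^esub> x)"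
    and smult_one: "\<And>x. x \<in> carrier M \<Longrightarrow> \<one>\<^bsub>R\<^esub> \<odot>\<^bsub>M\<^esub> x = x"
    and smult_zero: "\<And>x. x \<in> carrier M \<Longrightarrow> \<zero>\<^bsub>R\<^esub> \<odot>\<^bsub>M\<^esub> x = \<zero>\<^bsub>M\<^esub>"
  shows "left_module R M"
proof -
  interpret R: ring R by fact
  have "abelian_group M"
  proof (rule abelian_groupI)
    fix x assume x: "x \<in> carrier M"
    have "(\<ominus>\<^bsub>R\<^esub> \<one>\<^bsub>R\<^esub>) \<odot>\<^bsub>M\<^esub> x \<oplus>\<^bsub>M\<^esub> x = (\<ominus>\<^bsub>R\<^esub> \<one>\<^bsub>R\<^esub> \<oplus>\<^bsub>R\<^esub> \<one>\<^bsub>R\<^esub>) \<odot>\<^bsub>M\<^esub> x"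
      using x by (simp add: l_distr smult_one)
    then show "\<exists>y\<in>carrier M. y \<oplus>\<^bsub>M\<^esub> x = \<zero>\<^bsub>M\<^esub>"
      using x smult_closed[of "\<ominus>\<^bsub>R\<^esub> \<one>\<^bsub>R\<^esub>" x] by (auto simp: R.l_neg smult_zero)
  qed (use assms in auto)
  then show ?thesis
    using assms by (intro left_module.intro left_module_axioms.intro) auto
qed

context left_module
begin

lemma smult_zero_left [simp]: "x \<in> carrier M \<Longrightarrow> \<zero>\<^bsub>R\<^esub> \<odot>\<^bsub>M\<^esub> x = \<zero>\<^bsub>M\<^esub>"
  using smult_l_distr[of \<zero> \<zero> x] smult_closed[of \<zero> x]
  by (metis M.add.r_cancel_one' R.l_zero R.zero_closed)

lemma smult_zero_right [simp]: "a \<in> carrier R \<Longrightarrow> a \<odot>\<^bsub>M\<^esub> \<zero>\<^bsub>M\<^esub> = \<zero>\<^bsub>M\<^esub>"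
  using smult_r_distr[of a "\<zero>\<^bsub>M\<^esub>" "\<zero>\<^bsub>M\<^esub>"] smult_closed[of a "\<zero>\<^bsub>M\<^esub>"]
  by (metis M.add.r_cancel_one' M.l_zero M.zero_closed)

lemma smult_minus_one: "x \<in> carrier M \<Longrightarrow> (\<ominus>\<^bsub>R\<^esub> \<one>\<^bsub>R\<^esub>) \<odot>\<^bsub>M\<^esub> x = \<ominus>\<^bsub>M\<^esub> x"
  using smult_l_distr[of "\<ominus> \<one>" \<one> x]
  by (metis M.minus_equality R.a_inv_closed R.l_neg R.one_closed smult_closed smult_one
      smult_zero_left)

lemma smult_uminus:
  assumes "a \<in> carrier R" "x \<in> carrier M"
  shows "a \<odot>\<^bsub>M\<^esub> (\<ominus>\<^bsub>M\<^esub> x) = \<ominus>\<^bsub>M\<^esub> (a \<odot>\<^bsub>M\<^esub> x)"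
  using assms smult_r_distr[of a x "\<ominus>\<^bsub>M\<^esub> x"]
  by (intro M.minus_equality[symmetric]) (simp_all add: M.r_neg M.a_comm)

lemma submodule_iff:
  "submodule U R M \<longleftrightarrow> U \<subseteq> carrier M \<and> \<zero>\<^bsub>M\<^esub> \<in> U \<and> (\<forall>x\<in>U. \<forall>y\<in>U. x \<oplus>\<^bsub>M\<^esub> y \<in> U) \<and>
    (\<forall>a\<in>carrier R. \<forall>x\<in>U. a \<odot>\<^bsub>M\<^esub> x \<in> U)" (is "?l \<longleftrightarrow> ?r")
proof
  assume ?l
  then interpret U: submodule U R M .
  show ?r
    using U.subset U.one_closed U.m_closed by auto
next
  assume r: ?r
  then have "\<ominus>\<^bsub>M\<^esub> x \<in> U" if "x \<in> U" for x
    using that smult_minus_one[of x] by (metis R.a_inv_closed R.one_closed subsetD)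
  then show ?l
    using r by (intro submodule.intro subgroup.intro submodule_axioms.intro)
      (auto simp: a_inv_def)
qed

lemma submodule_uminus: "submodule U R M \<Longrightarrow> x \<in> U \<Longrightarrow> \<ominus>\<^bsub>M\<^esub> x \<in> U"
  using smult_minus_one[of x] unfolding submodule_iff
  by (metis R.a_inv_closed R.one_closed subsetD)

lemma submodule_minus: "submodule U R M \<Longrightarrow> x \<in> U \<Longrightarrow> y \<in> U \<Longrightarrow> x \<ominus>\<^bsub>M\<^esub> y \<in> U"
  using submodule_uminus[of U y] by (auto simp: submodule_iff a_minus_def)

lemma submodule_carrier: "submodule (carrier M) R M"
  by (auto simp: submodule_iff)

lemma submodule_zero: "submodule {\<zero>\<^bsub>M\<^esub>} R M"
  by (auto simp: submodule_iff)

lemma left_module_submodule: "submodule U R M \<Longrightarrow> left_module R (M\<lparr>carrier := U\<rparr>)"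
  by (rule left_moduleI, rule R.ring_axioms)
    (auto simp: submodule_iff subset_iff smult_l_distr smult_r_distr smult_assoc1 M.a_assoc
      intro: M.a_comm)

lemma submodule_of_submodule:
  assumes "submodule U R M"
  shows "submodule V R (M\<lparr>carrier := U\<rparr>) \<longleftrightarrow> submodule V R M \<and> V \<subseteq> U"
proof -
  interpret U: left_module R "M\<lparr>carrier := U\<rparr>"
    by (rule left_module_submodule) fact
  show ?thesis
    using assms by (auto simp: U.submodule_iff submodule_iff)
qed

lemma submodule_Int: "submodule U R M \<Longrightarrow> submodule V R M \<Longrightarrow> submodule (U \<inter> V) R M"
  by (auto simp: submodule_iff)

lemma minus_add_cancel: "x \<in> carrier M \<Longrightarrow> y \<in> carrier M \<Longrightarrow> (x \<ominus>\<^bsub>M\<^esub> y) \<oplus>\<^bsub>M\<^esub> y = x"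
  by (simp add: a_minus_def M.a_assoc M.l_neg)

lemma minus_self: "x \<in> carrier M \<Longrightarrow> x \<ominus>\<^bsub>M\<^esub> x = \<zero>\<^bsub>M\<^esub>"
  by (simp add: a_minus_def M.r_neg)

lemma minus_eq_zero: "x \<in> carrier M \<Longrightarrow> y \<in> carrier M \<Longrightarrow> x \<ominus>\<^bsub>M\<^esub> y = \<zero>\<^bsub>M\<^esub> \<longleftrightarrow> x = y"
  using minus_add_cancel[of x y] by (auto simp: minus_self)

end

lemma module_homI:
  assumes "\<And>x. x \<in> carrier M \<Longrightarrow> f x \<in> carrier N"
    and "\<And>x y. x \<in> carrier M \<Longrightarrow> y \<in> carrier M \<Longrightarrow> f (x \<oplus>\<^bsub>M\<^esub> y) = f x \<oplus>\<^bsub>N\<^esub> f y"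
    and "\<And>a x. a \<in> carrier R \<Longrightarrow> x \<in> carrier M \<Longrightarrow> f (a \<odot>\<^bsub>M\<^esub> x) = a \<odot>\<^bsub>N\<^esub> f x"
  shows "f \<in> module_hom R M N"
  using assms by (auto simp: module_hom_def)

lemma module_hom_closed: "f \<in> module_hom R M N \<Longrightarrow> x \<in> carrier M \<Longrightarrow> f x \<in> carrier N"
  and module_hom_add: "f \<in> module_hom R M N \<Longrightarrow> x \<in> carrier M \<Longrightarrow> y \<in> carrier M \<Longrightarrow>
    f (x \<oplus>\<^bsub>M\<^esub> y) = f x \<oplus>\<^bsub>N\<^esub> f y"
  and module_hom_smult: "f \<in> module_hom R M N \<Longrightarrow> a \<in> carrier R \<Longrightarrow> x \<in> carrier M \<Longrightarrow>
    f (a \<odot>\<^bsub>M\<^esub> x) = a \<odot>\<^bsub>N\<^esub> f x"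
  by (auto simp: module_hom_def)

lemma module_hom_zero:
  assumes "f \<in> module_hom R M N" "left_module R M" "left_module R N"
  shows "f \<zero>\<^bsub>M\<^esub> = \<zero>\<^bsub>N\<^esub>"
proof -
  interpret M: left_module R M by fact
  interpret N: left_module R N by fact
  show ?thesis
    using module_hom_smult[OF assms(1), of "\<zero>\<^bsub>R\<^esub>" "\<zero>\<^bsub>M\<^esub>"] module_hom_closed[OF assms(1)]
    by simp
qed

lemma module_hom_uminus:
  assumes "f \<in> module_hom R M N" "left_module R M" "left_module R N" "x \<in> carrier M"
  shows "f (\<ominus>\<^bsub>M\<^esub> x) = \<ominus>\<^bsub>N\<^esub> f x"
proof -
  interpret M: left_module R M by fact
  interpret N: left_module R N by fact
  show ?thesis
    using module_hom_smult[OF assms(1), of "\<ominus>\<^bsub>R\<^esub> \<one>\<^bsub>R\<^esub>" x] module_hom_closed[OF assms(1)] assms(4)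
    by (simp add: M.smult_minus_one N.smult_minus_one)
qed

lemma module_hom_minus:
  assumes "f \<in> module_hom R M N" "left_module R M" "left_module R N" "x \<in> carrier M" "y \<in> carrier M"
  shows "f (x \<ominus>\<^bsub>M\<^esub> y) = f x \<ominus>\<^bsub>N\<^esub> f y"
proof -
  interpret M: left_module R M by fact
  interpret N: left_module R N by fact
  show ?thesis
    using assms by (simp add: a_minus_def module_hom_add module_hom_uminus)
qed

lemma module_hom_comp:
  "f \<in> module_hom R L M \<Longrightarrow> g \<in> module_hom R M N \<Longrightarrow> (\<lambda>x. g (f x)) \<in> module_hom R L N"
  by (auto simp: module_hom_def Pi_iff)

lemma module_hom_id: "(\<lambda>x. x) \<in> module_hom R M M"
  by (auto simp: module_hom_def)

lemma module_hom_diff: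
  assumes "f \<in> module_hom R M N" "g \<in> module_hom R M N" "left_module R M" "left_module R N"
  shows "(\<lambda>x. f x \<ominus>\<^bsub>N\<^esub> g x) \<in> module_hom R M N"
proof -
  interpret M: left_module R M by fact
  interpret N: left_module R N by fact
  show ?thesis
  proof (rule module_homI)
    fix x y assume "x \<in> carrier M" "y \<in> carrier M"
    then show "f (x \<oplus>\<^bsub>M\<^esub> y) \<ominus>\<^bsub>N\<^esub> g (x \<oplus>\<^bsub>M\<^esub> y) = f x \<ominus>\<^bsub>N\<^esub> g x \<oplus>\<^bsub>N\<^esub> (f y \<ominus>\<^bsub>N\<^esub> g y)"
      using assms(1,2) by (simp add: module_hom_add module_hom_closed a_minus_def N.minus_add N.a_ac)
  next
    fix a x assume "a \<in> carrier R" "x \<in> carrier M"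
    then show "f (a \<odot>\<^bsub>M\<^esub> x) \<ominus>\<^bsub>N\<^esub> g (a \<odot>\<^bsub>M\<^esub> x) = a \<odot>\<^bsub>N\<^esub> (f x \<ominus>\<^bsub>N\<^esub> g x)"
      using assms(1,2) module_hom_closed[OF assms(1), of x] module_hom_closed[OF assms(2), of x]
      by (simp add: module_hom_smult a_minus_def N.smult_r_distr N.smult_uminus)
  qed (use assms in \<open>auto simp: module_hom_closed\<close>)
qed

lemma module_hom_sum:
  assumes "f \<in> module_hom R M N" "g \<in> module_hom R M N" "left_module R N"
  shows "(\<lambda>x. f x \<oplus>\<^bsub>N\<^esub> g x) \<in> module_hom R M N"
proof -
  interpret N: left_module R N by fact
  show ?thesis
    using assms(1,2) by (intro module_homI)
      (simp_all add: module_hom_add module_hom_closed module_hom_smult N.smult_r_distr N.a_ac)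
qed

lemma module_hom_restrict_source:
  "f \<in> module_hom R M N \<Longrightarrow> U \<subseteq> carrier M \<Longrightarrow> f \<in> module_hom R (M\<lparr>carrier := U\<rparr>) N"
  by (auto simp: module_hom_def subset_iff)

lemma module_hom_restrict_target:
  "f \<in> module_hom R M N \<Longrightarrow> f ` carrier M \<subseteq> U \<Longrightarrow> f \<in> module_hom R M (N\<lparr>carrier := U\<rparr>)"
  by (auto simp: module_hom_def)

lemma module_hom_extend_target:
  "f \<in> module_hom R M (N\<lparr>carrier := U\<rparr>) \<Longrightarrow> U \<subseteq> carrier N \<Longrightarrow> f \<in> module_hom R M N"
  by (auto simp: module_hom_def)

lemma module_hom_cong:
  assumes "f \<in> module_hom R M N" "left_module R M" "\<And>x. x \<in> carrier M \<Longrightarrow> g x = f x"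
  shows "g \<in> module_hom R M N"
proof -
  interpret M: left_module R M by fact
  show ?thesis
    using assms(1,3) by (intro module_homI)
      (simp_all add: module_hom_closed module_hom_add module_hom_smult)
qed

lemma submodule_image:
  assumes "f \<in> module_hom R M N" "left_module R M" "left_module R N" "submodule U R M"
  shows "submodule (f ` U) R N"
proof -
  interpret M: left_module R M by fact
  interpret N: left_module R N by fact
  have U: "U \<subseteq> carrier M" "\<zero>\<^bsub>M\<^esub> \<in> U" "\<And>x y. x \<in> U \<Longrightarrow> y \<in> U \<Longrightarrow> x \<oplus>\<^bsub>M\<^esub> y \<in> U"
    "\<And>a x. a \<in> carrier R \<Longrightarrow> x \<in> U \<Longrightarrow> a \<odot>\<^bsub>M\<^esub> x \<in> U"
    using assms(4) by (auto simp: M.submodule_iff)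
  show ?thesis
    unfolding N.submodule_iff
  proof (intro conjI ballI)
    show "f ` U \<subseteq> carrier N"
      using U(1) module_hom_closed[OF assms(1)] by auto
    show "\<zero>\<^bsub>N\<^esub> \<in> f ` U"
      using U(2) module_hom_zero[OF assms(1-3)] by (metis imageI)
  next
    fix x y assume "x \<in> f ` U" "y \<in> f ` U"
    then obtain x' y' where *: "x' \<in> U" "y' \<in> U" "x = f x'" "y = f y'" by blast
    have "f (x' \<oplus>\<^bsub>M\<^esub> y') \<in> f ` U"
      using U(3) * by blast
    then show "x \<oplus>\<^bsub>N\<^esub> y \<in> f ` U"
      using module_hom_add[OF assms(1), of x' y'] U(1) * by (simp add: subset_iff)
  next
    fix a x assume a: "a \<in> carrier R" and "x \<in> f ` U"
    then obtain x' where *: "x' \<in> U" "x = f x'" by blast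
    have "f (a \<odot>\<^bsub>M\<^esub> x') \<in> f ` U"
      using U(4) a * by blast
    then show "a \<odot>\<^bsub>N\<^esub> x \<in> f ` U"
      using module_hom_smult[OF assms(1), of a x'] a U(1) * by (simp add: subset_iff)
  qed
qed

lemma submodule_vimage:
  assumes "f \<in> module_hom R M N" "left_module R M" "left_module R N" "submodule V R N"
  shows "submodule {x \<in> carrier M. f x \<in> V} R M"
proof -
  interpret M: left_module R M by fact
  interpret N: left_module R N by fact
  show ?thesis
    using assms(4) module_hom_zero[OF assms(1-3)]
    unfolding M.submodule_iff N.submodule_iff
    by (simp add: module_hom_add[OF assms(1)] module_hom_smult[OF assms(1)])
qed

lemma submodule_kernel:
  assumes "f \<in> module_hom R M N" "left_module R M" "left_module R N"
  shows "submodule {x \<in> carrier M. f x = \<zero>\<^bsub>N\<^esub>} R M"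
  using submodule_vimage[OF assms left_module.submodule_zero[OF assms(3)]] by simp

lemma module_hom_factor_inj:
  assumes "left_module R M" "left_module R S" "left_module R N"
    and g: "g \<in> module_hom R M N" and i: "i \<in> module_hom R S N" "inj_on i (carrier S)"
    and sub: "g ` carrier M \<subseteq> i ` carrier S"
  obtains h where "h \<in> module_hom R M S" "\<And>x. x \<in> carrier M \<Longrightarrow> i (h x) = g x"
proof -
  interpret M: left_module R M by fact
  interpret S: left_module R S by fact
  define h where "h x = inv_into (carrier S) i (g x)" for x
  have h: "h x \<in> carrier S" "i (h x) = g x" if "x \<in> carrier M" for x
    using that sub by (auto simp: h_def image_subset_iff intro: inv_into_into f_inv_into_f)
  have "h \<in> module_hom R M S"
  proof (rule module_homI)
    fix x y assume "x \<in> carrier M" "y \<in> carrier M"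
    then show "h (x \<oplus>\<^bsub>M\<^esub> y) = h x \<oplus>\<^bsub>S\<^esub> h y"
      using h by (intro inj_onD[OF i(2)])
        (simp_all add: module_hom_add[OF i(1)] module_hom_add[OF g])
  next
    fix a x assume "a \<in> carrier R" "x \<in> carrier M"
    then show "h (a \<odot>\<^bsub>M\<^esub> x) = a \<odot>\<^bsub>S\<^esub> h x"
      using h by (intro inj_onD[OF i(2)])
        (simp_all add: module_hom_smult[OF i(1)] module_hom_smult[OF g])
  qed (rule h(1))
  then show thesis
    using that h(2) by blast
qed

lemma module_hom_inj_onI:
  assumes "left_module R M" "left_module R N" "f \<in> module_hom R M N"
    and "\<And>x. x \<in> carrier M \<Longrightarrow> f x = \<zero>\<^bsub>N\<^esub> \<Longrightarrow> x = \<zero>\<^bsub>M\<^esub>"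
  shows "inj_on f (carrier M)"
proof
  interpret M: left_module R M by fact
  interpret N: left_module R N by fact
  fix x y assume *: "x \<in> carrier M" "y \<in> carrier M" "f x = f y"
  then have "f (x \<ominus>\<^bsub>M\<^esub> y) = \<zero>\<^bsub>N\<^esub>"
    using assms(1-3) by (simp add: module_hom_minus N.minus_self module_hom_closed)
  then show "x = y"
    using * assms(4)[of "x \<ominus>\<^bsub>M\<^esub> y"] by (simp add: M.minus_eq_zero)
qed

lemma module_hom_factor_surj:
  assumes "left_module R M" "left_module R Y" "left_module R N"
    and g: "g \<in> module_hom R M N" and p: "p \<in> module_hom R M Y" "p ` carrier M = carrier Y"
    and kernel: "\<And>x. x \<in> carrier M \<Longrightarrow> p x = \<zero>\<^bsub>Y\<^esub> \<Longrightarrow> g x = \<zero>\<^bsub>N\<^esub>"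
  obtains h where "h \<in> module_hom R Y N" "\<And>x. x \<in> carrier M \<Longrightarrow> h (p x) = g x"
proof -
  interpret M: left_module R M by fact
  interpret Y: left_module R Y by fact
  interpret N: left_module R N by fact
  define h where "h y = g (inv_into (carrier M) p y)" for y
  have eq: "h (p x) = g x" if x: "x \<in> carrier M" for x
  proof -
    let ?x = "inv_into (carrier M) p (p x)"
    have x': "?x \<in> carrier M" "p ?x = p x"
      using x by (auto intro: inv_into_into f_inv_into_f)
    have "p (?x \<ominus>\<^bsub>M\<^esub> x) = \<zero>\<^bsub>Y\<^esub>"
      using x x' module_hom_closed[OF p(1)]
      by (simp add: module_hom_minus[OF p(1) assms(1,2)] Y.minus_self)
    then have "g (?x \<ominus>\<^bsub>M\<^esub> x) = \<zero>\<^bsub>N\<^esub>"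
      using x x'(1) by (intro kernel) simp_all
    then show ?thesis
      using x x'(1) module_hom_closed[OF g]
      by (simp add: h_def module_hom_minus[OF g assms(1,3)] N.minus_eq_zero)
  qed
  have "h \<in> module_hom R Y N"
  proof (rule module_homI)
    fix y assume "y \<in> carrier Y"
    then obtain x where "x \<in> carrier M" "y = p x" using p(2) by blast
    then show "h y \<in> carrier N"
      using eq module_hom_closed[OF g] by simp
  next
    fix y z assume "y \<in> carrier Y" "z \<in> carrier Y"
    then obtain x w where *: "x \<in> carrier M" "y = p x" "w \<in> carrier M" "z = p w" using p(2) by blast
    have "h (p (x \<oplus>\<^bsub>M\<^esub> w)) = h (p x) \<oplus>\<^bsub>N\<^esub> h (p w)"
      using * by (simp only: eq M.M.a_closed module_hom_add[OF g])
    then show "h (y \<oplus>\<^bsub>Y\<^esub> z) = h y \<oplus>\<^bsub>N\<^esub> h z"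
      using * by (simp only: module_hom_add[OF p(1)])
  next
    fix a y assume a: "a \<in> carrier R" and "y \<in> carrier Y"
    then obtain x where *: "x \<in> carrier M" "y = p x" using p(2) by blast
    have "h (p (a \<odot>\<^bsub>M\<^esub> x)) = a \<odot>\<^bsub>N\<^esub> h (p x)"
      using * a by (simp only: eq M.smult_closed module_hom_smult[OF g])
    then show "h (a \<odot>\<^bsub>Y\<^esub> y) = a \<odot>\<^bsub>N\<^esub> h y"
      using * a by (simp only: module_hom_smult[OF p(1)])
  qed
  then show thesis
    using eq by (rule that)
qed

section \<open>Length\<close>

text \<open>
  A chain of length \<open>n\<close> below \<open>U\<close> is a chain \<open>U 0 \<subset> \<dots> \<subset> U n = U\<close> of submodules.  The length of
  a submodule \<open>U\<close> is the maximal length of a chain below it.  Over a field this is the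
  dimension.
\<close>

inductive submodule_chain ::
    "('a, 'c) ring_scheme \<Rightarrow> ('a, 'm, 'd) module_scheme \<Rightarrow> nat \<Rightarrow> 'm set \<Rightarrow> bool"
  for R M where
  start: "submodule U R M \<Longrightarrow> submodule_chain R M 0 U"
| step: "submodule_chain R M n U \<Longrightarrow> U \<subset> V \<Longrightarrow> submodule V R M \<Longrightarrow> submodule_chain R M (Suc n) V"

definition finite_len ::
    "('a, 'c) ring_scheme \<Rightarrow> ('a, 'm, 'd) module_scheme \<Rightarrow> 'm set \<Rightarrow> bool" where
  "finite_len R M U \<longleftrightarrow> finite {n. submodule_chain R M n U}"

definition len :: "('a, 'c) ring_scheme \<Rightarrow> ('a, 'm, 'd) module_scheme \<Rightarrow> 'm set \<Rightarrow> nat" where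
  "len R M U = Max {n. submodule_chain R M n U}"

lemma submodule_chain_submodule: "submodule_chain R M n U \<Longrightarrow> submodule U R M"
  by (auto elim: submodule_chain.cases)

lemma submodule_chain_mono:
  assumes "submodule_chain R M n U" "U \<subseteq> V" "submodule V R M"
  shows "submodule_chain R M n V"
  using assms(1)
proof cases
  case (step m W)
  then show ?thesis
    using assms by (metis psubset_subset_trans submodule_chain.step)
qed (use assms submodule_chain.start in auto)

lemma finite_lenI: "(\<And>n. submodule_chain R M n U \<Longrightarrow> n \<le> b) \<Longrightarrow> finite_len R M U"
  unfolding finite_len_def by (rule finite_subset[of _ "{..b}"]) auto

lemma submodule_chain_le_len: "finite_len R M U \<Longrightarrow> submodule_chain R M n U \<Longrightarrow> n \<le> len R M U"
  unfolding finite_len_def len_def by (rule Max_ge) auto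

lemma submodule_chain_len:
  assumes "finite_len R M U" "submodule U R M"
  shows "submodule_chain R M (len R M U) U"
proof -
  have "Max {n. submodule_chain R M n U} \<in> {n. submodule_chain R M n U}"
    using assms by (intro Max_in) (auto simp: finite_len_def intro: submodule_chain.start)
  then show ?thesis by (simp add: len_def)
qed

lemma finite_len_mono:
  assumes "finite_len R M V" "U \<subseteq> V" "submodule V R M"
  shows "finite_len R M U"
  using assms by (intro finite_lenI[of _ _ _ "len R M V"])
    (auto intro: submodule_chain_le_len submodule_chain_mono)

lemma len_less:
  assumes "finite_len R M V" "submodule U R M" "submodule V R M" "U \<subset> V"
  shows "len R M U < len R M V"
proof -
  have "submodule_chain R M (Suc (len R M U)) V"
    using assms by (intro submodule_chain.step[OF submodule_chain_len])
      (auto intro: finite_len_mono)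
  then show ?thesis
    using submodule_chain_le_len[OF assms(1)] by fastforce
qed

lemma (in left_module) submodule_chain_zero: "submodule_chain R M n {\<zero>\<^bsub>M\<^esub>} \<Longrightarrow> n = 0"
proof (erule submodule_chain.cases)
  fix n U V assume "submodule_chain R M n U" and V: "{\<zero>\<^bsub>M\<^esub>} = V" "U \<subset> V"
  then have "\<zero>\<^bsub>M\<^esub> \<in> U"
    using submodule_chain_submodule[of R M n U] by (simp add: submodule_iff)
  then show ?thesis
    using V by blast
qed auto

lemma (in left_module) finite_len_zero: "finite_len R M {\<zero>\<^bsub>M\<^esub>}"
  by (rule finite_lenI[of _ _ _ 0]) (simp add: submodule_chain_zero)

lemma (in left_module) len_zero: "len R M {\<zero>\<^bsub>M\<^esub>} = 0"
  using submodule_chain_len[OF finite_len_zero submodule_zero] by (rule submodule_chain_zero)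

lemma (in left_module) len_eq_0:
  assumes "finite_len R M U" "submodule U R M" "len R M U = 0"
  shows "U = {\<zero>\<^bsub>M\<^esub>}"
proof (rule ccontr)
  assume "U \<noteq> {\<zero>\<^bsub>M\<^esub>}"
  then have "{\<zero>\<^bsub>M\<^esub>} \<subset> U"
    using assms(2) by (auto simp: submodule_iff)
  then show False
    using len_less[OF assms(1) submodule_zero assms(2)] assms(3) by simp
qed

lemma submodule_chain_of_submodule:
  assumes "left_module R M" "submodule U R M" "V \<subseteq> U"
  shows "submodule_chain R (M\<lparr>carrier := U\<rparr>) n V \<longleftrightarrow> submodule_chain R M n V"
proof -
  interpret M: left_module R M by fact
  show ?thesis
  proof
    show "submodule_chain R (M\<lparr>carrier := U\<rparr>) n V \<Longrightarrow> submodule_chain R M n V"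
      by (induction rule: submodule_chain.induct)
        (auto intro: submodule_chain.intros simp: M.submodule_of_submodule[OF assms(2)])
    have "submodule_chain R M n V \<Longrightarrow> V \<subseteq> U \<Longrightarrow> submodule_chain R (M\<lparr>carrier := U\<rparr>) n V"
    proof (induction rule: submodule_chain.induct)
      case (step n W W')
      then show ?case
        by (intro submodule_chain.step[of _ _ n W]) (auto simp: M.submodule_of_submodule[OF assms(2)])
    qed (auto intro: submodule_chain.start simp: M.submodule_of_submodule[OF assms(2)])
    then show "submodule_chain R M n V \<Longrightarrow> submodule_chain R (M\<lparr>carrier := U\<rparr>) n V"
      using assms(3) by blast
  qed
qed

lemma finite_len_of_submodule:
  assumes "left_module R M" "submodule U R M" "V \<subseteq> U"
  shows "finite_len R (M\<lparr>carrier := U\<rparr>) V \<longleftrightarrow> finite_len R M V"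
    and "len R (M\<lparr>carrier := U\<rparr>) V = len R M V"
  using submodule_chain_of_submodule[OF assms] by (simp_all add: finite_len_def len_def)

context
  fixes R :: "('a, 'c) ring_scheme" and M :: "('a, 'm) module" and N :: "('a, 'n) module" and f
  assumes M: "left_module R M" and N: "left_module R N" and f: "f \<in> module_hom R M N"
begin

interpretation M: left_module R M by (rule M)
interpretation N: left_module R N by (rule N)

text \<open>
  Under a homomorphism, every step of a chain becomes proper in the kernel or in the image.
\<close>

lemma submodule_eqI_kernel_image:
  assumes "submodule U R M" "submodule V R M" "U \<subseteq> V" "f ` U = f ` V"
    and "U \<inter> {x \<in> carrier M. f x = \<zero>\<^bsub>N\<^esub>} = V \<inter> {x \<in> carrier M. f x = \<zero>\<^bsub>N\<^esub>}"
  shows "U = V"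
proof
  show "V \<subseteq> U"
  proof
    fix v assume v: "v \<in> V"
    have V: "V \<subseteq> carrier M"
      using assms(2) by (simp add: M.submodule_iff)
    from v assms(4) obtain u where u: "u \<in> U" "f u = f v"
      by (metis imageE imageI)
    have uv: "u \<in> carrier M" "v \<in> carrier M"
      using u v V assms(3) by auto
    have "f (v \<ominus>\<^bsub>M\<^esub> u) = \<zero>\<^bsub>N\<^esub>"
      using u uv by (simp add: module_hom_minus[OF f M N] N.minus_self module_hom_closed[OF f])
    moreover have "v \<ominus>\<^bsub>M\<^esub> u \<in> V"
      using u v assms(3) by (intro M.submodule_minus[OF assms(2)]) auto
    ultimately have "v \<ominus>\<^bsub>M\<^esub> u \<in> U"
      using assms(5) V by auto
    then have "(v \<ominus>\<^bsub>M\<^esub> u) \<oplus>\<^bsub>M\<^esub> u \<in> U"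
      using u assms(1) by (simp add: M.submodule_iff)
    then show "v \<in> U"
      using uv by (simp add: M.minus_add_cancel)
  qed
qed (use assms in auto)

lemma submodule_chain_kernel_image:
  assumes "submodule_chain R M n V"
  obtains p q where "submodule_chain R M p (V \<inter> {x \<in> carrier M. f x = \<zero>\<^bsub>N\<^esub>})"
    "submodule_chain R N q (f ` V)" "n \<le> p + q"
  using assms
proof (induction arbitrary: thesis)
  case (start U)
  show ?case
    by (rule start.prems[of 0 0])
      (auto intro!: submodule_chain.start submodule_image[OF f M N] M.submodule_Int
        submodule_kernel[OF f M N] start.hyps)
next
  case (step n U V)
  let ?L = "{x \<in> carrier M. f x = \<zero>\<^bsub>N\<^esub>}"
  obtain p q where pq: "submodule_chain R M p (U \<inter> ?L)" "submodule_chain R N q (f ` U)" "n \<le> p + q"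
    using step.IH .
  have V: "submodule (V \<inter> ?L) R M" "submodule (f ` V) R N"
    by (intro M.submodule_Int submodule_kernel[OF f M N] step.hyps submodule_image[OF f M N])+
  show ?case
  proof (cases "U \<inter> ?L = V \<inter> ?L")
    case True
    then have "f ` U \<noteq> f ` V"
      using step.hyps submodule_eqI_kernel_image[of U V] submodule_chain_submodule by blast
    then have "f ` U \<subset> f ` V"
      using step.hyps by blast
    then show ?thesis
      using submodule_chain.step[OF pq(2) _ V(2)] pq(1,3) True by (intro step.prems[of p "Suc q"]) auto
  next
    case False
    then have "U \<inter> ?L \<subset> V \<inter> ?L"
      using step.hyps by blast
    moreover have "submodule_chain R N q (f ` V)"
      using step.hyps by (intro submodule_chain_mono[OF pq(2) _ V(2)]) auto
    ultimately show ?thesis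
      using submodule_chain.step[OF pq(1) _ V(1)] pq(3) by (intro step.prems[of "Suc p" q]) auto
  qed
qed

lemma submodule_chain_vimage:
  assumes U: "submodule U R M"
    and chain: "submodule_chain R M p (U \<inter> {x \<in> carrier M. f x = \<zero>\<^bsub>N\<^esub>})"
    and "submodule_chain R N q W" "W \<subseteq> f ` U"
  shows "submodule_chain R M (p + q) (U \<inter> {x \<in> carrier M. f x \<in> W})"
  using assms(3,4)
proof induction
  case (start W)
  then have "\<zero>\<^bsub>N\<^esub> \<in> W"
    by (simp add: N.submodule_iff)
  then have "U \<inter> {x \<in> carrier M. f x = \<zero>\<^bsub>N\<^esub>} \<subseteq> U \<inter> {x \<in> carrier M. f x \<in> W}"
    by auto
  then show ?case
    using submodule_chain_mono[OF chain]
      M.submodule_Int[OF U submodule_vimage[OF f M N start(1)]] by simp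
next
  case (step n W W')
  obtain w where "w \<in> W'" "w \<notin> W"
    using step.hyps by blast
  moreover from this obtain u where "u \<in> U" "f u = w"
    using step.prems by blast
  moreover have "U \<subseteq> carrier M"
    using U by (simp add: M.submodule_iff)
  ultimately have "U \<inter> {x \<in> carrier M. f x \<in> W} \<noteq> U \<inter> {x \<in> carrier M. f x \<in> W'}"
    by blast
  then have "U \<inter> {x \<in> carrier M. f x \<in> W} \<subset> U \<inter> {x \<in> carrier M. f x \<in> W'}"
    using step.hyps(2) by blast
  moreover have "submodule_chain R M (p + n) (U \<inter> {x \<in> carrier M. f x \<in> W})"
    using step.IH step.hyps(2) step.prems by simp
  ultimately show ?case
    using submodule_chain.step[OF _ _ M.submodule_Int[OF U submodule_vimage[OF f M N step.hyps(3)]]]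
    by simp
qed

lemma finite_len_extension:
  assumes "finite_len R M (U \<inter> {x \<in> carrier M. f x = \<zero>\<^bsub>N\<^esub>})" "finite_len R N (f ` U)"
  shows "finite_len R M U"
proof (rule finite_lenI)
  fix n assume "submodule_chain R M n U"
  then obtain p q where "submodule_chain R M p (U \<inter> {x \<in> carrier M. f x = \<zero>\<^bsub>N\<^esub>})"
    "submodule_chain R N q (f ` U)" "n \<le> p + q"
    by (rule submodule_chain_kernel_image)
  then show "n \<le> len R M (U \<inter> {x \<in> carrier M. f x = \<zero>\<^bsub>N\<^esub>}) + len R N (f ` U)"
    using submodule_chain_le_len[OF assms(1)] submodule_chain_le_len[OF assms(2)] by fastforce
qed

lemma submodule_chain_image:
  assumes "submodule U R M" "submodule_chain R N q (f ` U)"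
    and "submodule_chain R M p (U \<inter> {x \<in> carrier M. f x = \<zero>\<^bsub>N\<^esub>})"
  shows "submodule_chain R M (p + q) U"
proof -
  have "U \<inter> {x \<in> carrier M. f x \<in> f ` U} = U"
    using assms(1) by (auto simp: M.submodule_iff)
  then show ?thesis
    using submodule_chain_vimage[OF assms(1,3,2)] by simp
qed

lemma finite_len_image:
  assumes "finite_len R M U" "submodule U R M"
  shows "finite_len R N (f ` U)"
proof (rule finite_lenI)
  fix q assume "submodule_chain R N q (f ` U)"
  then have "submodule_chain R M (0 + q) U"
    by (rule submodule_chain_image[OF assms(2)])
      (intro submodule_chain.start M.submodule_Int submodule_kernel[OF f M N] assms)
  then show "q \<le> len R M U"
    using submodule_chain_le_len[OF assms(1)] by simp
qed

lemma len_kernel_image: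
  assumes "finite_len R M U" "submodule U R M"
  shows "len R M U = len R M (U \<inter> {x \<in> carrier M. f x = \<zero>\<^bsub>N\<^esub>}) + len R N (f ` U)"
proof -
  let ?L = "U \<inter> {x \<in> carrier M. f x = \<zero>\<^bsub>N\<^esub>}"
  have L: "submodule ?L R M"
    by (intro M.submodule_Int submodule_kernel[OF f M N] assms)
  have fin: "finite_len R M ?L"
    using finite_len_mono[OF assms(1) _ assms(2)] by blast
  note finI = finite_len_image[OF assms]
  obtain p q where pq: "submodule_chain R M p ?L" "submodule_chain R N q (f ` U)" "len R M U \<le> p + q"
    using submodule_chain_kernel_image[OF submodule_chain_len[OF assms]] .
  have "submodule_chain R M (len R M ?L + len R N (f ` U)) U"
    by (intro submodule_chain_image assms submodule_chain_len fin L finI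
        submodule_image[OF f M N])
  then show ?thesis
    using pq submodule_chain_le_len[OF fin pq(1)] submodule_chain_le_len[OF finI pq(2)]
      submodule_chain_le_len[OF assms(1)] by (meson add_mono le_antisym le_trans)
qed

text \<open>Lengths are preserved by homomorphisms that are injective on \<open>U\<close>.\<close>

lemma finite_len_inj:
  assumes "finite_len R N (f ` U)" "submodule U R M"
    and "\<And>x. x \<in> U \<Longrightarrow> f x = \<zero>\<^bsub>N\<^esub> \<Longrightarrow> x = \<zero>\<^bsub>M\<^esub>"
  shows "finite_len R M U" "len R M U = len R N (f ` U)"
proof -
  have "U \<inter> {x \<in> carrier M. f x = \<zero>\<^bsub>N\<^esub>} = {\<zero>\<^bsub>M\<^esub>}"
    using assms(2,3) module_hom_zero[OF f M N] by (auto simp: M.submodule_iff)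
  then show "finite_len R M U" "len R M U = len R N (f ` U)"
    using finite_len_extension[of U] len_kernel_image[of U] assms(1,2)
    by (simp_all add: M.finite_len_zero M.len_zero)
qed

end

text \<open>In a module of finite length, a property that can always be enlarged reaches the top.\<close>

lemma finite_len_climb:
  assumes fin: "finite_len R M T" and T: "submodule T R M"
    and start: "submodule U R M" "U \<subseteq> T" "P U"
    and climb: "\<And>U. submodule U R M \<Longrightarrow> U \<subseteq> T \<Longrightarrow> U \<noteq> T \<Longrightarrow> P U \<Longrightarrow>
      \<exists>V. submodule V R M \<and> U \<subset> V \<and> V \<subseteq> T \<and> P V"
  shows "P T"
proof -
  let ?Q = "\<lambda>U. submodule U R M \<and> U \<subseteq> T \<and> P U"
  have "\<exists>U. ?Q U \<and> (\<forall>V. ?Q V \<longrightarrow> len R M V \<le> len R M U)"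
  proof (rule ex_has_greatest_nat[where b = "Suc (len R M T)"])
    show "\<forall>V. ?Q V \<longrightarrow> len R M V < Suc (len R M T)"
      using len_less[OF fin _ T] by (metis less_Suc_eq psubsetI)
  qed (use start in auto)
  then obtain U where U: "?Q U" "\<And>V. ?Q V \<Longrightarrow> len R M V \<le> len R M U" by blast
  show ?thesis
  proof (rule ccontr)
    assume "\<not> P T"
    then have "U \<noteq> T" using U by auto
    then obtain V where V: "?Q V" "U \<subset> V"
      using climb[of U] U(1) by blast
    have "finite_len R M V"
      using finite_len_mono[OF fin _ T] V by blast
    then have "len R M U < len R M V"
      using U(1) V by (intro len_less) auto
    then show False
      using U(2)[OF V(1)] by simp
  qed
qed

section \<open>Free modules and finite generation\<close>

lemma direct_power_simps [simp]:
  "carrier (direct_power M n) = {..<n} \<rightarrow>\<^sub>E carrier M"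
  "\<zero>\<^bsub>direct_power M n\<^esub> = (\<lambda>i\<in>{..<n}. \<zero>\<^bsub>M\<^esub>)"
  "x \<oplus>\<^bsub>direct_power M n\<^esub> y = (\<lambda>i\<in>{..<n}. x i \<oplus>\<^bsub>M\<^esub> y i)"
  "a \<odot>\<^bsub>direct_power M n\<^esub> x = (\<lambda>i\<in>{..<n}. a \<odot>\<^bsub>M\<^esub> x i)"
  by (simp_all add: direct_power_def)

lemma regular_module_simps [simp]:
  "carrier (regular_module R) = carrier R" "\<zero>\<^bsub>regular_module R\<^esub> = \<zero>\<^bsub>R\<^esub>"
  "x \<oplus>\<^bsub>regular_module R\<^esub> y = x \<oplus>\<^bsub>R\<^esub> y" "a \<odot>\<^bsub>regular_module R\<^esub> x = a \<otimes>\<^bsub>R\<^esub> x"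
  by (simp_all add: regular_module_def)

lemma direct_power_eqI:
  "x \<in> {..<n} \<rightarrow>\<^sub>E A \<Longrightarrow> y \<in> {..<n} \<rightarrow>\<^sub>E B \<Longrightarrow> (\<And>i. i < n \<Longrightarrow> x i = y i) \<Longrightarrow> x = y"
  by (rule PiE_ext[of _ "{..<n}" "\<lambda>_. A"]) (auto simp: PiE_iff)

lemma left_module_regular: "ring R \<Longrightarrow> left_module R (regular_module R)"
proof (rule left_moduleI)
  assume "ring R"
  then interpret ring R .
  show "x \<oplus>\<^bsub>regular_module R\<^esub> y = y \<oplus>\<^bsub>regular_module R\<^esub> x"
    if "x \<in> carrier (regular_module R)" "y \<in> carrier (regular_module R)" for x y
    using that by (simp add: a_comm)
qed (auto simp: ring.is_monoid ring.ring_simprules)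

lemma left_module_direct_power:
  assumes "left_module R M"
  shows "left_module R (direct_power M n)"
proof -
  interpret M: left_module R M by fact
  show ?thesis
  proof (rule left_moduleI)
    fix x assume x: "x \<in> carrier (direct_power M n)"
    then show "\<zero>\<^bsub>direct_power M n\<^esub> \<oplus>\<^bsub>direct_power M n\<^esub> x = x" "\<one>\<^bsub>R\<^esub> \<odot>\<^bsub>direct_power M n\<^esub> x = x"
      by (auto simp: PiE_iff extensional_def fun_eq_iff restrict_def)
    show "\<zero>\<^bsub>R\<^esub> \<odot>\<^bsub>direct_power M n\<^esub> x = \<zero>\<^bsub>direct_power M n\<^esub>"
      using x by (auto simp: PiE_iff intro!: restrict_ext)
  next
    fix x y assume "x \<in> carrier (direct_power M n)" "y \<in> carrier (direct_power M n)"
    then show "x \<oplus>\<^bsub>direct_power M n\<^esub> y = y \<oplus>\<^bsub>direct_power M n\<^esub> x"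
      by (auto simp: PiE_iff M.a_comm intro!: restrict_ext)
  qed (use M.R.ring_axioms in \<open>auto simp: PiE_iff M.a_assoc M.smult_l_distr M.smult_r_distr
      M.smult_assoc1 intro!: restrict_ext\<close>)
qed

text \<open>The linear combination of \<open>y 0, \<dots>, y (n - 1)\<close> with coefficients \<open>v\<close>.\<close>

primrec lin_comb :: "('a, 'm, 'd) module_scheme \<Rightarrow> nat \<Rightarrow> (nat \<Rightarrow> 'm) \<Rightarrow> (nat \<Rightarrow> 'a) \<Rightarrow> 'm" where
  "lin_comb M 0 y v = \<zero>\<^bsub>M\<^esub>"
| "lin_comb M (Suc n) y v = lin_comb M n y v \<oplus>\<^bsub>M\<^esub> v n \<odot>\<^bsub>M\<^esub> y n"

text \<open>The \<open>i\<close>-th unit vector of the free module of rank \<open>n\<close>.\<close>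

definition unit_vector :: "('a, 'c) ring_scheme \<Rightarrow> nat \<Rightarrow> nat \<Rightarrow> nat \<Rightarrow> 'a" where
  "unit_vector R n i = (\<lambda>j\<in>{..<n}. if j = i then \<one>\<^bsub>R\<^esub> else \<zero>\<^bsub>R\<^esub>)"

lemma lin_comb_cong:
  "(\<And>i. i < n \<Longrightarrow> y i = z i) \<Longrightarrow> (\<And>i. i < n \<Longrightarrow> v i = w i) \<Longrightarrow> lin_comb M n y v = lin_comb M n z w"
  by (induction n) auto

lemma lin_comb_in_submodule:
  assumes "left_module R M" "submodule U R M" "\<And>i. i < n \<Longrightarrow> v i \<odot>\<^bsub>M\<^esub> y i \<in> U"
  shows "lin_comb M n y v \<in> U"
  using assms(3) assms(2) by (induction n) (auto simp: left_module.submodule_iff[OF assms(1)])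

context left_module
begin

lemma lin_comb_closed:
  "(\<And>i. i < n \<Longrightarrow> y i \<in> carrier M) \<Longrightarrow> (\<And>i. i < n \<Longrightarrow> v i \<in> carrier R) \<Longrightarrow>
    lin_comb M n y v \<in> carrier M"
  by (intro lin_comb_in_submodule[OF left_module_axioms submodule_carrier]) auto

lemma lin_comb_unit_vector:
  assumes "\<And>i. i < n \<Longrightarrow> y i \<in> carrier M" "i < n"
  shows "lin_comb M n y (unit_vector R n i) = y i"
proof -
  have "k \<le> n \<Longrightarrow> lin_comb M k y (unit_vector R n i) = (if i < k then y i else \<zero>\<^bsub>M\<^esub>)" for k
    using assms by (induction k) (auto simp: unit_vector_def less_Suc_eq)
  then show ?thesis
    using assms(2) by simp
qed

end

lemma lin_comb_hom:
  assumes "left_module R M" "\<And>i. i < n \<Longrightarrow> y i \<in> carrier M"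
  shows "lin_comb M n y \<in> module_hom R (free_module R n) M"
proof -
  interpret M: left_module R M by fact
  have add: "lin_comb M n y (\<lambda>i. v i \<oplus>\<^bsub>R\<^esub> w i) = lin_comb M n y v \<oplus>\<^bsub>M\<^esub> lin_comb M n y w"
    if "\<And>i. i < n \<Longrightarrow> y i \<in> carrier M" "\<And>i. i < n \<Longrightarrow> v i \<in> carrier R"
      "\<And>i. i < n \<Longrightarrow> w i \<in> carrier R" for n v w
    using that
    by (induction n) (simp_all add: M.smult_l_distr M.lin_comb_closed M.M.a_ac)
  have smult: "lin_comb M n y (\<lambda>i. a \<otimes>\<^bsub>R\<^esub> v i) = a \<odot>\<^bsub>M\<^esub> lin_comb M n y v"
    if "a \<in> carrier R" "\<And>i. i < n \<Longrightarrow> y i \<in> carrier M" "\<And>i. i < n \<Longrightarrow> v i \<in> carrier R" for n a v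
    using that
    by (induction n) (simp_all add: M.smult_r_distr M.smult_assoc1 M.lin_comb_closed)
  show ?thesis
  proof (rule module_homI)
    fix v w assume "v \<in> carrier (free_module R n)" "w \<in> carrier (free_module R n)"
    then show "lin_comb M n y (v \<oplus>\<^bsub>free_module R n\<^esub> w) = lin_comb M n y v \<oplus>\<^bsub>M\<^esub> lin_comb M n y w"
      using assms(2)
      by (subst add[symmetric]) (auto simp: PiE_iff intro!: lin_comb_cong)
  next
    fix a v assume "a \<in> carrier R" "v \<in> carrier (free_module R n)"
    then show "lin_comb M n y (a \<odot>\<^bsub>free_module R n\<^esub> v) = a \<odot>\<^bsub>M\<^esub> lin_comb M n y v"
      using assms(2) by (subst smult[symmetric]) (auto simp: PiE_iff intro!: lin_comb_cong)
  qed (use assms(2) in \<open>auto intro!: M.lin_comb_closed\<close>)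
qed

lemma unit_vector_closed: "ring R \<Longrightarrow> unit_vector R n i \<in> carrier (free_module R n)"
  by (auto simp: unit_vector_def ring.ring_simprules)

text \<open>A homomorphism on a free module is determined by its values on the unit vectors.\<close>

lemma module_hom_free:
  assumes "left_module R M" and f: "f \<in> module_hom R (free_module R n) M"
    and v: "v \<in> carrier (free_module R n)"
  shows "f v = lin_comb M n (\<lambda>i. f (unit_vector R n i)) v"
proof -
  interpret M: left_module R M by fact
  interpret F: left_module R "free_module R n"
    by (intro left_module_direct_power left_module_regular M.R.ring_axioms)
  define t where "t k = (\<lambda>i\<in>{..<n}. if i < k then v i else \<zero>\<^bsub>R\<^esub>)" for k
  have t: "t k \<in> carrier (free_module R n)" for k
    using v by (auto simp: t_def PiE_iff)
  have "f (t k) = lin_comb M k (\<lambda>i. f (unit_vector R n i)) v" if "k \<le> n" for k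
    using that
  proof (induction k)
    case 0
    have "t 0 = \<zero>\<^bsub>free_module R n\<^esub>"
      by (simp add: t_def)
    then have "f (t 0) = \<zero>\<^bsub>M\<^esub>"
      using module_hom_zero[OF f F.left_module_axioms assms(1)] by simp
    then show ?case by simp
  next
    case (Suc k)
    then have vk: "v k \<in> carrier R" using v by (auto simp: PiE_iff)
    have "t (Suc k) = t k \<oplus>\<^bsub>free_module R n\<^esub> (v k \<odot>\<^bsub>free_module R n\<^esub> unit_vector R n k)"
      using v Suc by (auto simp: t_def unit_vector_def PiE_iff less_Suc_eq intro!: restrict_ext)
    then have "f (t (Suc k)) = f (t k) \<oplus>\<^bsub>M\<^esub> v k \<odot>\<^bsub>M\<^esub> f (unit_vector R n k)"
      using t vk unit_vector_closed[OF M.R.ring_axioms, of n k] F.smult_closed[OF vk]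
      by (simp only: module_hom_add[OF f] module_hom_smult[OF f])
    then show ?case
      using Suc by simp
  qed
  moreover have "t n = v"
    using v by (auto simp: t_def PiE_iff extensional_def fun_eq_iff restrict_def)
  ultimately show ?thesis
    by (metis order_refl)
qed

lemma module_hom_free_eqI:
  assumes "left_module R M" "f \<in> module_hom R (free_module R n) M" "g \<in> module_hom R (free_module R n) M"
    and "\<And>i. i < n \<Longrightarrow> f (unit_vector R n i) = g (unit_vector R n i)"
    and "v \<in> carrier (free_module R n)"
  shows "f v = g v"
  using assms by (simp only: module_hom_free[OF assms(1)]) (auto intro!: lin_comb_cong)

lemma free_module_lift:
  assumes "left_module R L" "left_module R N" and U: "submodule U R L"
    and g: "g \<in> module_hom R L N" and f: "f \<in> module_hom R (free_module R n) N"
    and sub: "f ` carrier (free_module R n) \<subseteq> g ` U"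
  obtains h where "h \<in> module_hom R (free_module R n) L"
    "\<And>v. v \<in> carrier (free_module R n) \<Longrightarrow> h v \<in> U"
    "\<And>v. v \<in> carrier (free_module R n) \<Longrightarrow> g (h v) = f v"
proof -
  interpret L: left_module R L by fact
  interpret N: left_module R N by fact
  have UL: "U \<subseteq> carrier L"
    using U by (simp add: L.submodule_iff)
  have "\<forall>i. \<exists>l\<in>U. g l = f (unit_vector R n i)"
    using sub unit_vector_closed[OF L.R.ring_axioms] by (metis image_iff subset_iff)
  then obtain l where l: "\<And>i. l i \<in> U" "\<And>i. g (l i) = f (unit_vector R n i)" by metis
  define h where "h = lin_comb L n l"
  have h: "h \<in> module_hom R (free_module R n) L"
    unfolding h_def using l UL by (intro lin_comb_hom[OF assms(1)]) auto
  show thesis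
  proof (rule that[OF h])
    fix v assume v: "v \<in> carrier (free_module R n)"
    show "h v \<in> U"
      unfolding h_def using v l U UL
      by (intro lin_comb_in_submodule[OF assms(1) U]) (auto simp: L.submodule_iff PiE_iff)
    show "g (h v) = f v"
    proof (rule module_hom_free_eqI[OF assms(2) module_hom_comp[OF h g] f _ v])
      fix i assume "i < n"
      then show "g (h (unit_vector R n i)) = f (unit_vector R n i)"
        unfolding h_def using l UL by (subst L.lin_comb_unit_vector) auto
    qed
  qed
qed

text \<open>Finite generation, expressed by a surjection from a free module of finite rank.\<close>

definition free_cover :: "('a, 'c) ring_scheme \<Rightarrow> ('a, 'm) module \<Rightarrow> bool" where
  "free_cover R M \<longleftrightarrow>
    (\<exists>n. \<exists>g\<in>module_hom R (free_module R n) M. g ` carrier (free_module R n) = carrier M)"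

lemma free_cover_of_finitely_generated:
  assumes "left_module R M" "finitely_generated R M"
  shows "free_cover R M"
proof -
  interpret M: left_module R M by fact
  from assms(2) obtain S where S: "finite S" "S \<subseteq> carrier M"
    "carrier M = {(\<Oplus>\<^bsub>M\<^esub>s\<in>S. c s \<odot>\<^bsub>M\<^esub> s) | c. c \<in> S \<rightarrow> carrier R}"
    unfolding finitely_generated_def by blast
  obtain h where h: "bij_betw h {..<card S} S"
    using ex_bij_betw_nat_finite[OF S(1)] by (auto simp: atLeast0LessThan)
  have hM: "i < card S \<Longrightarrow> h i \<in> carrier M" for i
    using bij_betw_apply[OF h] S(2) by auto
  have sum: "lin_comb M k h v = (\<Oplus>\<^bsub>M\<^esub>i\<in>{..<k}. v i \<odot>\<^bsub>M\<^esub> h i)"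
    if "k \<le> card S" "\<And>i. i < card S \<Longrightarrow> v i \<in> carrier R" for k v
    using that
  proof (induction k)
    case (Suc k)
    then show ?case
      using hM by (simp add: lessThan_Suc M.M.finsum_insert Pi_iff M.a_comm)
  qed simp
  have "carrier M \<subseteq> lin_comb M (card S) h ` carrier (free_module R (card S))"
  proof
    fix x assume "x \<in> carrier M"
    then obtain c where c: "c \<in> S \<rightarrow> carrier R" "x = (\<Oplus>\<^bsub>M\<^esub>s\<in>S. c s \<odot>\<^bsub>M\<^esub> s)"
      using S(3) by blast
    define v where "v = (\<lambda>i\<in>{..<card S}. c (h i))"
    have v: "v \<in> carrier (free_module R (card S))"
      using c(1) bij_betw_apply[OF h] by (auto simp: v_def)
    have "lin_comb M (card S) h v = (\<Oplus>\<^bsub>M\<^esub>i\<in>{..<card S}. v i \<odot>\<^bsub>M\<^esub> h i)"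
      using v by (intro sum) (auto simp: PiE_iff)
    also have "\<dots> = (\<Oplus>\<^bsub>M\<^esub>i\<in>{..<card S}. c (h i) \<odot>\<^bsub>M\<^esub> h i)"
      using c(1) bij_betw_apply[OF h] hM
      by (intro M.M.finsum_cong') (auto simp: v_def)
    also have "\<dots> = (\<Oplus>\<^bsub>M\<^esub>s\<in>h ` {..<card S}. c s \<odot>\<^bsub>M\<^esub> s)"
      using c(1) h S(2)
      by (intro M.M.finsum_reindex[symmetric]) (auto simp: bij_betw_def)
    finally show "x \<in> lin_comb M (card S) h ` carrier (free_module R (card S))"
      using c(2) h v by (intro image_eqI[of _ _ v]) (simp_all add: bij_betw_def)
  qed
  moreover have "lin_comb M (card S) h ` carrier (free_module R (card S)) \<subseteq> carrier M"
    using lin_comb_hom[OF assms(1), of "card S" h] hM by (auto simp: module_hom_def)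
  ultimately show ?thesis
    using lin_comb_hom[OF assms(1), of "card S" h] hM unfolding free_cover_def by blast
qed

lemma finite_len_direct_power:
  assumes "left_module R M" "finite_len R M (carrier M)"
  shows "finite_len R (direct_power M n) (carrier (direct_power M n))"
proof -
  interpret M: left_module R M by fact
  let ?P = "direct_power M n"
  interpret P: left_module R ?P
    by (rule left_module_direct_power) fact
  let ?U = "\<lambda>k. {x \<in> carrier ?P. \<forall>i. k \<le> i \<and> i < n \<longrightarrow> x i = \<zero>\<^bsub>M\<^esub>}"
  have "k \<le> n \<Longrightarrow> finite_len R ?P (?U k)" for k
  proof (induction k)
    case 0
    have U0: "?U 0 = {\<zero>\<^bsub>?P\<^esub>}"
    proof (intro equalityI subsetI)
      fix x assume "x \<in> ?U 0"
      then have x: "x \<in> {..<n} \<rightarrow>\<^sub>E carrier M" "\<forall>i<n. x i = \<zero>\<^bsub>M\<^esub>"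
        by simp_all
      have "x = \<zero>\<^bsub>?P\<^esub>"
        using x(2) by (intro direct_power_eqI[OF x(1), of _ "carrier M"]) simp_all
      then show "x \<in> {\<zero>\<^bsub>?P\<^esub>}" by simp
    qed simp
    show ?case
      unfolding U0 by (rule P.finite_len_zero)
  next
    case (Suc k)
    have f: "(\<lambda>x. x k) \<in> module_hom R ?P M"
      using Suc.prems by (intro module_homI) (auto simp: PiE_iff)
    have im: "(\<lambda>x. x k) ` ?U (Suc k) \<subseteq> carrier M"
      using Suc.prems by (auto simp: PiE_iff)
    show ?case
    proof (rule finite_len_extension[OF P.left_module_axioms assms(1) f])
      have "?U (Suc k) \<inter> {x \<in> carrier ?P. x k = \<zero>\<^bsub>M\<^esub>} = ?U k"
      proof -
        have "(\<forall>i. k \<le> i \<and> i < n \<longrightarrow> x i = \<zero>\<^bsub>M\<^esub>) \<longleftrightarrow>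
            x k = \<zero>\<^bsub>M\<^esub> \<and> (\<forall>i. Suc k \<le> i \<and> i < n \<longrightarrow> x i = \<zero>\<^bsub>M\<^esub>)" for x
          using Suc.prems by (metis Suc_le_eq order_refl order_le_less)
        then show ?thesis by blast
      qed
      then show "finite_len R ?P (?U (Suc k) \<inter> {x \<in> carrier ?P. x k = \<zero>\<^bsub>M\<^esub>})"
        using Suc by simp
      show "finite_len R M ((\<lambda>x. x k) ` ?U (Suc k))"
        by (rule finite_len_mono[OF assms(2) im M.submodule_carrier])
    qed
  qed
  from this[OF order_refl] have "finite_len R ?P (?U n)" .
  moreover have Un: "?U n = carrier ?P"
  proof -
    have "\<not> (n \<le> i \<and> i < n)" for i by simp
    then show ?thesis by blast
  qed
  ultimately show ?thesis
    by (simp only:)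
qed

lemma finite_len_of_free_cover:
  assumes "left_module R M" "free_cover R M" "finite_len R (regular_module R) (carrier R)"
  shows "finite_len R M (carrier M)"
proof -
  interpret M: left_module R M by fact
  from assms(2) obtain n g where g: "g \<in> module_hom R (free_module R n) M"
    "g ` carrier (free_module R n) = carrier M"
    unfolding free_cover_def by blast
  have F: "left_module R (free_module R n)"
    by (intro left_module_direct_power left_module_regular M.R.ring_axioms)
  have "finite_len R M (g ` carrier (free_module R n))"
    using assms(3) left_module_regular[OF M.R.ring_axioms]
    by (intro finite_len_image[OF F assms(1) g(1)] left_module.submodule_carrier[OF F]
        finite_len_direct_power) simp_all
  then show ?thesis
    by (simp only: g(2))
qed

text \<open>A module of finite length is noetherian; in particular it is finitely generated.\<close>

lemma free_cover_of_finite_len: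
  assumes "left_module R M" "finite_len R M (carrier M)"
  shows "free_cover R M"
proof -
  interpret M: left_module R M by fact
  let ?P = "\<lambda>U. \<exists>n y. (\<forall>i. y i \<in> carrier M) \<and> U = lin_comb M n y ` carrier (free_module R n)"
  have "?P (carrier M)"
  proof (rule finite_len_climb[where P = ?P, OF assms(2) M.submodule_carrier M.submodule_zero])
    show "?P {\<zero>\<^bsub>M\<^esub>}"
      by (intro exI[of _ 0] exI[of _ "\<lambda>_. \<zero>\<^bsub>M\<^esub>"]) auto
    fix U assume U: "submodule U R M" "U \<subseteq> carrier M" "U \<noteq> carrier M" "?P U"
    then obtain n y where ny: "\<And>i. y i \<in> carrier M" "U = lin_comb M n y ` carrier (free_module R n)"
      by blast
    obtain x where x: "x \<in> carrier M" "x \<notin> U"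
      using U by blast
    define z where "z = y(n := x)"
    define V where "V = lin_comb M (Suc n) z ` carrier (free_module R (Suc n))"
    have z: "z i \<in> carrier M" for i
      using ny x by (simp add: z_def)
    have lin: "lin_comb M (Suc n) z v = lin_comb M n y v \<oplus>\<^bsub>M\<^esub> v n \<odot>\<^bsub>M\<^esub> x" for v
      using lin_comb_cong[of n z y v v M] by (simp add: z_def)
    have "U \<subseteq> V"
    proof
      fix u assume "u \<in> U"
      then obtain v where v: "v \<in> carrier (free_module R n)" "u = lin_comb M n y v"
        using ny by blast
      have "lin_comb M (Suc n) z (v(n := \<zero>\<^bsub>R\<^esub>)) = u"
        unfolding lin using v x ny lin_comb_cong[of n y y "v(n := \<zero>\<^bsub>R\<^esub>)" v M]
        by (auto simp: PiE_iff intro!: M.r_zero M.lin_comb_closed)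
      moreover have "v(n := \<zero>\<^bsub>R\<^esub>) \<in> carrier (free_module R (Suc n))"
        using v by (auto simp: PiE_iff extensional_def)
      ultimately show "u \<in> V"
        unfolding V_def by blast
    qed
    moreover have "x \<in> V"
    proof -
      have "lin_comb M (Suc n) z (unit_vector R (Suc n) n) = x"
        using M.lin_comb_unit_vector[of "Suc n" z n] z by (simp add: z_def)
      then show ?thesis
        unfolding V_def using unit_vector_closed[OF M.R.ring_axioms] by blast
    qed
    moreover have "submodule V R M"
      unfolding V_def using z
      by (intro submodule_image[OF lin_comb_hom] M.left_module_axioms left_module_direct_power
          left_module_regular M.R.ring_axioms left_module.submodule_carrier) auto
    moreover have "?P V"
      unfolding V_def using z by blast
    moreover from calculation have "V \<subseteq> carrier M"
      by (simp add: M.submodule_iff)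
    ultimately show "\<exists>V. submodule V R M \<and> U \<subset> V \<and> V \<subseteq> carrier M \<and> ?P V"
      using x by (intro exI[of _ V] conjI psubsetI) blast+
  qed auto
  then show ?thesis
    unfolding free_cover_def using lin_comb_hom[OF assms(1)] by metis
qed

section \<open>Quotient modules\<close>

text \<open>
  The elements of the quotient \<open>M/U\<close> are chosen representatives of the cosets, so that the quotient
  has the same element type as \<open>M\<close>.
\<close>

definition coset_rep :: "('a, 'm, 'd) module_scheme \<Rightarrow> 'm set \<Rightarrow> 'm \<Rightarrow> 'm" where
  "coset_rep M U x = (SOME y. y \<in> carrier M \<and> x \<ominus>\<^bsub>M\<^esub> y \<in> U)"

definition quotient_module :: "('a, 'm, 'd) module_scheme \<Rightarrow> 'm set \<Rightarrow> ('a, 'm) module" where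
  "quotient_module M U = \<lparr>
    carrier = coset_rep M U ` carrier M,
    monoid.mult = undefined, monoid.one = undefined,
    ring.zero = coset_rep M U \<zero>\<^bsub>M\<^esub>,
    ring.add = (\<lambda>x y. coset_rep M U (x \<oplus>\<^bsub>M\<^esub> y)),
    smult = (\<lambda>a x. coset_rep M U (a \<odot>\<^bsub>M\<^esub> x))\<rparr>"

lemma quotient_module_simps [simp]:
  "carrier (quotient_module M U) = coset_rep M U ` carrier M"
  "\<zero>\<^bsub>quotient_module M U\<^esub> = coset_rep M U \<zero>\<^bsub>M\<^esub>"
  "x \<oplus>\<^bsub>quotient_module M U\<^esub> y = coset_rep M U (x \<oplus>\<^bsub>M\<^esub> y)"
  "a \<odot>\<^bsub>quotient_module M U\<^esub> x = coset_rep M U (a \<odot>\<^bsub>M\<^esub> x)"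
  by (simp_all add: quotient_module_def)

context left_module
begin

lemma minus_zero_right: "x \<in> carrier M \<Longrightarrow> x \<ominus>\<^bsub>M\<^esub> \<zero>\<^bsub>M\<^esub> = x"
  using minus_add_cancel[of x "\<zero>\<^bsub>M\<^esub>"] by simp

lemma minus_minus_cancel:
  "x \<in> carrier M \<Longrightarrow> y \<in> carrier M \<Longrightarrow> z \<in> carrier M \<Longrightarrow> (x \<ominus>\<^bsub>M\<^esub> y) \<oplus>\<^bsub>M\<^esub> (y \<ominus>\<^bsub>M\<^esub> z) = x \<ominus>\<^bsub>M\<^esub> z"
  by (metis M.add.m_assoc M.add.inv_closed a_minus_def minus_add_cancel M.minus_closed)

lemma coset_rep:
  assumes "submodule U R M" "x \<in> carrier M"
  shows "coset_rep M U x \<in> carrier M" "x \<ominus>\<^bsub>M\<^esub> coset_rep M U x \<in> U"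
proof -
  have "x \<in> carrier M \<and> x \<ominus>\<^bsub>M\<^esub> x \<in> U"
    using assms by (simp add: minus_self submodule_iff)
  then have "coset_rep M U x \<in> carrier M \<and> x \<ominus>\<^bsub>M\<^esub> coset_rep M U x \<in> U"
    unfolding coset_rep_def by (rule someI)
  then show "coset_rep M U x \<in> carrier M" "x \<ominus>\<^bsub>M\<^esub> coset_rep M U x \<in> U" by auto
qed

lemma coset_rep_eq:
  assumes U: "submodule U R M" and x: "x \<in> carrier M" and y: "y \<in> carrier M"
  shows "coset_rep M U x = coset_rep M U y \<longleftrightarrow> x \<ominus>\<^bsub>M\<^esub> y \<in> U"
proof
  have sym: "y \<ominus>\<^bsub>M\<^esub> x \<in> U" if "x \<ominus>\<^bsub>M\<^esub> y \<in> U" "x \<in> carrier M" "y \<in> carrier M" for x y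
    using submodule_uminus[OF U that(1)] that(2,3) by (simp add: a_minus_def M.minus_add M.a_comm)
  have trans: "x \<ominus>\<^bsub>M\<^esub> z \<in> U" if "x \<ominus>\<^bsub>M\<^esub> y \<in> U" "y \<ominus>\<^bsub>M\<^esub> z \<in> U"
    "x \<in> carrier M" "y \<in> carrier M" "z \<in> carrier M" for x y z
    using minus_minus_cancel[OF that(3-5)] that(1,2) U by (metis submodule_iff)
  {
    assume "coset_rep M U x = coset_rep M U y"
    then show "x \<ominus>\<^bsub>M\<^esub> y \<in> U"
      using coset_rep[OF U x] coset_rep[OF U y] sym trans x y by metis
  next
    assume "x \<ominus>\<^bsub>M\<^esub> y \<in> U"
    then have "(z \<in> carrier M \<and> x \<ominus>\<^bsub>M\<^esub> z \<in> U) = (z \<in> carrier M \<and> y \<ominus>\<^bsub>M\<^esub> z \<in> U)" for z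
      using sym trans x y by metis
    then show "coset_rep M U x = coset_rep M U y"
      unfolding coset_rep_def by simp
  }
qed

lemma coset_rep_eq_zero:
  "submodule U R M \<Longrightarrow> x \<in> carrier M \<Longrightarrow> coset_rep M U x = coset_rep M U \<zero>\<^bsub>M\<^esub> \<longleftrightarrow> x \<in> U"
  by (simp add: coset_rep_eq minus_zero_right)

lemma coset_rep_idem:
  "submodule U R M \<Longrightarrow> x \<in> carrier M \<Longrightarrow> coset_rep M U (coset_rep M U x) = coset_rep M U x"
  using coset_rep_eq[of U x "coset_rep M U x"] coset_rep[of U x] by simp

lemma coset_rep_add:
  assumes U: "submodule U R M" and "x \<in> carrier M" "y \<in> carrier M"
  shows "coset_rep M U (coset_rep M U x \<oplus>\<^bsub>M\<^esub> y) = coset_rep M U (x \<oplus>\<^bsub>M\<^esub> y)"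
    and "coset_rep M U (x \<oplus>\<^bsub>M\<^esub> coset_rep M U y) = coset_rep M U (x \<oplus>\<^bsub>M\<^esub> y)"
proof -
  have *: "coset_rep M U (x \<oplus>\<^bsub>M\<^esub> y) = coset_rep M U (coset_rep M U x \<oplus>\<^bsub>M\<^esub> y)"
    if "x \<in> carrier M" "y \<in> carrier M" for x y
  proof -
    have "(x \<oplus>\<^bsub>M\<^esub> y) \<ominus>\<^bsub>M\<^esub> (coset_rep M U x \<oplus>\<^bsub>M\<^esub> y) = x \<ominus>\<^bsub>M\<^esub> coset_rep M U x"
      using that coset_rep[OF U, of x]
      by (simp add: a_minus_def M.minus_add M.a_ac M.r_neg1 M.r_neg2)
    then show ?thesis
      using that coset_rep[OF U, of x] by (simp add: coset_rep_eq[OF U])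
  qed
  show "coset_rep M U (coset_rep M U x \<oplus>\<^bsub>M\<^esub> y) = coset_rep M U (x \<oplus>\<^bsub>M\<^esub> y)"
    "coset_rep M U (x \<oplus>\<^bsub>M\<^esub> coset_rep M U y) = coset_rep M U (x \<oplus>\<^bsub>M\<^esub> y)"
    using *[of x y] *[of y x] assms(2,3) coset_rep[OF U, of y] by (simp_all add: M.a_comm)
qed

lemma coset_rep_smult:
  assumes U: "submodule U R M" and "a \<in> carrier R" "x \<in> carrier M"
  shows "coset_rep M U (a \<odot>\<^bsub>M\<^esub> coset_rep M U x) = coset_rep M U (a \<odot>\<^bsub>M\<^esub> x)"
proof -
  have "a \<odot>\<^bsub>M\<^esub> x \<ominus>\<^bsub>M\<^esub> a \<odot>\<^bsub>M\<^esub> coset_rep M U x = a \<odot>\<^bsub>M\<^esub> (x \<ominus>\<^bsub>M\<^esub> coset_rep M U x)"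
    using assms coset_rep[OF U, of x] by (simp add: a_minus_def smult_r_distr smult_uminus)
  also have "\<dots> \<in> U"
    using assms coset_rep[OF U, of x] by (simp add: submodule_iff)
  finally show ?thesis
    using assms coset_rep[OF U, of x] coset_rep_eq[OF U, of "a \<odot>\<^bsub>M\<^esub> x" "a \<odot>\<^bsub>M\<^esub> coset_rep M U x"]
    by simp
qed

lemma left_module_quotient:
  assumes U: "submodule U R M"
  shows "left_module R (quotient_module M U)"
proof (rule left_moduleI, rule R.ring_axioms)
  note rep = coset_rep[OF U] coset_rep_add[OF U] coset_rep_smult[OF U] coset_rep_idem[OF U]
  {
    fix x y assume "x \<in> carrier (quotient_module M U)" "y \<in> carrier (quotient_module M U)"
    then show "x \<oplus>\<^bsub>quotient_module M U\<^esub> y = y \<oplus>\<^bsub>quotient_module M U\<^esub> x"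
      using rep by (auto simp: M.a_comm)
  next
    fix a b x assume *: "a \<in> carrier R" "b \<in> carrier R" "x \<in> carrier (quotient_module M U)"
    then obtain y where y: "y \<in> carrier M" "x = coset_rep M U y" by auto
    have "coset_rep M U ((a \<oplus>\<^bsub>R\<^esub> b) \<odot>\<^bsub>M\<^esub> x) = coset_rep M U ((a \<oplus>\<^bsub>R\<^esub> b) \<odot>\<^bsub>M\<^esub> y)"
      using * y by (simp add: rep del: smult_l_distr)
    then show "(a \<oplus>\<^bsub>R\<^esub> b) \<odot>\<^bsub>quotient_module M U\<^esub> x =
      a \<odot>\<^bsub>quotient_module M U\<^esub> x \<oplus>\<^bsub>quotient_module M U\<^esub> b \<odot>\<^bsub>quotient_module M U\<^esub> x"
      using *(1,2) y(1) unfolding y(2) by (simp add: rep smult_l_distr)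
    have "coset_rep M U ((a \<otimes>\<^bsub>R\<^esub> b) \<odot>\<^bsub>M\<^esub> x) = coset_rep M U ((a \<otimes>\<^bsub>R\<^esub> b) \<odot>\<^bsub>M\<^esub> y)"
      using * y by (simp add: rep)
    then show "(a \<otimes>\<^bsub>R\<^esub> b) \<odot>\<^bsub>quotient_module M U\<^esub> x =
      a \<odot>\<^bsub>quotient_module M U\<^esub> (b \<odot>\<^bsub>quotient_module M U\<^esub> x)"
      using *(1,2) y(1) unfolding y(2) by (simp add: rep smult_assoc1)
  }
qed (auto simp: coset_rep[OF U] coset_rep_add[OF U] coset_rep_smult[OF U] coset_rep_idem[OF U]
    smult_r_distr M.a_assoc)

end

lemma coset_rep_hom:
  assumes M: "left_module R M" and U: "submodule U R M"
  shows "coset_rep M U \<in> module_hom R M (quotient_module M U)"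
proof -
  interpret M: left_module R M by fact
  show ?thesis
    by (rule module_homI)
      (simp_all add: M.coset_rep[OF U] M.coset_rep_add[OF U] M.coset_rep_smult[OF U])
qed

text \<open>A homomorphism that vanishes on \<open>U\<close> is itself the induced homomorphism on \<open>M/U\<close>.\<close>

lemma quotient_module_hom:
  assumes M: "left_module R M" and U: "submodule U R M" and N: "left_module R N"
    and f: "f \<in> module_hom R M N" and vanish: "\<And>x. x \<in> U \<Longrightarrow> f x = \<zero>\<^bsub>N\<^esub>"
  shows "f \<in> module_hom R (quotient_module M U) N"
    and "\<And>x. x \<in> carrier M \<Longrightarrow> f (coset_rep M U x) = f x"
proof -
  interpret M: left_module R M by fact
  interpret N: left_module R N by fact
  show eq: "f (coset_rep M U x) = f x" if "x \<in> carrier M" for x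
    using vanish[OF M.coset_rep(2)[OF U that]] that M.coset_rep(1)[OF U that] module_hom_closed[OF f]
    by (simp add: module_hom_minus[OF f M N] N.minus_eq_zero)
  show "f \<in> module_hom R (quotient_module M U) N"
    by (rule module_homI)
      (auto simp: eq M.coset_rep[OF U] module_hom_closed[OF f] module_hom_add[OF f]
        module_hom_smult[OF f])
qed

section \<open>Spaces of homomorphisms over a finite-dimensional algebra\<close>

text \<open>An \<open>A\<close>-module as a vector space: \<open>c\<close> acts as the element \<open>c \<cdot> 1\<close> of \<open>A\<close>.\<close>

definition restrict_scalars ::
    "('k, 'c) ring_scheme \<Rightarrow> ('k, 'a, 'd) module_scheme \<Rightarrow> ('a, 'm) module \<Rightarrow> ('k, 'm) module" where
  "restrict_scalars K A M = \<lparr>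
    carrier = carrier M,
    monoid.mult = undefined, monoid.one = undefined,
    ring.zero = \<zero>\<^bsub>M\<^esub>, ring.add = ring.add M,
    smult = (\<lambda>c x. (c \<odot>\<^bsub>A\<^esub> \<one>\<^bsub>A\<^esub>) \<odot>\<^bsub>M\<^esub> x)\<rparr>"

text \<open>
  The vector space \<open>Hom (M, N)\<close>.  As for \<^const>\<open>hom_group\<close>, its elements are extensional on the
  carrier of the source, so that homomorphisms with the same values are equal.
\<close>

definition hom_space ::
    "('k, 'c) ring_scheme \<Rightarrow> ('k, 'a, 'd) module_scheme \<Rightarrow> ('a, 'm) module \<Rightarrow> ('a, 'n) module \<Rightarrow>
      ('k, 'm \<Rightarrow> 'n) module" where
  "hom_space K A M N = \<lparr>
    carrier = module_hom A M N \<inter> extensional (carrier M),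
    monoid.mult = undefined, monoid.one = undefined,
    ring.zero = (\<lambda>x\<in>carrier M. \<zero>\<^bsub>N\<^esub>),
    ring.add = (\<lambda>f g. \<lambda>x\<in>carrier M. f x \<oplus>\<^bsub>N\<^esub> g x),
    smult = (\<lambda>c f. \<lambda>x\<in>carrier M. (c \<odot>\<^bsub>A\<^esub> \<one>\<^bsub>A\<^esub>) \<odot>\<^bsub>N\<^esub> f x)\<rparr>"

text \<open>The dimension of \<open>Hom (M, N)\<close>, as a length.\<close>

definition hom_len ::
    "('k, 'c) ring_scheme \<Rightarrow> ('k, 'a, 'd) module_scheme \<Rightarrow> ('a, 'm) module \<Rightarrow> ('a, 'n) module \<Rightarrow>
      nat" where
  "hom_len K A M N = len K (hom_space K A M N) (carrier (hom_space K A M N))"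

text \<open>The homomorphisms from \<open>M\<close> to \<open>N\<close> with image in \<open>U\<close>, as elements of \<^const>\<open>hom_space\<close>.\<close>

definition homs_into ::
    "('a, 'c) ring_scheme \<Rightarrow> ('a, 'm) module \<Rightarrow> ('a, 'n) module \<Rightarrow> 'n set \<Rightarrow> ('m \<Rightarrow> 'n) set" where
  "homs_into A M N U = {f \<in> module_hom A M N \<inter> extensional (carrier M). f ` carrier M \<subseteq> U}"

lemma restrict_scalars_simps [simp]:
  "carrier (restrict_scalars K A M) = carrier M"
  "\<zero>\<^bsub>restrict_scalars K A M\<^esub> = \<zero>\<^bsub>M\<^esub>"
  "x \<oplus>\<^bsub>restrict_scalars K A M\<^esub> y = x \<oplus>\<^bsub>M\<^esub> y"
  "c \<odot>\<^bsub>restrict_scalars K A M\<^esub> x = (c \<odot>\<^bsub>A\<^esub> \<one>\<^bsub>A\<^esub>) \<odot>\<^bsub>M\<^esub> x"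
  by (simp_all add: restrict_scalars_def)

lemma hom_space_simps [simp]:
  "carrier (hom_space K A M N) = module_hom A M N \<inter> extensional (carrier M)"
  "\<zero>\<^bsub>hom_space K A M N\<^esub> = (\<lambda>x\<in>carrier M. \<zero>\<^bsub>N\<^esub>)"
  "f \<oplus>\<^bsub>hom_space K A M N\<^esub> g = (\<lambda>x\<in>carrier M. f x \<oplus>\<^bsub>N\<^esub> g x)"
  "c \<odot>\<^bsub>hom_space K A M N\<^esub> f = (\<lambda>x\<in>carrier M. (c \<odot>\<^bsub>A\<^esub> \<one>\<^bsub>A\<^esub>) \<odot>\<^bsub>N\<^esub> f x)"
  by (simp_all add: hom_space_def)

lemma module_hom_restrict:
  "left_module R M \<Longrightarrow> f \<in> module_hom R M N \<Longrightarrow> (\<lambda>x\<in>carrier M. f x) \<in> module_hom R M N"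
  by (erule module_hom_cong) auto

lemma module_hom_zero_map:
  assumes "left_module R N"
  shows "(\<lambda>x. \<zero>\<^bsub>N\<^esub>) \<in> module_hom R M N"
proof -
  interpret N: left_module R N by fact
  show ?thesis by (rule module_homI) auto
qed

context fin_dim_algebra
begin

text \<open>The central element of \<open>A\<close> by which \<open>c\<close> acts.\<close>

abbreviation scalar :: "'k \<Rightarrow> 'a" where
  "scalar c \<equiv> c \<odot>\<^bsub>A\<^esub> \<one>\<^bsub>A\<^esub>"

lemma scalar_closed: "c \<in> carrier K \<Longrightarrow> scalar c \<in> carrier A"
  by simp

lemma scalar_mult_left: "c \<in> carrier K \<Longrightarrow> a \<in> carrier A \<Longrightarrow> scalar c \<otimes>\<^bsub>A\<^esub> a = c \<odot>\<^bsub>A\<^esub> a"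
  by (simp add: smult_mult_left)

lemma scalar_mult_right: "c \<in> carrier K \<Longrightarrow> a \<in> carrier A \<Longrightarrow> a \<otimes>\<^bsub>A\<^esub> scalar c = c \<odot>\<^bsub>A\<^esub> a"
  by (simp add: smult_mult_right)

lemma scalar_add:
  "c \<in> carrier K \<Longrightarrow> d \<in> carrier K \<Longrightarrow> scalar (c \<oplus>\<^bsub>K\<^esub> d) = scalar c \<oplus>\<^bsub>A\<^esub> scalar d"
  by (simp add: V.smult_l_distr)

lemma scalar_mult:
  "c \<in> carrier K \<Longrightarrow> d \<in> carrier K \<Longrightarrow> scalar (c \<otimes>\<^bsub>K\<^esub> d) = scalar c \<otimes>\<^bsub>A\<^esub> scalar d"
  by (simp add: V.smult_assoc1 scalar_mult_left)

lemma scalar_commute: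
  assumes "left_module A M" "c \<in> carrier K" "a \<in> carrier A" "x \<in> carrier M"
  shows "a \<odot>\<^bsub>M\<^esub> (scalar c \<odot>\<^bsub>M\<^esub> x) = scalar c \<odot>\<^bsub>M\<^esub> (a \<odot>\<^bsub>M\<^esub> x)"
proof -
  interpret M: left_module A M by fact
  show ?thesis
    using assms by (simp add: M.smult_assoc1[symmetric] scalar_mult_left scalar_mult_right)
qed

lemma left_module_regular_algebra: "left_module A (regular_module A)"
  by (rule left_module_regular) (rule A.ring_axioms)

lemma left_module_free: "left_module A (free_module A n)"
  by (rule left_module_direct_power) (rule left_module_regular_algebra)

lemma left_module_restrict_scalars:
  assumes "left_module A M"
  shows "left_module K (restrict_scalars K A M)"
proof -
  interpret M: left_module A M by fact
  show ?thesis
  proof (rule left_moduleI, rule K.ring_axioms)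
    fix c d x
    assume "c \<in> carrier K" "d \<in> carrier K" "x \<in> carrier (restrict_scalars K A M)"
    then show "(c \<oplus>\<^bsub>K\<^esub> d) \<odot>\<^bsub>restrict_scalars K A M\<^esub> x =
      c \<odot>\<^bsub>restrict_scalars K A M\<^esub> x \<oplus>\<^bsub>restrict_scalars K A M\<^esub> d \<odot>\<^bsub>restrict_scalars K A M\<^esub> x"
      by (simp add: scalar_add M.smult_l_distr del: V.smult_l_distr)
    show "(c \<otimes>\<^bsub>K\<^esub> d) \<odot>\<^bsub>restrict_scalars K A M\<^esub> x =
      c \<odot>\<^bsub>restrict_scalars K A M\<^esub> (d \<odot>\<^bsub>restrict_scalars K A M\<^esub> x)"
      using \<open>c \<in> carrier K\<close> \<open>d \<in> carrier K\<close> \<open>x \<in> _\<close> by (simp add: scalar_mult M.smult_assoc1)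
  next
    fix x y
    assume "x \<in> carrier (restrict_scalars K A M)" "y \<in> carrier (restrict_scalars K A M)"
    then show "x \<oplus>\<^bsub>restrict_scalars K A M\<^esub> y = y \<oplus>\<^bsub>restrict_scalars K A M\<^esub> x"
      by (simp add: M.M.a_comm)
  qed (simp_all add: M.M.a_assoc M.smult_r_distr)
qed

lemma left_module_hom_space:
  assumes "left_module A M" "left_module A N"
  shows "left_module K (hom_space K A M N)"
proof -
  interpret M: left_module A M by fact
  interpret N: left_module A N by fact
  let ?H = "hom_space K A M N"
  have H: "f \<in> module_hom A M N" "f \<in> extensional (carrier M)"
    "\<And>x. x \<in> carrier M \<Longrightarrow> f x \<in> carrier N" if "f \<in> carrier ?H" for f
    using that module_hom_closed by auto
  have eqI: "f = g" if "f \<in> extensional (carrier M)" "g \<in> extensional (carrier M)"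
    "\<And>x. x \<in> carrier M \<Longrightarrow> f x = g x" for f g
    using that by (rule extensionalityI)
  show ?thesis
  proof (rule left_moduleI, rule K.ring_axioms)
    show "\<zero>\<^bsub>?H\<^esub> \<in> carrier ?H"
      using module_hom_restrict[OF assms(1) module_hom_zero_map[OF assms(2)]] by simp
  next
    fix f g assume fg: "f \<in> carrier ?H" "g \<in> carrier ?H"
    show "f \<oplus>\<^bsub>?H\<^esub> g \<in> carrier ?H"
      using module_hom_restrict[OF assms(1) module_hom_sum[OF H(1)[OF fg(1)] H(1)[OF fg(2)] assms(2)]]
      by simp
    show "f \<oplus>\<^bsub>?H\<^esub> g = g \<oplus>\<^bsub>?H\<^esub> f"
      using H(3)[OF fg(1)] H(3)[OF fg(2)] by (auto simp: N.M.a_comm intro!: restrict_ext)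
    fix h assume h: "h \<in> carrier ?H"
    show "f \<oplus>\<^bsub>?H\<^esub> g \<oplus>\<^bsub>?H\<^esub> h = f \<oplus>\<^bsub>?H\<^esub> (g \<oplus>\<^bsub>?H\<^esub> h)"
      using H(3)[OF fg(1)] H(3)[OF fg(2)] H(3)[OF h]
      by (auto simp: N.M.a_assoc intro!: restrict_ext)
  next
    fix f assume f: "f \<in> carrier ?H"
    show "\<zero>\<^bsub>?H\<^esub> \<oplus>\<^bsub>?H\<^esub> f = f"
      using H(2,3)[OF f] by (intro eqI) simp_all
    show "\<one>\<^bsub>K\<^esub> \<odot>\<^bsub>?H\<^esub> f = f"
      using H(2,3)[OF f] by (intro eqI) simp_all
    show "\<zero>\<^bsub>K\<^esub> \<odot>\<^bsub>?H\<^esub> f = \<zero>\<^bsub>?H\<^esub>"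
      using H(2,3)[OF f] by (intro eqI) simp_all
    fix c assume c: "c \<in> carrier K"
    have "(\<lambda>x. scalar c \<odot>\<^bsub>N\<^esub> f x) \<in> module_hom A M N"
      using c H(1,3)[OF f]
      by (intro module_homI) (simp_all add: module_hom_add module_hom_smult N.smult_r_distr
          scalar_commute[OF assms(2)])
    from module_hom_restrict[OF assms(1) this] show "c \<odot>\<^bsub>?H\<^esub> f \<in> carrier ?H"
      by simp
    fix d assume d: "d \<in> carrier K"
    show "(c \<oplus>\<^bsub>K\<^esub> d) \<odot>\<^bsub>?H\<^esub> f = c \<odot>\<^bsub>?H\<^esub> f \<oplus>\<^bsub>?H\<^esub> d \<odot>\<^bsub>?H\<^esub> f"
      using c d H(3)[OF f] by (intro eqI) (simp_all add: scalar_add N.smult_l_distr)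
    show "(c \<otimes>\<^bsub>K\<^esub> d) \<odot>\<^bsub>?H\<^esub> f = c \<odot>\<^bsub>?H\<^esub> (d \<odot>\<^bsub>?H\<^esub> f)"
      using c d H(3)[OF f] by (intro eqI) (simp_all add: scalar_mult N.smult_assoc1)
  next
    fix c f g assume c: "c \<in> carrier K" and fg: "f \<in> carrier ?H" "g \<in> carrier ?H"
    show "c \<odot>\<^bsub>?H\<^esub> (f \<oplus>\<^bsub>?H\<^esub> g) = c \<odot>\<^bsub>?H\<^esub> f \<oplus>\<^bsub>?H\<^esub> c \<odot>\<^bsub>?H\<^esub> g"
      using c H(3)[OF fg(1)] H(3)[OF fg(2)] by (intro eqI) (simp_all add: N.smult_r_distr)
  qed
qed

lemma module_hom_restrict_scalars:
  "f \<in> module_hom A M N \<Longrightarrow> f \<in> module_hom K (restrict_scalars K A M) (restrict_scalars K A N)"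
  by (rule module_homI) (auto simp: module_hom_closed module_hom_add module_hom_smult)

lemma submodule_restrict_scalars:
  assumes "left_module A M" "submodule U A M"
  shows "submodule U K (restrict_scalars K A M)"
  using assms(2) left_module.submodule_iff[OF left_module_restrict_scalars[OF assms(1)]]
  by (simp add: left_module.submodule_iff[OF assms(1)])

text \<open>A submodule is in particular a subspace, so the dimension bounds the length.\<close>

lemma finite_len_of_restrict_scalars:
  assumes "left_module A M" "finite_len K (restrict_scalars K A M) U"
  shows "finite_len A M U"
proof (rule finite_lenI)
  fix n assume "submodule_chain A M n U"
  then have "submodule_chain K (restrict_scalars K A M) n U"
    by induction (auto intro: submodule_chain.intros submodule_restrict_scalars[OF assms(1)])
  then show "n \<le> len K (restrict_scalars K A M) U"
    by (rule submodule_chain_le_len[OF assms(2)])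
qed

lemma finite_len_regular_field: "finite_len K (regular_module K) (carrier K)"
proof -
  interpret R: left_module K "regular_module K"
    by (rule left_module_regular) (rule K.ring_axioms)
  have field: "U = {\<zero>\<^bsub>K\<^esub>} \<or> U = carrier K" if U: "submodule U K (regular_module K)" for U
  proof (rule disjCI)
    assume "U \<noteq> carrier K"
    show "U = {\<zero>\<^bsub>K\<^esub>}"
    proof (rule ccontr)
      assume "U \<noteq> {\<zero>\<^bsub>K\<^esub>}"
      then obtain u where u: "u \<in> U" "u \<in> carrier K" "u \<noteq> \<zero>\<^bsub>K\<^esub>"
        using U by (auto simp: R.submodule_iff)
      have "a \<in> U" if "a \<in> carrier K" for a
      proof -
        have "(a \<otimes>\<^bsub>K\<^esub> inv\<^bsub>K\<^esub> u) \<otimes>\<^bsub>K\<^esub> u \<in> U"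
          using u U that by (simp add: R.submodule_iff K.field_Units)
        then show ?thesis
          using u that by (simp add: K.m_assoc K.field_Units)
      qed
      then show False
        using \<open>U \<noteq> carrier K\<close> U by (auto simp: R.submodule_iff)
    qed
  qed
  show ?thesis
  proof (rule finite_lenI)
    fix n assume "submodule_chain K (regular_module K) n (carrier K)"
    then show "n \<le> 1"
    proof cases
      case (step m U)
      then have "U = {\<zero>\<^bsub>regular_module K\<^esub>}"
        using field[of U] submodule_chain_submodule by fastforce
      then show ?thesis
        using step R.submodule_chain_zero[of m] by simp
    qed simp
  qed
qed

text \<open>
  The regular module as a vector space has the same elements and operations as \<open>A\<close> itself, which is
  first replaced by a plain module record.
\<close>

lemma finite_len_regular_scalars:
  "finite_len K (restrict_scalars K A (regular_module A)) (carrier A)"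
proof -
  let ?V = "\<lparr>carrier = carrier A, monoid.mult = undefined, monoid.one = undefined,
    ring.zero = \<zero>\<^bsub>A\<^esub>, ring.add = ring.add A, smult = smult A\<rparr> :: ('k, 'a) module"
  have V': "left_module K ?V"
    by (rule left_moduleI, rule K.ring_axioms)
      (auto simp: V.smult_l_distr V.smult_r_distr V.smult_assoc1 V.M.a_assoc intro: V.M.a_comm)
  have "finitely_generated K ?V"
  proof -
    have "finsum ?V = (finsum A :: ('a \<Rightarrow> 'a) \<Rightarrow> _)"
      by (auto simp: finsum_def finprod_def fun_eq_iff)
    then show ?thesis
      using finite_dim by (simp add: finitely_generated_def)
  qed
  then have "finite_len K ?V (carrier ?V)"
    by (intro finite_len_of_free_cover[OF V'] free_cover_of_finitely_generated[OF V']
        finite_len_regular_field)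
  moreover have "(\<lambda>x. x) \<in> module_hom K ?V (restrict_scalars K A (regular_module A))"
    by (rule module_homI) (auto simp: scalar_mult_left)
  ultimately have "finite_len K (restrict_scalars K A (regular_module A)) ((\<lambda>x. x) ` carrier ?V)"
    by (intro finite_len_image[OF V' left_module_restrict_scalars[OF left_module_regular_algebra]]
        left_module.submodule_carrier[OF V'])
  then show ?thesis by simp
qed

lemma finite_len_regular: "finite_len A (regular_module A) (carrier A)"
  by (rule finite_len_of_restrict_scalars[OF left_module_regular_algebra finite_len_regular_scalars])

lemma finite_len_free: "finite_len A (free_module A n) (carrier (free_module A n))"
  by (rule finite_len_direct_power[OF left_module_regular_algebra])
    (simp only: regular_module_simps finite_len_regular)

lemma free_cover_iff_finite_len:
  "left_module A M \<Longrightarrow> free_cover A M \<longleftrightarrow> finite_len A M (carrier M)"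
  using finite_len_of_free_cover[OF _ _ finite_len_regular] free_cover_of_finite_len by blast

lemma free_cover_submodule:
  assumes "left_module A M" "free_cover A M" "submodule U A M"
  shows "free_cover A (M\<lparr>carrier := U\<rparr>)"
proof -
  interpret M: left_module A M by fact
  have "U \<subseteq> carrier M"
    using assms(3) by (simp add: M.submodule_iff)
  then have "finite_len A M U"
    using finite_len_mono[OF _ _ M.submodule_carrier] assms(2)
    by (simp add: free_cover_iff_finite_len[OF assms(1)])
  then show ?thesis
    using free_cover_iff_finite_len[OF M.left_module_submodule[OF assms(3)]]
      finite_len_of_submodule[OF assms(1,3)] by simp
qed

lemma free_cover_image:
  assumes "free_cover A M" "f \<in> module_hom A M N" "f ` carrier M = carrier N"
  shows "free_cover A N"
proof -
  obtain n g where g: "g \<in> module_hom A (free_module A n) M"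
    "g ` carrier (free_module A n) = carrier M"
    using assms(1) unfolding free_cover_def by blast
  have "(\<lambda>x. f (g x)) ` carrier (free_module A n) = carrier N"
    unfolding assms(3)[symmetric] g(2)[symmetric] by (rule image_image[symmetric])
  then show ?thesis
    using module_hom_comp[OF g(1) assms(2)] unfolding free_cover_def by blast
qed

lemma free_cover_free: "free_cover A (free_module A n)"
  using free_cover_iff_finite_len[OF left_module_free] finite_len_free by blast

lemma finite_len_restrict_scalars:
  assumes "left_module A M" "free_cover A M"
  shows "finite_len K (restrict_scalars K A M) (carrier M)"
proof -
  obtain n g where g: "g \<in> module_hom A (free_module A n) M"
    "g ` carrier (free_module A n) = carrier M"
    using assms(2) unfolding free_cover_def by blast
  have eq: "restrict_scalars K A (free_module A n) =
      direct_power (restrict_scalars K A (regular_module A)) n"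
    by (simp add: restrict_scalars_def direct_power_def)
  have "finite_len K (restrict_scalars K A (free_module A n)) (carrier (free_module A n))"
    using finite_len_direct_power[OF left_module_restrict_scalars[OF left_module_regular_algebra], of n]
      finite_len_regular_scalars by (simp add: eq)
  then have "finite_len K (restrict_scalars K A M) (g ` carrier (free_module A n))"
    by (intro finite_len_image[OF left_module_restrict_scalars[OF left_module_free]
          left_module_restrict_scalars[OF assms(1)] module_hom_restrict_scalars[OF g(1)]]
        submodule_restrict_scalars left_module_free left_module.submodule_carrier[OF left_module_free])
  then show ?thesis
    by (simp only: g(2))
qed

lemma finite_len_hom_space:
  assumes M: "left_module A M" "free_cover A M" and N: "left_module A N" "free_cover A N"
  shows "finite_len K (hom_space K A M N) (carrier (hom_space K A M N))"
proof -
  obtain n g where g: "g \<in> module_hom A (free_module A n) M"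
    "g ` carrier (free_module A n) = carrier M"
    using assms(2) unfolding free_cover_def by blast
  let ?H = "hom_space K A M N" and ?P = "direct_power (restrict_scalars K A N) n"
  let ?e = "\<lambda>i. g (unit_vector A n i)"
  let ?ev = "\<lambda>f. \<lambda>i\<in>{..<n}. f (?e i)"
  note H = left_module_hom_space[OF M(1) N(1)]
  note P = left_module_direct_power[OF left_module_restrict_scalars[OF N(1)], of n]
  have e: "?e i \<in> carrier M" for i
    using module_hom_closed[OF g(1) unit_vector_closed[OF A.ring_axioms]] .
  have ev: "?ev \<in> module_hom K ?H ?P"
    by (rule module_homI) (auto simp: e module_hom_closed intro!: restrict_ext)
  have inj: "f = \<zero>\<^bsub>?H\<^esub>" if f: "f \<in> carrier ?H" "?ev f = \<zero>\<^bsub>?P\<^esub>" for f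
  proof -
    have fe: "f (?e i) = \<zero>\<^bsub>N\<^esub>" if "i < n" for i
      using fun_cong[OF f(2), of i] that by simp
    have "f x = \<zero>\<^bsub>N\<^esub>" if x: "x \<in> carrier M" for x
    proof -
      obtain v where v: "v \<in> carrier (free_module A n)" "x = g v"
        using g(2) x by (metis imageE)
      have fM: "f \<in> module_hom A M N"
        using f(1) by simp
      have "f (g v) = \<zero>\<^bsub>N\<^esub>"
        by (rule module_hom_free_eqI[OF N(1) module_hom_comp[OF g(1) fM]
              module_hom_zero_map[OF N(1)] _ v(1)]) (rule fe)
      then show ?thesis using v by simp
    qed
    then show ?thesis
      using f(1) by (intro extensionalityI[of _ "carrier M"]) simp_all
  qed
  have "?ev ` carrier ?H \<subseteq> carrier ?P"
    using module_hom_closed[OF ev] by blast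
  then have "finite_len K ?P (?ev ` carrier ?H)"
    using finite_len_restrict_scalars[OF N]
    by (intro finite_len_mono[OF finite_len_direct_power[OF left_module_restrict_scalars[OF N(1)]]
          _ left_module.submodule_carrier[OF P]]) (simp_all only: restrict_scalars_simps)
  then show ?thesis
    by (intro finite_len_inj(1)[OF H P ev] left_module.submodule_carrier[OF H] inj)
qed

lemma precompose_hom:
  assumes "left_module A L" "g \<in> module_hom A L M"
  shows "(\<lambda>f. \<lambda>x\<in>carrier L. f (g x)) \<in> module_hom K (hom_space K A M N) (hom_space K A L N)"
proof (rule module_homI)
  fix f assume "f \<in> carrier (hom_space K A M N)"
  then show "(\<lambda>x\<in>carrier L. f (g x)) \<in> carrier (hom_space K A L N)"
    using module_hom_restrict[OF assms(1) module_hom_comp[OF assms(2), of f N]] by simp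
qed (auto simp: module_hom_closed[OF assms(2)] intro!: restrict_ext)

lemma postcompose_hom:
  assumes "left_module A L" "g \<in> module_hom A M N"
  shows "(\<lambda>f. \<lambda>x\<in>carrier L. g (f x)) \<in> module_hom K (hom_space K A L M) (hom_space K A L N)"
proof (rule module_homI)
  fix f assume "f \<in> carrier (hom_space K A L M)"
  then show "(\<lambda>x\<in>carrier L. g (f x)) \<in> carrier (hom_space K A L N)"
    using module_hom_restrict[OF assms(1) module_hom_comp[OF _ assms(2), of f L]] by simp
qed (auto simp: module_hom_closed module_hom_add[OF assms(2)] module_hom_smult[OF assms(2)]
    intro!: restrict_ext)

lemma submodule_homs_into:
  assumes "left_module A M" "left_module A N" "submodule U A N"
  shows "submodule (homs_into A M N U) K (hom_space K A M N)"
proof -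
  interpret N: left_module A N by fact
  interpret H: left_module K "hom_space K A M N"
    by (rule left_module_hom_space) fact+
  have U: "U \<subseteq> carrier N" "\<zero>\<^bsub>N\<^esub> \<in> U" "\<And>x y. x \<in> U \<Longrightarrow> y \<in> U \<Longrightarrow> x \<oplus>\<^bsub>N\<^esub> y \<in> U"
    "\<And>a x. a \<in> carrier A \<Longrightarrow> x \<in> U \<Longrightarrow> a \<odot>\<^bsub>N\<^esub> x \<in> U"
    using assms(3) by (auto simp: N.submodule_iff)
  have eq: "homs_into A M N U = {f \<in> carrier (hom_space K A M N). \<forall>x\<in>carrier M. f x \<in> U}"
    by (auto simp: homs_into_def)
  show ?thesis
    unfolding H.submodule_iff
  proof (intro conjI ballI)
    show "homs_into A M N U \<subseteq> carrier (hom_space K A M N)"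
      by (auto simp: eq)
    show "\<zero>\<^bsub>hom_space K A M N\<^esub> \<in> homs_into A M N U"
      unfolding eq using H.M.zero_closed U(2) by simp
    show "f \<oplus>\<^bsub>hom_space K A M N\<^esub> g \<in> homs_into A M N U"
      if "f \<in> homs_into A M N U" "g \<in> homs_into A M N U" for f g
      using that H.M.a_closed[of f g] U(3) unfolding eq by simp
    show "c \<odot>\<^bsub>hom_space K A M N\<^esub> f \<in> homs_into A M N U"
      if "c \<in> carrier K" "f \<in> homs_into A M N U" for c f
      using that H.smult_closed[of c f] U(4) scalar_closed unfolding eq by simp
  qed
qed

lemma len_homs_into:
  assumes M: "left_module A M" "free_cover A M" and N: "left_module A N" "free_cover A N"
    and U: "submodule U A N"
  shows "len K (hom_space K A M N) (homs_into A M N U) = hom_len K A M (N\<lparr>carrier := U\<rparr>)"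
proof -
  let ?U = "N\<lparr>carrier := U\<rparr>"
  interpret N: left_module A N by fact
  have U': "left_module A ?U" "free_cover A ?U" "U \<subseteq> carrier N"
    using N.left_module_submodule[OF U] free_cover_submodule[OF N U] U
    by (auto simp: N.submodule_iff)
  have inc: "(\<lambda>x. x) \<in> module_hom A ?U N"
    using U'(3) by (auto simp: module_hom_def)
  let ?i = "\<lambda>f. \<lambda>x\<in>carrier M. f x"
  have i: "?i \<in> module_hom K (hom_space K A M ?U) (hom_space K A M N)"
    using postcompose_hom[OF M(1) inc] by simp
  have eq: "?i f = f" if "f \<in> carrier (hom_space K A M ?U)" for f
    using that by (simp add: extensional_restrict)
  have im: "?i ` carrier (hom_space K A M ?U) = homs_into A M N U"
  proof
    show "?i ` carrier (hom_space K A M ?U) \<subseteq> homs_into A M N U"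
    proof
      fix g assume "g \<in> ?i ` carrier (hom_space K A M ?U)"
      then have "g \<in> carrier (hom_space K A M ?U)"
        using eq by auto
      then show "g \<in> homs_into A M N U"
        using module_hom_extend_target[of g A M U N] U'(3) module_hom_closed[of g A M ?U]
        by (auto simp: homs_into_def)
    qed
    show "homs_into A M N U \<subseteq> ?i ` carrier (hom_space K A M ?U)"
    proof
      fix g assume "g \<in> homs_into A M N U"
      then have "g \<in> carrier (hom_space K A M ?U)"
        using module_hom_restrict_target[of g A M N U] by (auto simp: homs_into_def)
      then show "g \<in> ?i ` carrier (hom_space K A M ?U)"
        using eq by (metis image_eqI)
    qed
  qed
  show ?thesis
    unfolding hom_len_def im[symmetric]
  proof (rule finite_len_inj(2)[symmetric, OF left_module_hom_space[OF M(1) U'(1)]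
        left_module_hom_space[OF M(1) N(1)] i])
    show "finite_len K (hom_space K A M N) (?i ` carrier (hom_space K A M ?U))"
      unfolding im
    proof (rule finite_len_mono[OF finite_len_hom_space[OF M N]])
      show "homs_into A M N U \<subseteq> carrier (hom_space K A M N)"
        by (auto simp: homs_into_def)
      show "submodule (carrier (hom_space K A M N)) K (hom_space K A M N)"
        by (rule left_module.submodule_carrier[OF left_module_hom_space[OF M(1) N(1)]])
    qed
    show "submodule (carrier (hom_space K A M ?U)) K (hom_space K A M ?U)"
      by (rule left_module.submodule_carrier[OF left_module_hom_space[OF M(1) U'(1)]])
    show "f = \<zero>\<^bsub>hom_space K A M ?U\<^esub>"
      if "f \<in> carrier (hom_space K A M ?U)" "?i f = \<zero>\<^bsub>hom_space K A M N\<^esub>" for f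
      using that eq[OF that(1)] by simp
  qed
qed

end

section \<open>The radical and semisimple modules\<close>

text \<open>The submodule \<open>J M\<close>, where \<open>J\<close> is the Jacobson radical of the ring.\<close>

inductive_set radical_submodule ::
    "('a, 'c) ring_scheme \<Rightarrow> ('a, 'm, 'd) module_scheme \<Rightarrow> 'm set"
  for R M where
  zero: "\<zero>\<^bsub>M\<^esub> \<in> radical_submodule R M"
| smult: "a \<in> jacobson_radical R \<Longrightarrow> x \<in> carrier M \<Longrightarrow> a \<odot>\<^bsub>M\<^esub> x \<in> radical_submodule R M"
| add: "x \<in> radical_submodule R M \<Longrightarrow> y \<in> radical_submodule R M \<Longrightarrow>
    x \<oplus>\<^bsub>M\<^esub> y \<in> radical_submodule R M"

context fin_dim_algebra
begin

lemma left_ideal_iff: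
  "submodule I A (regular_module A) \<longleftrightarrow> I \<subseteq> carrier A \<and> \<zero>\<^bsub>A\<^esub> \<in> I \<and>
    (\<forall>x\<in>I. \<forall>y\<in>I. x \<oplus>\<^bsub>A\<^esub> y \<in> I) \<and> (\<forall>a\<in>carrier A. \<forall>x\<in>I. a \<otimes>\<^bsub>A\<^esub> x \<in> I)"
  by (simp add: left_module.submodule_iff[OF left_module_regular_algebra])

lemma left_ideal_minus:
  assumes "submodule I A (regular_module A)" "x \<in> I" "y \<in> I"
  shows "x \<ominus>\<^bsub>A\<^esub> y \<in> I"
proof -
  have "x \<in> carrier A" "y \<in> carrier A"
    using assms by (auto simp: left_ideal_iff)
  moreover from this have "x \<ominus>\<^bsub>A\<^esub> y = x \<oplus>\<^bsub>A\<^esub> (\<ominus>\<^bsub>A\<^esub> \<one>\<^bsub>A\<^esub>) \<otimes>\<^bsub>A\<^esub> y"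
    by (simp add: a_minus_def A.l_minus)
  ultimately show ?thesis
    using assms by (simp add: left_ideal_iff)
qed

lemma left_ideal_Inter:
  assumes "\<And>I. I \<in> F \<Longrightarrow> submodule I A (regular_module A)"
  shows "submodule (carrier A \<inter> \<Inter>F) A (regular_module A)"
  unfolding left_ideal_iff
proof (intro conjI ballI)
  show "\<zero>\<^bsub>A\<^esub> \<in> carrier A \<inter> \<Inter>F"
    using assms by (simp add: left_ideal_iff)
  show "x \<oplus>\<^bsub>A\<^esub> y \<in> carrier A \<inter> \<Inter>F"
    if "x \<in> carrier A \<inter> \<Inter>F" "y \<in> carrier A \<inter> \<Inter>F" for x y
    using that assms by (simp add: left_ideal_iff)
  show "a \<otimes>\<^bsub>A\<^esub> x \<in> carrier A \<inter> \<Inter>F" if "a \<in> carrier A" "x \<in> carrier A \<inter> \<Inter>F" for a x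
    using that assms by (simp add: left_ideal_iff)
qed blast

lemma maximal_left_ideal_comaximal:
  assumes I: "maximal_left_ideal A I" and L: "submodule L A (regular_module A)" and "\<not> L \<subseteq> I"
  obtains c where "c \<in> L" "\<one>\<^bsub>A\<^esub> \<ominus>\<^bsub>A\<^esub> c \<in> I"
proof -
  have I': "submodule I A (regular_module A)"
    using I by (simp add: maximal_left_ideal_def)
  note L' = L[unfolded left_ideal_iff] and I'' = I'[unfolded left_ideal_iff]
  let ?S = "{x \<oplus>\<^bsub>A\<^esub> y | x y. x \<in> I \<and> y \<in> L}"
  have mem: "x \<oplus>\<^bsub>A\<^esub> y \<in> ?S" if "x \<in> I" "y \<in> L" for x y
    using that by blast
  have "submodule ?S A (regular_module A)"
    unfolding left_ideal_iff
  proof (intro conjI ballI)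
    show "?S \<subseteq> carrier A"
      using I'' L' by (auto intro!: V.M.a_closed)
    show "\<zero>\<^bsub>A\<^esub> \<in> ?S"
      using mem[of "\<zero>\<^bsub>A\<^esub>" "\<zero>\<^bsub>A\<^esub>"] I'' L' by simp
  next
    fix u v assume "u \<in> ?S" "v \<in> ?S"
    then obtain x y x' y' where *: "u = x \<oplus>\<^bsub>A\<^esub> y" "v = x' \<oplus>\<^bsub>A\<^esub> y'" "x \<in> I" "y \<in> L" "x' \<in> I" "y' \<in> L"
      by blast
    then have "x \<in> carrier A" "y \<in> carrier A" "x' \<in> carrier A" "y' \<in> carrier A"
      using I'' L' by blast+
    then have "u \<oplus>\<^bsub>A\<^esub> v = (x \<oplus>\<^bsub>A\<^esub> x') \<oplus>\<^bsub>A\<^esub> (y \<oplus>\<^bsub>A\<^esub> y')"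
      using * by (simp add: V.M.a_ac)
    then show "u \<oplus>\<^bsub>A\<^esub> v \<in> ?S"
      using mem[of "x \<oplus>\<^bsub>A\<^esub> x'" "y \<oplus>\<^bsub>A\<^esub> y'"] * I'' L' by simp
  next
    fix a u assume a: "a \<in> carrier A" and "u \<in> ?S"
    then obtain x y where *: "u = x \<oplus>\<^bsub>A\<^esub> y" "x \<in> I" "y \<in> L"
      by blast
    then have "x \<in> carrier A" "y \<in> carrier A"
      using I'' L' by blast+
    then have "a \<otimes>\<^bsub>A\<^esub> u = a \<otimes>\<^bsub>A\<^esub> x \<oplus>\<^bsub>A\<^esub> a \<otimes>\<^bsub>A\<^esub> y"
      using a * by (simp add: A.r_distr)
    then show "a \<otimes>\<^bsub>A\<^esub> u \<in> ?S"
      using mem[of "a \<otimes>\<^bsub>A\<^esub> x" "a \<otimes>\<^bsub>A\<^esub> y"] a * I'' L' by simp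
  qed
  moreover have "I \<subseteq> ?S"
  proof
    fix x assume "x \<in> I"
    then show "x \<in> ?S"
      using mem[of x "\<zero>\<^bsub>A\<^esub>"] I'' L' by (simp add: subset_iff)
  qed
  moreover have "L \<subseteq> ?S"
  proof
    fix x assume "x \<in> L"
    then show "x \<in> ?S"
      using mem[of "\<zero>\<^bsub>A\<^esub>" x] I'' L' by (simp add: subset_iff)
  qed
  ultimately have "?S = carrier A"
    using I \<open>\<not> L \<subseteq> I\<close> unfolding maximal_left_ideal_def by blast
  then obtain x c where xc: "x \<in> I" "c \<in> L" "\<one>\<^bsub>A\<^esub> = x \<oplus>\<^bsub>A\<^esub> c"
    using A.one_closed by blast
  then have "x \<in> carrier A" "c \<in> carrier A"
    using I'' L' by blast+
  then have "\<one>\<^bsub>A\<^esub> \<ominus>\<^bsub>A\<^esub> c = x"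
    using xc(3) by (simp add: a_minus_def V.M.a_assoc V.M.r_neg)
  then show thesis
    using that[of c] xc by simp
qed

lemma left_ideal_radical: "submodule (jacobson_radical A) A (regular_module A)"
proof -
  have "jacobson_radical A = carrier A \<inter> \<Inter>{I. maximal_left_ideal A I}"
    by (auto simp: jacobson_radical_def)
  then show ?thesis
    using left_ideal_Inter[of "{I. maximal_left_ideal A I}"] by (simp add: maximal_left_ideal_def)
qed

lemma radical_closed: "a \<in> jacobson_radical A \<Longrightarrow> a \<in> carrier A"
  by (simp add: jacobson_radical_def)

text \<open>
  By finite length the radical is an intersection of finitely many maximal left ideals; a
  family of least size has no superfluous member.
\<close>

lemma radical_finite_Inter:
  obtains F where "finite F" "\<And>I. I \<in> F \<Longrightarrow> maximal_left_ideal A I"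
    "jacobson_radical A = carrier A \<inter> \<Inter>F"
    "\<And>I. I \<in> F \<Longrightarrow> \<not> carrier A \<inter> \<Inter>(F - {I}) \<subseteq> I"
proof -
  let ?max = "\<lambda>F. finite F \<and> (\<forall>I\<in>F. maximal_left_ideal A I)"
  let ?l = "\<lambda>F. len A (regular_module A) (carrier A \<inter> \<Inter>F)"
  have sub: "submodule (carrier A \<inter> \<Inter>F) A (regular_module A)" if "?max F" for F
    using that by (intro left_ideal_Inter) (auto simp: maximal_left_ideal_def)
  have "?max {}" by simp
  then have "\<exists>G. ?max G \<and> (\<forall>F. ?max F \<longrightarrow> ?l G \<le> ?l F)"
    by (rule ex_has_least_nat)
  then obtain G where G: "?max G" "\<And>F. ?max F \<Longrightarrow> ?l G \<le> ?l F"
    by blast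
  have "carrier A \<inter> \<Inter>G \<subseteq> I" if I: "maximal_left_ideal A I" for I
  proof (rule ccontr)
    assume "\<not> carrier A \<inter> \<Inter>G \<subseteq> I"
    then have *: "carrier A \<inter> \<Inter>(insert I G) \<subset> carrier A \<inter> \<Inter>G" by blast
    have "finite_len A (regular_module A) (carrier A \<inter> \<Inter>G)"
      using left_module.submodule_carrier[OF left_module_regular_algebra]
      by (intro finite_len_mono[OF finite_len_regular]) simp_all
    moreover have max: "?max (insert I G)"
      using G(1) I by simp
    ultimately have "?l (insert I G) < ?l G"
      using sub[OF max] sub[OF G(1)] * by (intro len_less)
    then show False
      using G(2)[OF max] by simp
  qed
  then have J: "jacobson_radical A = carrier A \<inter> \<Inter>G"
    using G(1) by (auto simp: jacobson_radical_def)
  let ?J = "\<lambda>F. ?max F \<and> jacobson_radical A = carrier A \<inter> \<Inter>F"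
  have "\<exists>F. ?J F \<and> (\<forall>F'. ?J F' \<longrightarrow> card F \<le> card F')"
    by (rule ex_has_least_nat[of ?J G]) (use G(1) J in simp)
  then obtain F where F: "?J F" "\<And>F'. ?J F' \<Longrightarrow> card F \<le> card F'"
    by blast
  have irr: "\<not> carrier A \<inter> \<Inter>(F - {I}) \<subseteq> I" if I: "I \<in> F" for I
  proof
    assume "carrier A \<inter> \<Inter>(F - {I}) \<subseteq> I"
    then have eq: "carrier A \<inter> \<Inter>(F - {I}) = carrier A \<inter> \<Inter>F"
      using I by blast
    have "card F \<le> card (F - {I})"
      by (rule F(2)) (use F(1) eq in simp)
    moreover have "card (F - {I}) < card F"
      using F(1) I by (intro card_Diff1_less) auto
    ultimately show False by simp
  qed
  show thesis
    by (rule that[of F]) (use F(1) irr in blast)+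
qed

text \<open>
  A version of the Chinese remainder theorem.  Choose \<open>c I\<close> in all members of \<open>F\<close> but \<open>I\<close>, with
  \<open>1 - c I\<close> in \<open>I\<close>.  Then \<open>I (c I)\<close> lies in the radical, and the sum of all \<open>c I\<close> is congruent to
  \<open>1\<close> modulo the radical, so that not all \<open>c I\<close> lie in the proper left ideal \<open>L\<close>.
\<close>

lemma radical_idempotent_outside:
  assumes F: "finite F" "\<And>I. I \<in> F \<Longrightarrow> maximal_left_ideal A I"
    and J: "jacobson_radical A = carrier A \<inter> \<Inter>F"
    and irredundant: "\<And>I. I \<in> F \<Longrightarrow> \<not> carrier A \<inter> \<Inter>(F - {I}) \<subseteq> I"
    and L: "submodule L A (regular_module A)" "jacobson_radical A \<subseteq> L" "\<one>\<^bsub>A\<^esub> \<notin> L"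
  obtains I c where "I \<in> F" "c \<in> carrier A" "c \<notin> L" "\<forall>a\<in>I. a \<otimes>\<^bsub>A\<^esub> c \<in> jacobson_radical A"
proof -
  have ideal: "submodule I A (regular_module A)" if "I \<in> F" for I
    using F(2)[OF that] by (simp add: maximal_left_ideal_def)
  have "\<exists>c. c \<in> carrier A \<inter> \<Inter>(F - {I}) \<and> \<one>\<^bsub>A\<^esub> \<ominus>\<^bsub>A\<^esub> c \<in> I" if "I \<in> F" for I
    using maximal_left_ideal_comaximal[OF F(2)[OF that] left_ideal_Inter irredundant[OF that]] ideal
    by (metis DiffD1)
  then obtain c where c: "\<And>I. I \<in> F \<Longrightarrow> c I \<in> carrier A \<inter> \<Inter>(F - {I})"
    "\<And>I. I \<in> F \<Longrightarrow> \<one>\<^bsub>A\<^esub> \<ominus>\<^bsub>A\<^esub> c I \<in> I"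
    by metis
  have cA: "c I \<in> carrier A" if "I \<in> F" for I
    using c(1)[OF that] by blast
  have cI: "c I \<in> I'" if "I \<in> F" "I' \<in> F" "I' \<noteq> I" for I I'
    using c(1)[OF that(1)] that by blast
  have Ic: "a \<otimes>\<^bsub>A\<^esub> c I \<in> jacobson_radical A" if I: "I \<in> F" and a: "a \<in> I" for I a
  proof -
    have aA: "a \<in> carrier A"
      using ideal[OF I] a by (auto simp: left_ideal_iff)
    have "a \<otimes>\<^bsub>A\<^esub> c I \<in> I'" if I': "I' \<in> F" for I'
    proof (cases "I' = I")
      case True
      have "a \<otimes>\<^bsub>A\<^esub> (\<one>\<^bsub>A\<^esub> \<ominus>\<^bsub>A\<^esub> c I) \<in> I"
        using ideal[OF I] c(2)[OF I] aA by (simp add: left_ideal_iff)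
      then have "a \<ominus>\<^bsub>A\<^esub> a \<otimes>\<^bsub>A\<^esub> (\<one>\<^bsub>A\<^esub> \<ominus>\<^bsub>A\<^esub> c I) \<in> I"
        by (rule left_ideal_minus[OF ideal[OF I] a])
      moreover have "a \<ominus>\<^bsub>A\<^esub> a \<otimes>\<^bsub>A\<^esub> (\<one>\<^bsub>A\<^esub> \<ominus>\<^bsub>A\<^esub> c I) = a \<otimes>\<^bsub>A\<^esub> c I"
        using aA cA[OF I]
        by (simp add: a_minus_def A.r_distr V.M.minus_add A.r_minus V.M.minus_minus
            V.M.r_neg2)
      ultimately show ?thesis
        using True by simp
    next
      case False
      then show ?thesis
        using cI[OF I I'] ideal[OF I'] aA by (simp add: left_ideal_iff)
    qed
    then show ?thesis
      using J aA cA[OF I] by simp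
  qed
  note result = that
  show thesis
  proof (rule ccontr)
    assume "\<not> thesis"
    then have cL: "c I \<in> L" if I: "I \<in> F" for I
      using result[OF I cA[OF I]] Ic[OF I] by blast
    have LA: "L \<subseteq> carrier A"
      using L(1) by (simp add: left_ideal_iff)
    have "\<exists>e\<in>L. (\<forall>I\<in>G. \<one>\<^bsub>A\<^esub> \<ominus>\<^bsub>A\<^esub> e \<in> I) \<and> (\<forall>I\<in>F - G. e \<in> I)" if "finite G" "G \<subseteq> F" for G
      using that
    proof induction
      case empty
      show ?case
        using L(1) ideal by (intro bexI[of _ "\<zero>\<^bsub>A\<^esub>"]) (auto simp: left_ideal_iff)
    next
      case (insert I G)
      then obtain e where e: "e \<in> L" "\<And>I. I \<in> G \<Longrightarrow> \<one>\<^bsub>A\<^esub> \<ominus>\<^bsub>A\<^esub> e \<in> I" "\<And>I. I \<in> F - G \<Longrightarrow> e \<in> I"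
        by auto
      have I: "I \<in> F" using insert by simp
      have A': "e \<in> carrier A" "c I \<in> carrier A"
        using e(1) LA cA[OF I] by auto
      have eq: "\<one>\<^bsub>A\<^esub> \<ominus>\<^bsub>A\<^esub> (e \<oplus>\<^bsub>A\<^esub> c I) = (\<one>\<^bsub>A\<^esub> \<ominus>\<^bsub>A\<^esub> e) \<ominus>\<^bsub>A\<^esub> c I"
        "\<one>\<^bsub>A\<^esub> \<ominus>\<^bsub>A\<^esub> (e \<oplus>\<^bsub>A\<^esub> c I) = (\<one>\<^bsub>A\<^esub> \<ominus>\<^bsub>A\<^esub> c I) \<ominus>\<^bsub>A\<^esub> e"
        using A' by (simp_all add: a_minus_def V.M.minus_add V.M.a_ac)
      show ?case
      proof (intro bexI[of _ "e \<oplus>\<^bsub>A\<^esub> c I"] conjI ballI)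
        show "e \<oplus>\<^bsub>A\<^esub> c I \<in> L"
          using L(1) e(1) cL[OF I] by (simp add: left_ideal_iff)
        show "\<one>\<^bsub>A\<^esub> \<ominus>\<^bsub>A\<^esub> (e \<oplus>\<^bsub>A\<^esub> c I) \<in> I'" if I': "I' \<in> insert I G" for I'
        proof (cases "I' = I")
          case True
          then show ?thesis
            unfolding eq(2) using e(3)[of I] c(2)[OF I] insert.hyps I
            by (auto intro: left_ideal_minus ideal)
        next
          case False
          then have "I' \<in> G" "I' \<in> F"
            using I' insert.prems by auto
          then show ?thesis
            unfolding eq(1) using e(2)[of I'] cI[OF I _ False] by (auto intro: left_ideal_minus ideal)
        qed
        show "e \<oplus>\<^bsub>A\<^esub> c I \<in> I'" if I': "I' \<in> F - insert I G" for I'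
          using I' e(3)[of I'] cI[OF I, of I'] ideal[of I'] by (simp add: left_ideal_iff)
      qed
    qed
    from this[OF F(1) order_refl] obtain e where e: "e \<in> L" "\<And>I. I \<in> F \<Longrightarrow> \<one>\<^bsub>A\<^esub> \<ominus>\<^bsub>A\<^esub> e \<in> I"
      by auto
    have eA: "e \<in> carrier A"
      using e(1) LA by blast
    have "\<one>\<^bsub>A\<^esub> \<ominus>\<^bsub>A\<^esub> e \<in> jacobson_radical A"
      using e(2) eA J by simp
    then have "(\<one>\<^bsub>A\<^esub> \<ominus>\<^bsub>A\<^esub> e) \<oplus>\<^bsub>A\<^esub> e \<in> L"
      using L(1,2) e(1) by (auto simp: left_ideal_iff)
    then show False
      using L(3) eA by (simp add: a_minus_def V.M.a_assoc V.M.l_neg)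
  qed
qed

lemma submodule_radical_submodule:
  assumes "left_module A M"
  shows "submodule (radical_submodule A M) A M"
proof -
  interpret M: left_module A M by fact
  have sub: "radical_submodule A M \<subseteq> carrier M"
  proof
    show "x \<in> carrier M" if "x \<in> radical_submodule A M" for x
      using that by induction (auto simp: radical_closed)
  qed
  have smult: "a \<odot>\<^bsub>M\<^esub> x \<in> radical_submodule A M"
    if "x \<in> radical_submodule A M" "a \<in> carrier A" for a x
    using that
  proof induction
    case (smult b x)
    then have "a \<otimes>\<^bsub>A\<^esub> b \<in> jacobson_radical A"
      using left_ideal_radical by (simp add: left_ideal_iff)
    then have "(a \<otimes>\<^bsub>A\<^esub> b) \<odot>\<^bsub>M\<^esub> x \<in> radical_submodule A M"
      using smult by (intro radical_submodule.smult)
    then show ?case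
      using smult by (simp add: M.smult_assoc1 radical_closed)
  next
    case (add x y)
    then have "a \<odot>\<^bsub>M\<^esub> x \<oplus>\<^bsub>M\<^esub> a \<odot>\<^bsub>M\<^esub> y \<in> radical_submodule A M"
      by (intro radical_submodule.add) auto
    then show ?case
      using add sub by (simp add: M.smult_r_distr subset_iff)
  qed (auto intro: radical_submodule.zero)
  show ?thesis
    unfolding M.submodule_iff
    using sub smult by (auto intro: radical_submodule.intros)
qed

lemma module_hom_radical_coefficients:
  assumes "left_module A M" and f: "f \<in> module_hom A (free_module A n) M"
    and v: "v \<in> carrier (free_module A n)" "\<And>i. i < n \<Longrightarrow> v i \<in> jacobson_radical A"
  shows "f v \<in> radical_submodule A M"
  unfolding module_hom_free[OF assms(1) f v(1)]
proof (rule lin_comb_in_submodule[OF assms(1) submodule_radical_submodule[OF assms(1)]])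
  fix i assume "i < n"
  then show "v i \<odot>\<^bsub>M\<^esub> f (unit_vector A n i) \<in> radical_submodule A M"
    by (intro radical_submodule.smult v(2) module_hom_closed[OF f] unit_vector_closed
        A.ring_axioms)
qed

lemma radical_kills_radical_submodule:
  assumes "left_module A M"
    and "\<And>a b x. a \<in> jacobson_radical A \<Longrightarrow> b \<in> jacobson_radical A \<Longrightarrow> x \<in> carrier M \<Longrightarrow>
      a \<odot>\<^bsub>M\<^esub> (b \<odot>\<^bsub>M\<^esub> x) = \<zero>\<^bsub>M\<^esub>"
    and "a \<in> jacobson_radical A" "x \<in> radical_submodule A M"
  shows "a \<odot>\<^bsub>M\<^esub> x = \<zero>\<^bsub>M\<^esub>"
proof -
  interpret M: left_module A M by fact
  have sub: "radical_submodule A M \<subseteq> carrier M"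
    using submodule_radical_submodule[OF assms(1)] by (simp add: M.submodule_iff)
  show ?thesis
    using assms(4)
  proof induction
    case (add x y)
    then show ?case
      using sub assms(3) by (simp add: M.smult_r_distr subset_iff radical_closed)
  qed (use assms(2,3) in \<open>auto simp: radical_closed\<close>)
qed

lemma radical_submodule_trivial:
  assumes "left_module A M"
    and "\<And>a x. a \<in> jacobson_radical A \<Longrightarrow> x \<in> carrier M \<Longrightarrow> a \<odot>\<^bsub>M\<^esub> x = \<zero>\<^bsub>M\<^esub>"
  shows "radical_submodule A M = {\<zero>\<^bsub>M\<^esub>}"
proof -
  interpret M: left_module A M by fact
  have "x = \<zero>\<^bsub>M\<^esub>" if "x \<in> radical_submodule A M" for x
    using that by induction (auto simp: assms(2))
  then show ?thesis
    using radical_submodule.zero by blast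
qed

text \<open>Nakayama's lemma, for modules annihilated by the square of the radical.\<close>

lemma nakayama:
  assumes "left_module A M"
    and sq: "\<And>a b x. a \<in> jacobson_radical A \<Longrightarrow> b \<in> jacobson_radical A \<Longrightarrow> x \<in> carrier M \<Longrightarrow>
      a \<odot>\<^bsub>M\<^esub> (b \<odot>\<^bsub>M\<^esub> x) = \<zero>\<^bsub>M\<^esub>"
    and top: "carrier M \<subseteq> radical_submodule A M"
  shows "carrier M = {\<zero>\<^bsub>M\<^esub>}"
proof -
  interpret M: left_module A M by fact
  have "a \<odot>\<^bsub>M\<^esub> x = \<zero>\<^bsub>M\<^esub>" if "a \<in> jacobson_radical A" "x \<in> carrier M" for a x
    by (rule radical_kills_radical_submodule[OF assms(1) sq that(1)]) (use top that in auto)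
  from radical_submodule_trivial[OF assms(1) this] show ?thesis
    using top M.M.zero_closed by blast
qed

text \<open>
  Adding to \<open>U\<close> a simple submodule \<open>A z\<close> isomorphic to \<open>A/I\<close> that is not contained in \<open>U\<close>.  The sum
  is direct, so that homomorphisms into \<open>V/U\<close> lift to \<open>V\<close>.
\<close>

lemma len_homs_into_add_simple:
  assumes Y: "left_module A Y" "free_cover A Y" and T: "left_module A T" "free_cover A T"
    and U: "submodule U A T" and V: "submodule V A T" "U \<subseteq> V"
    and I: "maximal_left_ideal A I"
    and z: "z \<in> V" "z \<notin> U" "\<And>a. a \<in> I \<Longrightarrow> a \<odot>\<^bsub>T\<^esub> z = \<zero>\<^bsub>T\<^esub>"
    and gen: "\<And>v. v \<in> V \<Longrightarrow> \<exists>u\<in>U. \<exists>a\<in>carrier A. v = u \<oplus>\<^bsub>T\<^esub> a \<odot>\<^bsub>T\<^esub> z"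
  shows "len K (hom_space K A Y T) (homs_into A Y T V) =
    len K (hom_space K A Y T) (homs_into A Y T U) +
    hom_len K A Y (quotient_module (regular_module A) I)"
proof -
  interpret T: left_module A T by fact
  interpret A': left_module A "regular_module A"
    by (rule left_module_regular_algebra)
  let ?S = "quotient_module (regular_module A) I" and ?Q = "quotient_module T U"
  let ?q = "coset_rep T U"
  have I': "submodule I A (regular_module A)"
    using I by (simp add: maximal_left_ideal_def)
  have IA: "I \<subseteq> carrier A"
    using I' by (simp add: left_ideal_iff)
  have VT: "V \<subseteq> carrier T"
    using V(1) by (simp add: T.submodule_iff)
  then have zT: "z \<in> carrier T"
    using z(1) by blast
  have S: "left_module A ?S"
    by (rule A'.left_module_quotient[OF I'])
  have Q: "left_module A ?Q"
    by (rule T.left_module_quotient[OF U])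
  note q = coset_rep_hom[OF T(1) U]
  have fcS: "free_cover A ?S"
    using finite_len_regular left_module_regular_algebra
    by (intro free_cover_image[OF _ coset_rep_hom[OF left_module_regular_algebra I']])
      (simp_all add: free_cover_iff_finite_len)
  have fcQ: "free_cover A ?Q"
    by (intro free_cover_image[OF T(2) q]) simp
  \<comment> \<open>the isomorphism of \<open>A/I\<close> with \<open>A z\<close>, and its composition with the projection to \<open>T/U\<close>\<close>
  define j where "j a = a \<odot>\<^bsub>T\<^esub> z" for a
  have j0: "j \<in> module_hom A (regular_module A) T"
    unfolding j_def using zT by (intro module_homI) (simp_all add: T.smult_l_distr T.smult_assoc1)
  have jI: "j a = \<zero>\<^bsub>T\<^esub>" if "a \<in> I" for a
    using z(3) that by (simp add: j_def)
  note j = quotient_module_hom[OF left_module_regular_algebra I' T(1) j0 jI]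
  have i: "(\<lambda>a. ?q (j a)) \<in> module_hom A ?S ?Q"
    by (rule module_hom_comp[OF j(1) q])
  have jT: "j a \<in> carrier T" if "a \<in> carrier A" for a
    using module_hom_closed[OF j0] that by simp
  have jV: "j a \<in> V" if "a \<in> carrier A" for a
    using V(1) z(1) that by (simp add: j_def T.submodule_iff)
  have rep: "coset_rep (regular_module A) I a \<in> carrier A" if "a \<in> carrier A" for a
    using A'.coset_rep(1)[OF I'] that by simp
  have "{a \<in> carrier A. j a \<in> U} = I"
  proof -
    have "submodule {a \<in> carrier (regular_module A). j a \<in> U} A (regular_module A)"
      by (rule submodule_vimage[OF j0 left_module_regular_algebra T(1) U])
    moreover have "I \<subseteq> {a \<in> carrier A. j a \<in> U}"
      using IA jI U by (auto simp: T.submodule_iff)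
    moreover have "\<one>\<^bsub>A\<^esub> \<notin> {a \<in> carrier A. j a \<in> U}"
      using z(2) zT by (simp add: j_def)
    ultimately show ?thesis
      using I A.one_closed unfolding maximal_left_ideal_def by simp blast
  qed
  then have ker: "a \<in> I" if "a \<in> carrier A" "j a \<in> U" for a
    using that by blast
  have inj: "inj_on (\<lambda>a. ?q (j a)) (carrier ?S)"
  proof (rule module_hom_inj_onI[OF S Q i])
    fix s assume s: "s \<in> carrier ?S" "?q (j s) = \<zero>\<^bsub>?Q\<^esub>"
    then obtain a where a: "a \<in> carrier A" "s = coset_rep (regular_module A) I a"
      by auto
    have "j a \<in> U"
      using s(2) a j(2)[of a] jT[OF a(1)] T.coset_rep_eq_zero[OF U] by simp
    then have "a \<in> I"
      using ker a(1) by blast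
    then show "s = \<zero>\<^bsub>?S\<^esub>"
      using a A'.coset_rep_eq_zero[OF I', of a] by simp
  qed
  have im: "?q v \<in> (\<lambda>a. ?q (j a)) ` carrier ?S" if v: "v \<in> V" for v
  proof -
    obtain u a where ua: "u \<in> U" "a \<in> carrier A" "v = u \<oplus>\<^bsub>T\<^esub> a \<odot>\<^bsub>T\<^esub> z"
      using gen[OF v] by blast
    have uT: "u \<in> carrier T"
      using ua(1) V(2) VT by blast
    have "v \<ominus>\<^bsub>T\<^esub> j a = u"
      using ua uT jT[OF ua(2)] by (simp add: a_minus_def j_def T.M.a_assoc T.M.r_neg)
    then have "?q v = ?q (j a)"
      using T.coset_rep_eq[OF U, of v "j a"] ua(1) jT[OF ua(2)] v VT by auto
    also have "\<dots> = ?q (j (coset_rep (regular_module A) I a))"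
      using j(2)[of a] ua(2) by simp
    finally show ?thesis
      using ua(2) by auto
  qed
  let ?H = "hom_space K A Y T" and ?HQ = "hom_space K A Y ?Q" and ?HS = "hom_space K A Y ?S"
  note H = left_module_hom_space[OF Y(1) T(1)]
    and HQ = left_module_hom_space[OF Y(1) Q] and HS = left_module_hom_space[OF Y(1) S]
  let ?p = "\<lambda>f. \<lambda>x\<in>carrier Y. ?q (f x)"
  let ?i = "\<lambda>f. \<lambda>x\<in>carrier Y. ?q (j (f x))"
  have p: "?p \<in> module_hom K ?H ?HQ"
    by (rule postcompose_hom[OF Y(1) q])
  have i': "?i \<in> module_hom K ?HS ?HQ"
    by (rule postcompose_hom[OF Y(1) i])
  have finV: "finite_len K ?H (homs_into A Y T V)"
    by (rule finite_len_mono[OF finite_len_hom_space[OF Y T] _ left_module.submodule_carrier[OF H]])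
      (auto simp: homs_into_def)
  have "len K ?H (homs_into A Y T V) =
    len K ?H (homs_into A Y T V \<inter> {f \<in> carrier ?H. ?p f = \<zero>\<^bsub>?HQ\<^esub>}) +
    len K ?HQ (?p ` homs_into A Y T V)"
    by (rule len_kernel_image[OF H HQ p finV submodule_homs_into[OF Y(1) T(1) V(1)]])
  also have "homs_into A Y T V \<inter> {f \<in> carrier ?H. ?p f = \<zero>\<^bsub>?HQ\<^esub>} = homs_into A Y T U"
  proof -
    have "?p f = \<zero>\<^bsub>?HQ\<^esub> \<longleftrightarrow> f ` carrier Y \<subseteq> U" if f: "f \<in> carrier ?H" for f
    proof -
      have fY: "f x \<in> carrier T" if "x \<in> carrier Y" for x
        using f that module_hom_closed[of f A Y T x] by simp
      have "?p f = \<zero>\<^bsub>?HQ\<^esub> \<longleftrightarrow> (\<forall>x\<in>carrier Y. ?q (f x) = ?q \<zero>\<^bsub>T\<^esub>)"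
        by (auto simp: fun_eq_iff restrict_def)
      also have "\<dots> \<longleftrightarrow> (\<forall>x\<in>carrier Y. f x \<in> U)"
        using fY T.coset_rep_eq_zero[OF U] by blast
      finally show ?thesis by blast
    qed
    then show ?thesis
      using V(2) unfolding homs_into_def by auto
  qed
  also have "?p ` homs_into A Y T V = ?i ` carrier ?HS"
  proof
    show "?p ` homs_into A Y T V \<subseteq> ?i ` carrier ?HS"
    proof
      fix g assume "g \<in> ?p ` homs_into A Y T V"
      then obtain f where f: "f \<in> module_hom A Y T" "f ` carrier Y \<subseteq> V" "g = ?p f"
        unfolding homs_into_def by blast
      have "(\<lambda>x. ?q (f x)) ` carrier Y \<subseteq> (\<lambda>a. ?q (j a)) ` carrier ?S"
        using f(2) im by blast
      then obtain h where h: "h \<in> module_hom A Y ?S" "\<And>x. x \<in> carrier Y \<Longrightarrow> ?q (j (h x)) = ?q (f x)"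
        using module_hom_factor_inj[OF Y(1) S Q module_hom_comp[OF f(1) q] i inj] by blast
      have "g = ?i (restrict h (carrier Y))"
        unfolding f(3) using h(2) by (intro restrict_ext) simp
      moreover have "restrict h (carrier Y) \<in> carrier ?HS"
        using module_hom_restrict[OF Y(1) h(1)] by simp
      ultimately show "g \<in> ?i ` carrier ?HS" by blast
    qed
    show "?i ` carrier ?HS \<subseteq> ?p ` homs_into A Y T V"
    proof
      fix g assume "g \<in> ?i ` carrier ?HS"
      then obtain h where h: "h \<in> module_hom A Y ?S" "g = ?i h" by auto
      let ?f = "\<lambda>x\<in>carrier Y. j (h x)"
      have "j (h x) \<in> V" if "x \<in> carrier Y" for x
        using module_hom_closed[OF h(1) that] rep jV by auto
      then have "?f \<in> homs_into A Y T V"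
        using module_hom_restrict[OF Y(1) module_hom_comp[OF h(1) j(1)]]
        by (auto simp: homs_into_def)
      moreover have "g = ?p ?f"
        unfolding h(2) by (intro restrict_ext) simp
      ultimately show "g \<in> ?p ` homs_into A Y T V" by blast
    qed
  qed
  also have "len K ?HQ (?i ` carrier ?HS) = hom_len K A Y ?S"
    unfolding hom_len_def
  proof (rule finite_len_inj(2)[symmetric, OF HS HQ i' _ left_module.submodule_carrier[OF HS]])
    show "finite_len K ?HQ (?i ` carrier ?HS)"
      by (rule finite_len_image[OF HS HQ i' finite_len_hom_space[OF Y S fcS]
            left_module.submodule_carrier[OF HS]])
    fix f assume f: "f \<in> carrier ?HS" "?i f = \<zero>\<^bsub>?HQ\<^esub>"
    have fY: "f x \<in> carrier ?S" if "x \<in> carrier Y" for x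
      using f(1) that module_hom_closed[of f A Y ?S x] by simp
    have "f x = \<zero>\<^bsub>?S\<^esub>" if x: "x \<in> carrier Y" for x
    proof (rule inj_onD[OF inj _ fY[OF x] left_module.submodule_carrier[OF S, unfolded left_module.submodule_iff[OF S], THEN conjunct2, THEN conjunct1]])
      have "?q (j (f x)) = \<zero>\<^bsub>?Q\<^esub>"
        using fun_cong[OF f(2), of x] x by simp
      also have "\<zero>\<^bsub>?Q\<^esub> = ?q (j \<zero>\<^bsub>?S\<^esub>)"
        using module_hom_zero[OF i S Q] by simp
      finally show "?q (j (f x)) = ?q (j \<zero>\<^bsub>?S\<^esub>)" .
    qed
    then show "f = \<zero>\<^bsub>?HS\<^esub>"
      using f(1) by (intro extensionalityI[of _ "carrier Y"]) simp_all
  qed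
  finally show ?thesis .
qed

text \<open>
  A module killed by the radical is a direct sum of simple modules \<open>A/I\<close>.  All that is needed of
  this decomposition is its effect on the dimension of Hom spaces.
\<close>

lemma hom_len_semisimple:
  fixes T :: "('a, 't) module"
  assumes F: "finite F" "\<And>I. I \<in> F \<Longrightarrow> maximal_left_ideal A I"
    "jacobson_radical A = carrier A \<inter> \<Inter>F"
    "\<And>I. I \<in> F \<Longrightarrow> \<not> carrier A \<inter> \<Inter>(F - {I}) \<subseteq> I"
    and T: "left_module A T" "free_cover A T"
    and kill: "\<And>a x. a \<in> jacobson_radical A \<Longrightarrow> x \<in> carrier T \<Longrightarrow> a \<odot>\<^bsub>T\<^esub> x = \<zero>\<^bsub>T\<^esub>"
  obtains m :: "'a set \<Rightarrow> nat" where
    "\<And>Y :: ('a, 'y) module. left_module A Y \<Longrightarrow> free_cover A Y \<Longrightarrow> hom_len K A Y T =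
      (\<Sum>I\<in>F. m I * hom_len K A Y (quotient_module (regular_module A) I))"
proof -
  interpret T: left_module A T by fact
  let ?P = "\<lambda>U. \<exists>m :: 'a set \<Rightarrow> nat. \<forall>Y :: ('a, 'y) module. left_module A Y \<longrightarrow> free_cover A Y \<longrightarrow>
    len K (hom_space K A Y T) (homs_into A Y T U) =
      (\<Sum>I\<in>F. m I * hom_len K A Y (quotient_module (regular_module A) I))"
  have "?P (carrier T)"
  proof (rule finite_len_climb[where P = ?P, OF _ T.submodule_carrier T.submodule_zero])
    show "finite_len A T (carrier T)"
      using T by (simp add: free_cover_iff_finite_len)
    have "len K (hom_space K A Y T) (homs_into A Y T {\<zero>\<^bsub>T\<^esub>}) = 0"
      if Y: "left_module A Y" for Y :: "('a, 'y) module"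
    proof -
      interpret H: left_module K "hom_space K A Y T"
        by (rule left_module_hom_space[OF Y T(1)])
      have "homs_into A Y T {\<zero>\<^bsub>T\<^esub>} = {\<zero>\<^bsub>hom_space K A Y T\<^esub>}"
      proof
        show "homs_into A Y T {\<zero>\<^bsub>T\<^esub>} \<subseteq> {\<zero>\<^bsub>hom_space K A Y T\<^esub>}"
        proof
          fix f assume "f \<in> homs_into A Y T {\<zero>\<^bsub>T\<^esub>}"
          then have "f = (\<lambda>x\<in>carrier Y. \<zero>\<^bsub>T\<^esub>)"
            unfolding homs_into_def by (intro extensionalityI[of _ "carrier Y"]) auto
          then show "f \<in> {\<zero>\<^bsub>hom_space K A Y T\<^esub>}" by simp
        qed
        show "{\<zero>\<^bsub>hom_space K A Y T\<^esub>} \<subseteq> homs_into A Y T {\<zero>\<^bsub>T\<^esub>}"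
          using H.M.zero_closed by (auto simp: homs_into_def)
      qed
      then show ?thesis
        using H.len_zero by simp
    qed
    then show "?P {\<zero>\<^bsub>T\<^esub>}"
      by (intro exI[of _ "\<lambda>_. 0"]) simp
    fix U assume U: "submodule U A T" "U \<subseteq> carrier T" "U \<noteq> carrier T" "?P U"
    then obtain x where x: "x \<in> carrier T" "x \<notin> U" by blast
    let ?L = "{a \<in> carrier A. a \<odot>\<^bsub>T\<^esub> x \<in> U}"
    have U': "\<zero>\<^bsub>T\<^esub> \<in> U" "\<And>u v. u \<in> U \<Longrightarrow> v \<in> U \<Longrightarrow> u \<oplus>\<^bsub>T\<^esub> v \<in> U"
      "\<And>a u. a \<in> carrier A \<Longrightarrow> u \<in> U \<Longrightarrow> a \<odot>\<^bsub>T\<^esub> u \<in> U"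
      using U(1) by (auto simp: T.submodule_iff)
    have L1: "submodule ?L A (regular_module A)"
      unfolding left_ideal_iff using x U'
      by (auto simp: T.smult_l_distr T.smult_assoc1 V.M.a_closed)
    have L2: "jacobson_radical A \<subseteq> ?L"
      using kill[OF _ x(1)] U'(1) by (auto simp: radical_closed)
    have L3: "\<one>\<^bsub>A\<^esub> \<notin> ?L"
      using x by simp
    obtain I c where Ic: "I \<in> F" "c \<in> carrier A" "c \<notin> ?L"
      "\<forall>a\<in>I. a \<otimes>\<^bsub>A\<^esub> c \<in> jacobson_radical A"
      by (rule radical_idempotent_outside[OF F L1 L2 L3])
    define z where "z = c \<odot>\<^bsub>T\<^esub> x"
    have z: "z \<in> carrier T" "z \<notin> U"
      using Ic x by (auto simp: z_def)
    have Iz: "a \<odot>\<^bsub>T\<^esub> z = \<zero>\<^bsub>T\<^esub>" if a: "a \<in> I" for a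
    proof -
      have "a \<in> carrier A"
        using F(2)[OF Ic(1)] a by (auto simp: maximal_left_ideal_def left_ideal_iff)
      then have "a \<odot>\<^bsub>T\<^esub> z = (a \<otimes>\<^bsub>A\<^esub> c) \<odot>\<^bsub>T\<^esub> x"
        using Ic(2) x(1) by (simp add: z_def T.smult_assoc1)
      then show ?thesis
        using kill[OF bspec[OF Ic(4) a] x(1)] by simp
    qed
    define V where "V = {u \<oplus>\<^bsub>T\<^esub> a \<odot>\<^bsub>T\<^esub> z | u a. u \<in> U \<and> a \<in> carrier A}"
    have memV: "u \<oplus>\<^bsub>T\<^esub> a \<odot>\<^bsub>T\<^esub> z \<in> V" if "u \<in> U" "a \<in> carrier A" for u a
      unfolding V_def using that by blast
    have V: "submodule V A T"
      unfolding T.submodule_iff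
    proof (intro conjI ballI)
      show "V \<subseteq> carrier T"
        using U(2) z(1) by (auto simp: V_def intro!: T.M.a_closed)
      show "\<zero>\<^bsub>T\<^esub> \<in> V"
        using memV[of "\<zero>\<^bsub>T\<^esub>" "\<zero>\<^bsub>A\<^esub>"] U'(1) z(1) by simp
    next
      fix v w assume "v \<in> V" "w \<in> V"
      then obtain u a u' a' where *: "v = u \<oplus>\<^bsub>T\<^esub> a \<odot>\<^bsub>T\<^esub> z" "w = u' \<oplus>\<^bsub>T\<^esub> a' \<odot>\<^bsub>T\<^esub> z"
        "u \<in> U" "u' \<in> U" "a \<in> carrier A" "a' \<in> carrier A"
        unfolding V_def by blast
      have "u \<in> carrier T" "u' \<in> carrier T"
        using * U(2) by auto
      then have "v \<oplus>\<^bsub>T\<^esub> w = (u \<oplus>\<^bsub>T\<^esub> u') \<oplus>\<^bsub>T\<^esub> (a \<oplus>\<^bsub>A\<^esub> a') \<odot>\<^bsub>T\<^esub> z"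
        using * z(1) by (simp add: T.smult_l_distr T.M.a_ac)
      then show "v \<oplus>\<^bsub>T\<^esub> w \<in> V"
        using memV[of "u \<oplus>\<^bsub>T\<^esub> u'" "a \<oplus>\<^bsub>A\<^esub> a'"] * U'(2) by (simp add: V.M.a_closed)
    next
      fix b v assume b: "b \<in> carrier A" and "v \<in> V"
      then obtain u a where *: "v = u \<oplus>\<^bsub>T\<^esub> a \<odot>\<^bsub>T\<^esub> z" "u \<in> U" "a \<in> carrier A"
        unfolding V_def by blast
      have "u \<in> carrier T"
        using * U(2) by auto
      then have "b \<odot>\<^bsub>T\<^esub> v = (b \<odot>\<^bsub>T\<^esub> u) \<oplus>\<^bsub>T\<^esub> (b \<otimes>\<^bsub>A\<^esub> a) \<odot>\<^bsub>T\<^esub> z"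
        using * z(1) b by (simp add: T.smult_r_distr T.smult_assoc1)
      then show "b \<odot>\<^bsub>T\<^esub> v \<in> V"
        using memV[of "b \<odot>\<^bsub>T\<^esub> u" "b \<otimes>\<^bsub>A\<^esub> a"] * b U'(3) by simp
    qed
    have UV: "U \<subseteq> V"
    proof
      fix u assume u: "u \<in> U"
      then show "u \<in> V"
        using memV[of u "\<zero>\<^bsub>A\<^esub>"] z(1) U(2) by (simp add: subset_iff)
    qed
    have zV: "z \<in> V"
      using memV[of "\<zero>\<^bsub>T\<^esub>" "\<one>\<^bsub>A\<^esub>"] z(1) U'(1) by simp
    have gen: "\<exists>u\<in>U. \<exists>a\<in>carrier A. v = u \<oplus>\<^bsub>T\<^esub> a \<odot>\<^bsub>T\<^esub> z" if "v \<in> V" for v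
      using that unfolding V_def by blast
    obtain m :: "'a set \<Rightarrow> nat" where m: "\<And>Y :: ('a, 'y) module. left_module A Y \<Longrightarrow> free_cover A Y \<Longrightarrow>
      len K (hom_space K A Y T) (homs_into A Y T U) =
        (\<Sum>I\<in>F. m I * hom_len K A Y (quotient_module (regular_module A) I))"
      using U(4) by blast
    have "len K (hom_space K A Y T) (homs_into A Y T V) =
        (\<Sum>I'\<in>F. (m I' + (if I' = I then 1 else 0)) * hom_len K A Y (quotient_module (regular_module A) I'))"
      if Y: "left_module A Y" "free_cover A Y" for Y :: "('a, 'y) module"
      using len_homs_into_add_simple[OF Y T U(1) V UV F(2)[OF Ic(1)] zV z(2) Iz gen] m[OF Y]
        F(1) Ic(1)
      by (simp add: distrib_right sum.distrib if_distrib[of "\<lambda>x. x * _"] cong: if_cong)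
    then have "?P V"
      by (intro exI[of _ "\<lambda>I'. m I' + (if I' = I then 1 else 0)"]) blast
    moreover have "V \<subseteq> carrier T"
      using V by (simp add: T.submodule_iff)
    ultimately show "\<exists>V. submodule V A T \<and> U \<subset> V \<and> V \<subseteq> carrier T \<and> ?P V"
      using V UV zV z(2) by (intro exI[of _ V]) blast
  qed simp
  then obtain m :: "'a set \<Rightarrow> nat" where m: "\<And>Y :: ('a, 'y) module. left_module A Y \<Longrightarrow>
      free_cover A Y \<Longrightarrow> len K (hom_space K A Y T) (homs_into A Y T (carrier T)) =
        (\<Sum>I\<in>F. m I * hom_len K A Y (quotient_module (regular_module A) I))"
    by blast
  have "homs_into A Y T (carrier T) = carrier (hom_space K A Y T)" for Y :: "('a, 'y) module"
    by (auto simp: homs_into_def dest: module_hom_closed)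
  then show thesis
    using m by (intro that[of m]) (simp add: hom_len_def)
qed

end

section \<open>Minimal projective covers\<close>

text \<open>
  A projective cover of \<open>Y\<close>, presented as the image of an idempotent endomorphism \<open>\<phi>\<close> of a free
  module that is compatible with a surjection \<open>\<rho>\<close> of the free module onto \<open>Y\<close>.  Minimality is
  expressed by the last clause: the kernel has its coordinates in the radical.
\<close>

definition minimal_cover ::
    "('a, 'c) ring_scheme \<Rightarrow> nat \<Rightarrow> ((nat \<Rightarrow> 'a) \<Rightarrow> (nat \<Rightarrow> 'a)) \<Rightarrow> ((nat \<Rightarrow> 'a) \<Rightarrow> 'm) \<Rightarrow>
      ('a, 'm) module \<Rightarrow> bool" where
  "minimal_cover A r \<phi> \<rho> Y \<longleftrightarrow>
    \<phi> \<in> module_hom A (free_module A r) (free_module A r) \<and>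
    (\<forall>x\<in>carrier (free_module A r). \<phi> (\<phi> x) = \<phi> x) \<and>
    \<rho> \<in> module_hom A (free_module A r) Y \<and>
    \<rho> ` carrier (free_module A r) = carrier Y \<and>
    (\<forall>x\<in>carrier (free_module A r). \<rho> (\<phi> x) = \<rho> x) \<and>
    (\<forall>x\<in>\<phi> ` carrier (free_module A r). \<rho> x = \<zero>\<^bsub>Y\<^esub> \<longrightarrow> (\<forall>i<r. x i \<in> jacobson_radical A))"

context fin_dim_algebra
begin

text \<open>
  Among the endomorphisms of a free module that are compatible with a surjection \<open>\<rho>\<close>, take one, \<open>\<phi>\<close>,
  whose image \<open>Q\<close> has the least length.  The square of \<open>\<phi>\<close> is compatible as well, so \<open>\<phi>\<close> maps \<open>Q\<close>
  bijectively to itself and can be corrected to an idempotent \<open>\<psi>\<close> with image \<open>Q\<close>.  An element of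
  the kernel outside the radical would allow \<open>\<rho>\<close> to be lifted to a proper submodule of \<open>Q\<close>.
\<close>

lemma minimal_cover_exists:
  assumes Y: "left_module A Y" "free_cover A Y"
  obtains r \<phi> \<rho> where "minimal_cover A r \<phi> \<rho> Y"
proof -
  obtain r \<rho> where \<rho>: "\<rho> \<in> module_hom A (free_module A r) Y"
    "\<rho> ` carrier (free_module A r) = carrier Y"
    using Y(2) unfolding free_cover_def by blast
  let ?F = "free_module A r"
  let ?C = "carrier (free_module A r)"
  interpret F: left_module A ?F by (rule left_module_free)
  interpret Y: left_module A Y by fact
  let ?E = "\<lambda>\<phi>. \<phi> \<in> module_hom A ?F ?F \<and> (\<forall>x\<in>?C. \<rho> (\<phi> x) = \<rho> x)"
  let ?l = "\<lambda>\<phi>. len A ?F (\<phi> ` ?C)"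
  have "\<exists>\<phi>. ?E \<phi> \<and> (\<forall>\<psi>. ?E \<psi> \<longrightarrow> ?l \<phi> \<le> ?l \<psi>)"
    by (rule ex_has_least_nat[of ?E "\<lambda>x. x"]) (simp add: module_hom_id del: direct_power_simps)
  then obtain \<phi> where \<phi>: "\<phi> \<in> module_hom A ?F ?F" "\<And>x. x \<in> ?C \<Longrightarrow> \<rho> (\<phi> x) = \<rho> x"
    and least: "\<And>\<psi>. ?E \<psi> \<Longrightarrow> ?l \<phi> \<le> ?l \<psi>" by blast
  define Q where "Q = \<phi> ` ?C"
  have \<phi>C: "\<phi> x \<in> ?C" if "x \<in> ?C" for x
    using module_hom_closed[OF \<phi>(1) that] .
  have Q: "submodule Q A ?F"
    unfolding Q_def by (rule submodule_image[OF \<phi>(1) left_module_free left_module_free F.submodule_carrier])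
  have QC: "Q \<subseteq> ?C"
    using \<phi>C by (auto simp: Q_def simp del: direct_power_simps)
  have finQ: "finite_len A ?F Q"
    by (rule finite_len_mono[OF finite_len_free QC F.submodule_carrier])
  \<comment> \<open>no compatible endomorphism has its image properly inside \<open>Q\<close>\<close>
  have no_smaller: "\<psi> ` ?C = Q"
    if \<psi>: "\<psi> \<in> module_hom A ?F ?F" "\<And>x. x \<in> ?C \<Longrightarrow> \<rho> (\<psi> x) = \<rho> x" "\<psi> ` ?C \<subseteq> Q" for \<psi>
  proof (rule ccontr)
    assume "\<psi> ` ?C \<noteq> Q"
    then have "\<psi> ` ?C \<subset> Q"
      using \<psi>(3) by blast
    then have "?l \<psi> < ?l \<phi>"
      unfolding Q_def[symmetric]
      by (intro len_less finQ Q submodule_image[OF \<psi>(1) left_module_free left_module_free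
            F.submodule_carrier])
    moreover have "?l \<phi> \<le> ?l \<psi>"
      using \<psi> by (intro least) blast
    ultimately show False
      by (simp only: leD)
  qed
  have \<phi>Q: "\<phi> ` Q = Q"
  proof -
    have "(\<lambda>x. \<phi> (\<phi> x)) ` ?C = Q"
    proof (rule no_smaller)
      show "(\<lambda>x. \<phi> (\<phi> x)) \<in> module_hom A ?F ?F"
        by (rule module_hom_comp[OF \<phi>(1) \<phi>(1)])
      show "\<rho> (\<phi> (\<phi> x)) = \<rho> x" if "x \<in> ?C" for x
        using \<phi>(2)[OF \<phi>C[OF that]] \<phi>(2)[OF that] by simp
      show "(\<lambda>x. \<phi> (\<phi> x)) ` ?C \<subseteq> Q"
        unfolding Q_def using \<phi>C by blast
    qed
    then show ?thesis
      unfolding Q_def by (simp only: image_image)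
  qed
  have FQ: "left_module A (?F\<lparr>carrier := Q\<rparr>)"
    by (rule F.left_module_submodule[OF Q])
  have \<phi>Q_hom: "\<phi> \<in> module_hom A (?F\<lparr>carrier := Q\<rparr>) ?F"
    by (rule module_hom_restrict_source[OF \<phi>(1) QC])
  have "x = \<zero>\<^bsub>?F\<^esub>" if x: "x \<in> Q" "\<phi> x = \<zero>\<^bsub>?F\<^esub>" for x
  proof -
    let ?N = "Q \<inter> {x \<in> ?C. \<phi> x = \<zero>\<^bsub>?F\<^esub>}"
    have N: "submodule ?N A ?F"
      by (intro F.submodule_Int Q submodule_kernel[OF \<phi>(1)] left_module_free)
    have "len A ?F Q = len A ?F ?N + len A ?F (\<phi> ` Q)"
      by (rule len_kernel_image[OF left_module_free left_module_free \<phi>(1) finQ Q])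
    then have "len A ?F ?N = 0"
      by (simp only: \<phi>Q)
    then have "?N = {\<zero>\<^bsub>?F\<^esub>}"
      by (intro F.len_eq_0 N finite_len_mono[OF finQ _ Q]) blast
    then show ?thesis
      using x QC by blast
  qed
  then have inj: "inj_on \<phi> Q"
    using module_hom_inj_onI[OF FQ left_module_free \<phi>Q_hom] by simp
  have sub: "\<phi> ` ?C \<subseteq> \<phi> ` carrier (?F\<lparr>carrier := Q\<rparr>)"
    using \<phi>Q by (simp add: Q_def)
  have inj': "inj_on \<phi> (carrier (?F\<lparr>carrier := Q\<rparr>))"
    using inj by simp
  obtain \<psi> where \<psi>: "\<psi> \<in> module_hom A ?F (?F\<lparr>carrier := Q\<rparr>)"
    "\<And>x. x \<in> ?C \<Longrightarrow> \<phi> (\<psi> x) = \<phi> x"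
    using module_hom_factor_inj[OF left_module_free FQ left_module_free \<phi>(1) \<phi>Q_hom inj' sub]
    by blast
  have \<psi>Q: "\<psi> x \<in> Q" if "x \<in> ?C" for x
    using module_hom_closed[OF \<psi>(1) that] by simp
  have \<psi>id: "\<psi> x = x" if x: "x \<in> Q" for x
  proof -
    have xC: "x \<in> ?C" using x QC by blast
    show ?thesis
      by (rule inj_onD[OF inj \<psi>(2)[OF xC] \<psi>Q[OF xC] x])
  qed
  have \<psi>im: "\<psi> ` ?C = Q"
  proof
    show "Q \<subseteq> \<psi> ` ?C"
    proof
      fix x assume x: "x \<in> Q"
      show "x \<in> \<psi> ` ?C"
        by (rule image_eqI[of _ _ x]) (use x QC \<psi>id[OF x] in auto)
    qed
  qed (use \<psi>Q in blast)
  have \<psi>F: "\<psi> \<in> module_hom A ?F ?F"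
    by (rule module_hom_extend_target[OF \<psi>(1) QC])
  have \<rho>\<psi>: "\<rho> (\<psi> x) = \<rho> x" if x: "x \<in> ?C" for x
  proof -
    have "\<psi> x \<in> ?C" using \<psi>Q[OF x] QC by blast
    then show ?thesis
      using \<phi>(2)[of "\<psi> x"] \<phi>(2)[OF x] \<psi>(2)[OF x] by (simp only:)
  qed
  have rad: "x i \<in> jacobson_radical A" if x: "x \<in> Q" "\<rho> x = \<zero>\<^bsub>Y\<^esub>" and i: "i < r" for x i
  proof -
    have xi: "x i \<in> carrier A"
      using x(1) QC i by (auto simp: PiE_iff)
    have "x i \<in> I" if I: "maximal_left_ideal A I" for I
    proof (rule ccontr)
      assume nI: "x i \<notin> I"
      have I': "submodule I A (regular_module A)"
        using I by (simp add: maximal_left_ideal_def)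
      have pr: "(\<lambda>v. v i) \<in> module_hom A ?F (regular_module A)"
        using i by (intro module_homI) (auto simp: PiE_iff)
      let ?L = "Q \<inter> {x \<in> ?C. \<rho> x = \<zero>\<^bsub>Y\<^esub>}"
      have L: "submodule ?L A ?F"
        by (intro F.submodule_Int Q submodule_kernel[OF \<rho>(1)] left_module_free Y(1))
      let ?N = "Q \<inter> {x \<in> ?C. x i \<in> I}"
      have N: "submodule ?N A ?F"
        by (intro F.submodule_Int Q submodule_vimage[OF pr] left_module_free
            left_module_regular_algebra I')
      have xL: "x \<in> ?L"
        using x QC by blast
      then have "\<not> (\<lambda>v. v i) ` ?L \<subseteq> I"
        using nI by blast
      then obtain c where c: "c \<in> (\<lambda>v. v i) ` ?L" "\<one>\<^bsub>A\<^esub> \<ominus>\<^bsub>A\<^esub> c \<in> I"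
        by (rule maximal_left_ideal_comaximal[OF I submodule_image[OF pr left_module_free
              left_module_regular_algebra L]])
      then obtain y where y: "y \<in> ?L" "c = y i" by blast
      \<comment> \<open>the elements of \<open>Q\<close> with coordinate \<open>i\<close> in \<open>I\<close> already map onto \<open>Y\<close>\<close>
      have onto: "\<rho> ` ?C \<subseteq> \<rho> ` ?N"
      proof
        fix u assume "u \<in> \<rho> ` ?C"
        then obtain v where v: "v \<in> ?C" "u = \<rho> v" by blast
        define w where "w = \<psi> v"
        have w: "w \<in> Q" "w \<in> ?C" "\<rho> w = u"
          using \<psi>Q[OF v(1)] QC \<rho>\<psi>[OF v(1)] v(2) by (auto simp: w_def)
        have wi: "w i \<in> carrier A"
          using w(2) i by (auto simp: PiE_iff)
        have cA: "c \<in> carrier A"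
          using y QC i by (auto simp: PiE_iff)
        define t where "t = w \<ominus>\<^bsub>?F\<^esub> (w i \<odot>\<^bsub>?F\<^esub> y)"
        have wy: "w i \<odot>\<^bsub>?F\<^esub> y \<in> ?L"
          using L wi y(1) by (simp only: F.submodule_iff)
        have tQ: "t \<in> Q"
          unfolding t_def using wy w(1) by (intro F.submodule_minus[OF Q]) blast+
        have "t i = w i \<ominus>\<^bsub>A\<^esub> w i \<otimes>\<^bsub>A\<^esub> c"
        proof -
          have "t \<oplus>\<^bsub>?F\<^esub> (w i \<odot>\<^bsub>?F\<^esub> y) = w"
            unfolding t_def using wy w(2) by (intro F.minus_add_cancel) blast+
          from fun_cong[OF this, of i] have "t i \<oplus>\<^bsub>A\<^esub> w i \<otimes>\<^bsub>A\<^esub> c = w i"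
            using i y(2) by simp
          moreover have "t i \<in> carrier A"
            using tQ QC i by (auto simp: PiE_iff)
          ultimately show ?thesis
            using wi cA
            by (metis a_minus_def A.m_closed V.M.a_assoc V.M.a_inv_closed V.M.r_neg V.M.r_zero)
        qed
        also have "\<dots> = w i \<otimes>\<^bsub>A\<^esub> (\<one>\<^bsub>A\<^esub> \<ominus>\<^bsub>A\<^esub> c)"
          using wi cA by (simp add: a_minus_def A.r_distr A.r_minus)
        also have "\<dots> \<in> I"
          using I' c(2) wi by (simp add: left_ideal_iff)
        finally have "t \<in> ?N"
          using tQ QC by blast
        moreover have "\<rho> t = u"
        proof -
          have "\<rho> t = \<rho> w \<ominus>\<^bsub>Y\<^esub> \<rho> (w i \<odot>\<^bsub>?F\<^esub> y)"
            unfolding t_def using wy w(2)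
            by (intro module_hom_minus[OF \<rho>(1) left_module_free Y(1)]) blast+
          also have "\<rho> (w i \<odot>\<^bsub>?F\<^esub> y) = \<zero>\<^bsub>Y\<^esub>"
            using wy by blast
          finally show ?thesis
            using w(2,3) module_hom_closed[OF \<rho>(1)] Y.minus_zero_right by metis
        qed
        ultimately show "u \<in> \<rho> ` ?N" by blast
      qed
      obtain h where h: "h \<in> module_hom A ?F ?F" "\<And>v. v \<in> ?C \<Longrightarrow> h v \<in> ?N"
        "\<And>v. v \<in> ?C \<Longrightarrow> \<rho> (h v) = \<rho> v"
        using free_module_lift[OF left_module_free Y(1) N \<rho>(1) \<rho>(1) onto] by blast
      have "h ` ?C = Q"
        by (rule no_smaller[OF h(1,3)]) (use h(2) in blast)+
      then have "x \<in> ?N"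
        using x(1) h(2) by blast
      then show False
        using nI by blast
    qed
    then show ?thesis
      using xi by (simp add: jacobson_radical_def)
  qed
  have "minimal_cover A r \<psi> \<rho> Y"
    unfolding minimal_cover_def \<psi>im
    using \<psi>F \<rho> \<rho>\<psi> rad \<psi>id \<psi>Q by blast
  then show thesis by (rule that)
qed

end

section \<open>Resolutions and vanishing of Ext\<close>

text \<open>
  Vanishing of the cohomology of the complex \<open>Hom(P, N)\<close> in degree \<open>n + 1\<close>: every cocycle
  on \<open>P (n + 1)\<close> factors through the differential \<open>d n\<close>.
\<close>

definition ext_vanishing ::
    "('a, 'c) ring_scheme \<Rightarrow> (nat \<Rightarrow> ('a, 'p) module) \<Rightarrow> (nat \<Rightarrow> 'p \<Rightarrow> 'p) \<Rightarrow> ('a, 'n) module \<Rightarrow>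
      nat \<Rightarrow> bool" where
  "ext_vanishing R P d N n \<longleftrightarrow> (\<forall>f\<in>module_hom R (P (Suc n)) N.
    (\<forall>x\<in>carrier (P (Suc (Suc n))). f (d (Suc n) x) = \<zero>\<^bsub>N\<^esub>) \<longrightarrow>
    (\<exists>h\<in>module_hom R (P n) N. \<forall>x\<in>carrier (P (Suc n)). f x = h (d n x)))"

lemma ext_vanishingD:
  assumes "ext_vanishing R P d N n" "f \<in> module_hom R (P (Suc n)) N"
    and "\<And>x. x \<in> carrier (P (Suc (Suc n))) \<Longrightarrow> f (d (Suc n) x) = \<zero>\<^bsub>N\<^esub>"
  shows "\<exists>h\<in>module_hom R (P n) N. \<forall>x\<in>carrier (P (Suc n)). f x = h (d n x)"
  using assms unfolding ext_vanishing_def by simp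

lemma ext_vanishing_of_trivial_cohomology:
  assumes P: "\<And>n. left_module R (P n)" "\<And>n. d n \<in> module_hom R (P (Suc n)) (P n)"
    and N: "left_module R N"
    and triv: "trivial_group (hom_cohomology R P d N (Suc n))"
  shows "ext_vanishing R P d N n"
  unfolding ext_vanishing_def
proof (intro ballI impI)
  interpret N: left_module R N by fact
  fix f assume f: "f \<in> module_hom R (P (Suc n)) N"
    and cocycle: "\<forall>x\<in>carrier (P (Suc (Suc n))). f (d (Suc n) x) = \<zero>\<^bsub>N\<^esub>"
  let ?B = "hom_coboundaries R P d N (Suc n)" and ?Z = "hom_cocycles R P d N (Suc n)"
  let ?H = "hom_group R (P (Suc n)) N"
  define f' where "f' = (\<lambda>x\<in>carrier (P (Suc n)). f x)"
  have f': "f' \<in> module_hom R (P (Suc n)) N" "f' \<in> extensional (carrier (P (Suc n)))"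
    unfolding f'_def using module_hom_restrict[OF P(1) f] by simp_all
  have "hom_differential P d (Suc n) f' = (\<lambda>x\<in>carrier (P (Suc (Suc n))). \<zero>\<^bsub>N\<^esub>)"
    unfolding hom_differential_def f'_def using cocycle module_hom_closed[OF P(2)]
    by (intro restrict_ext) simp
  then have "f' \<in> ?Z"
    using f' by (simp add: hom_cocycles_def kernel_def hom_group_def)
  then have "?B #>\<^bsub>?H\<lparr>carrier := ?Z\<rparr>\<^esub> f' \<in> carrier (hom_cohomology R P d N (Suc n))"
    by (auto simp: hom_cohomology_def FactGroup_def RCOSETS_def)
  then have coset: "?B #>\<^bsub>?H\<lparr>carrier := ?Z\<rparr>\<^esub> f' = ?B"
    using triv by (simp add: trivial_group_def hom_cohomology_def FactGroup_def)
  let ?z = "\<lambda>x\<in>carrier (P n). \<zero>\<^bsub>N\<^esub>"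
  have "?z \<in> carrier (hom_group R (P n) N)"
    using module_hom_restrict[OF P(1) module_hom_zero_map[OF N]] by (simp add: hom_group_def)
  then have "hom_differential P d n ?z \<in> ?B"
    by simp
  moreover have "hom_differential P d n ?z \<otimes>\<^bsub>?H\<^esub> f' = f'"
    using f' module_hom_closed[OF P(2)] module_hom_closed[OF f'(1)]
    by (intro extensionalityI[of _ "carrier (P (Suc n))"])
      (simp_all add: hom_group_def hom_differential_def)
  ultimately have "f' \<in> ?B #>\<^bsub>?H\<lparr>carrier := ?Z\<rparr>\<^esub> f'"
    unfolding r_coset_def by force
  then have "f' \<in> ?B"
    by (simp only: coset)
  then obtain h where h: "h \<in> carrier (hom_group R (P n) N)" "f' = hom_differential P d n h"
    by auto
  have "f x = h (d n x)" if "x \<in> carrier (P (Suc n))" for x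
    using fun_cong[OF h(2), of x] that by (simp add: f'_def hom_differential_def)
  then show "\<exists>h\<in>module_hom R (P n) N. \<forall>x\<in>carrier (P (Suc n)). f x = h (d n x)"
    using h(1) by (intro bexI[of _ h]) (simp_all add: hom_group_def)
qed

lemma ext_vanishing_retract:
  assumes "ext_vanishing R P d N n" and i: "i \<in> module_hom R N' N" and p: "p \<in> module_hom R N N'"
    and retract: "\<And>x. x \<in> carrier N' \<Longrightarrow> p (i x) = x"
    and N: "left_module R N" "left_module R N'"
  shows "ext_vanishing R P d N' n"
  unfolding ext_vanishing_def
proof (intro ballI impI)
  fix f assume f: "f \<in> module_hom R (P (Suc n)) N'"
    and "\<forall>x\<in>carrier (P (Suc (Suc n))). f (d (Suc n) x) = \<zero>\<^bsub>N'\<^esub>"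
  then have "i (f (d (Suc n) x)) = \<zero>\<^bsub>N\<^esub>" if "x \<in> carrier (P (Suc (Suc n)))" for x
    using module_hom_zero[OF i N(2,1)] that by simp
  then obtain h where h: "h \<in> module_hom R (P n) N" "\<forall>x\<in>carrier (P (Suc n)). i (f x) = h (d n x)"
    using ext_vanishingD[OF assms(1) module_hom_comp[OF f i]] by blast
  have "f x = p (h (d n x))" if x: "x \<in> carrier (P (Suc n))" for x
  proof -
    have "f x = p (i (f x))"
      by (rule retract[OF module_hom_closed[OF f x], symmetric])
    also have "i (f x) = h (d n x)"
      using h(2) x by (rule bspec)
    finally show ?thesis .
  qed
  then show "\<exists>h\<in>module_hom R (P n) N'. \<forall>x\<in>carrier (P (Suc n)). f x = h (d n x)"
    by (intro bexI[of _ "\<lambda>x. p (h x)"] ballI module_hom_comp[OF h(1) p])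
qed

lemma ext_vanishing_direct_power:
  assumes "ext_vanishing R P d N n" "left_module R N"
  shows "ext_vanishing R P d (direct_power N k) n"
  unfolding ext_vanishing_def
proof (intro ballI impI)
  fix f assume f: "f \<in> module_hom R (P (Suc n)) (direct_power N k)"
    and cocycle: "\<forall>x\<in>carrier (P (Suc (Suc n))). f (d (Suc n) x) = \<zero>\<^bsub>direct_power N k\<^esub>"
  have fk: "f x \<in> {..<k} \<rightarrow>\<^sub>E carrier N" if "x \<in> carrier (P (Suc n))" for x
    using module_hom_closed[OF f that] by simp
  have "\<exists>h\<in>module_hom R (P n) N. \<forall>x\<in>carrier (P (Suc n)). f x i = h (d n x)" if i: "i < k" for i
  proof -
    have fi: "(\<lambda>x. f x i) \<in> module_hom R (P (Suc n)) N"
      using i fk by (intro module_homI)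
        (auto simp: module_hom_add[OF f] module_hom_smult[OF f] PiE_iff)
    show ?thesis
      by (rule ext_vanishingD[OF assms(1) fi]) (use cocycle i in simp)
  qed
  then obtain h where h: "\<And>i. i < k \<Longrightarrow> h i \<in> module_hom R (P n) N"
    "\<And>i x. i < k \<Longrightarrow> x \<in> carrier (P (Suc n)) \<Longrightarrow> f x i = h i (d n x)"
    by metis
  have "(\<lambda>x. \<lambda>i\<in>{..<k}. h i x) \<in> module_hom R (P n) (direct_power N k)"
    using h(1) by (intro module_homI)
      (auto simp: module_hom_closed[OF h(1)] module_hom_add[OF h(1)] module_hom_smult[OF h(1)]
        intro!: restrict_ext)
  moreover have "f x = (\<lambda>i\<in>{..<k}. h i (d n x))" if "x \<in> carrier (P (Suc n))" for x
    using fk[OF that] h(2) that by (intro direct_power_eqI[OF fk[OF that], of _ UNIV]) simp_all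
  ultimately show "\<exists>h\<in>module_hom R (P n) (direct_power N k).
      \<forall>x\<in>carrier (P (Suc n)). f x = h (d n x)"
    by (intro bexI[of _ "\<lambda>x. \<lambda>i\<in>{..<k}. h i x"] ballI)
qed

lemma retract_of_direct_summand:
  assumes "direct_summand R M N" "left_module R M" "left_module R N"
  obtains i p where "i \<in> module_hom R M N" "p \<in> module_hom R N M"
    "\<And>x. x \<in> carrier M \<Longrightarrow> p (i x) = x"
proof -
  interpret M: left_module R M by fact
  interpret N: left_module R N by fact
  obtain U V f where U: "submodule U R N" and V: "submodule V R N" and UV: "U \<inter> V = {\<zero>\<^bsub>N\<^esub>}"
    "U <+>\<^bsub>N\<^esub> V = carrier N" and f: "f \<in> module_hom R M (N\<lparr>carrier := U\<rparr>)"
    "bij_betw f (carrier M) U"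
    using assms(1) unfolding direct_summand_def module_iso_def by auto
  have U': "U \<subseteq> carrier N" and V': "V \<subseteq> carrier N"
    using U V by (simp_all add: N.submodule_iff)
  have fN: "f \<in> module_hom R M N"
    by (rule module_hom_extend_target[OF f(1) U'])
  let ?Q = "quotient_module N V"
  note q = coset_rep_hom[OF assms(3) V]
  have Q: "left_module R ?Q"
    by (rule N.left_module_quotient[OF V])
  have inj: "inj_on (\<lambda>x. coset_rep N V (f x)) (carrier M)"
  proof (rule module_hom_inj_onI[OF assms(2) Q module_hom_comp[OF fN q]])
    fix x assume x: "x \<in> carrier M" "coset_rep N V (f x) = \<zero>\<^bsub>?Q\<^esub>"
    have fx: "f x \<in> U"
      using f(2) x(1) by (auto simp: bij_betw_def)
    have "f x \<in> V"
      using x(2) N.coset_rep_eq_zero[OF V, of "f x"] fx U' by auto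
    then have "f x = f \<zero>\<^bsub>M\<^esub>"
      using fx UV(1) module_hom_zero[OF fN assms(2,3)] by auto
    then show "x = \<zero>\<^bsub>M\<^esub>"
      using f(2) x(1) by (auto simp: bij_betw_def inj_on_def)
  qed
  have im: "coset_rep N V ` carrier N \<subseteq> (\<lambda>x. coset_rep N V (f x)) ` carrier M"
  proof
    fix y assume "y \<in> coset_rep N V ` carrier N"
    then obtain w where w: "w \<in> carrier N" "y = coset_rep N V w" by blast
    then obtain u v where uv: "u \<in> U" "v \<in> V" "w = u \<oplus>\<^bsub>N\<^esub> v"
      using UV(2) unfolding set_add_def' by blast
    have "u \<in> carrier N" "v \<in> carrier N"
      using uv U' V' by auto
    then have "w \<ominus>\<^bsub>N\<^esub> u = v"
      unfolding uv(3)
      by (simp add: a_minus_def N.M.a_comm[of u v] N.M.a_assoc N.M.r_neg)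
    then have "coset_rep N V w = coset_rep N V u"
      using N.coset_rep_eq[OF V w(1) \<open>u \<in> carrier N\<close>] uv(2) by simp
    moreover obtain x where "x \<in> carrier M" "f x = u"
      using f(2) uv(1) by (auto simp: bij_betw_def)
    ultimately show "y \<in> (\<lambda>x. coset_rep N V (f x)) ` carrier M"
      using w(2) by blast
  qed
  obtain p where p: "p \<in> module_hom R N M"
    "\<And>x. x \<in> carrier N \<Longrightarrow> coset_rep N V (f (p x)) = coset_rep N V x"
    using module_hom_factor_inj[OF assms(3,2) Q q module_hom_comp[OF fN q] inj im] by blast
  have "p (f x) = x" if x: "x \<in> carrier M" for x
  proof (rule inj_onD[OF inj])
    show "coset_rep N V (f (p (f x))) = coset_rep N V (f x)"
      by (rule p(2)[OF module_hom_closed[OF fN x]])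
    show "p (f x) \<in> carrier M"
      by (rule module_hom_closed[OF p(1) module_hom_closed[OF fN x]])
  qed (rule x)
  then show thesis
    by (rule that[OF fN p(1)])
qed

lemma free_resolutionD:
  assumes "ring R" "free_resolution R M P d e"
  shows "\<And>n. \<exists>r. P n = free_module R r" "\<And>n. left_module R (P n)"
    "\<And>n. d n \<in> module_hom R (P (Suc n)) (P n)" "e \<in> module_hom R (P 0) M"
    "e ` carrier (P 0) = carrier M"
    "d 0 ` carrier (P (Suc 0)) = {x \<in> carrier (P 0). e x = \<zero>\<^bsub>M\<^esub>}"
    "\<And>n. d (Suc n) ` carrier (P (Suc (Suc n))) =
      {x \<in> carrier (P (Suc n)). d n x = \<zero>\<^bsub>P n\<^esub>}"
proof -
  show free: "\<exists>r. P n = free_module R r" for n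
    using assms(2) unfolding free_resolution_def by blast
  show "left_module R (P n)" for n
    using free[of n] left_module_direct_power[OF left_module_regular[OF assms(1)]] by auto
qed (use assms(2) in \<open>simp_all add: free_resolution_def a_kernel_def'\<close>)

context fin_dim_algebra
begin

lemma free_resolution_exists:
  assumes G: "left_module A G" "free_cover A G"
  shows "\<exists>P d e. free_resolution A G P d e"
proof -
  obtain r0 e where e: "e \<in> module_hom A (free_module A r0) G"
    "e ` carrier (free_module A r0) = carrier G"
    using G(2) unfolding free_cover_def by blast
  have cover: "\<exists>s \<delta>. \<delta> \<in> module_hom A (free_module A s) (free_module A r) \<and>
      \<delta> ` carrier (free_module A s) = U" if U: "submodule U A (free_module A r)" for r U
  proof -
    have UC: "U \<subseteq> carrier (free_module A r)"
      using U by (simp only: left_module.submodule_iff[OF left_module_free])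
    have "free_cover A ((free_module A r)\<lparr>carrier := U\<rparr>)"
      by (rule free_cover_submodule[OF left_module_free free_cover_free U])
    then obtain s g where "g \<in> module_hom A (free_module A s) ((free_module A r)\<lparr>carrier := U\<rparr>)"
      "g ` carrier (free_module A s) = U"
      unfolding free_cover_def by auto
    then show ?thesis
      using module_hom_extend_target[OF _ UC] by blast
  qed
  let ?good = "\<lambda>n (r, s, \<delta>). \<delta> \<in> module_hom A (free_module A s) (free_module A r) \<and>
    (n = (0::nat) \<longrightarrow> r = r0 \<and> \<delta> ` carrier (free_module A s) =
      {x \<in> carrier (free_module A r0). e x = \<zero>\<^bsub>G\<^esub>})"
  let ?next = "\<lambda>n (r, s, \<delta>) (r', s', \<delta>'). r' = s \<and> \<delta>' ` carrier (free_module A s') =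
    {x \<in> carrier (free_module A s). \<delta> x = \<zero>\<^bsub>free_module A r\<^esub>}"
  have "\<exists>f. \<forall>n. ?good n (f n) \<and> ?next n (f n) (f (Suc n))"
  proof (rule dependent_nat_choice)
    obtain s \<delta> where "\<delta> \<in> module_hom A (free_module A s) (free_module A r0)"
      "\<delta> ` carrier (free_module A s) = {x \<in> carrier (free_module A r0). e x = \<zero>\<^bsub>G\<^esub>}"
      using cover[OF submodule_kernel[OF e(1) left_module_free G(1)]] by blast
    then show "\<exists>x. ?good 0 x"
      by (intro exI[of _ "(r0, s, \<delta>)"]) (simp del: direct_power_simps)
    fix x n assume x: "?good n x"
    obtain r s \<delta> where rs: "x = (r, s, \<delta>)"
      by (cases x)
    then have \<delta>: "\<delta> \<in> module_hom A (free_module A s) (free_module A r)"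
      using x by simp
    obtain s' \<delta>' where "\<delta>' \<in> module_hom A (free_module A s') (free_module A s)"
      "\<delta>' ` carrier (free_module A s') = {x \<in> carrier (free_module A s). \<delta> x = \<zero>\<^bsub>free_module A r\<^esub>}"
      using cover[OF submodule_kernel[OF \<delta> left_module_free left_module_free]] by blast
    then show "\<exists>y. ?good (Suc n) y \<and> ?next n x y"
      by (intro exI[of _ "(s, s', \<delta>')"]) (simp add: rs del: direct_power_simps)
  qed
  then obtain f where f': "\<forall>n. ?good n (f n) \<and> ?next n (f n) (f (Suc n))" ..
  note f = f'[THEN spec, THEN conjunct1] f'[THEN spec, THEN conjunct2]
  define r where "r n = fst (f n)" for n
  define d where "d n = snd (snd (f n))" for n
  have s: "fst (snd (f n)) = r (Suc n)" for n
    using f(2)[of n] by (simp add: r_def split_beta del: direct_power_simps)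
  have d: "d n \<in> module_hom A (free_module A (r (Suc n))) (free_module A (r n))" for n
    using f(1)[of n] s[of n] by (simp add: r_def d_def split_beta del: direct_power_simps)
  have r0: "r 0 = r0" "d 0 ` carrier (free_module A (r (Suc 0))) =
      {x \<in> carrier (free_module A r0). e x = \<zero>\<^bsub>G\<^esub>}"
    using f(1)[of 0] s[of 0] by (simp_all add: r_def d_def split_beta del: direct_power_simps)
  have exact: "d (Suc n) ` carrier (free_module A (r (Suc (Suc n)))) =
      {x \<in> carrier (free_module A (r (Suc n))). d n x = \<zero>\<^bsub>free_module A (r n)\<^esub>}" for n
    using f(2)[of n] s[of n] s[of "Suc n"]
    by (simp add: r_def d_def split_beta del: direct_power_simps)
  have "free_resolution A G (\<lambda>n. free_module A (r n)) d e"
    unfolding free_resolution_def a_kernel_def'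
  proof (intro conjI allI)
    show "\<exists>s. free_module A (r n) = free_module A s" for n
      by (rule exI) (rule refl)
  qed (use d e r0 exact in \<open>simp_all del: direct_power_simps\<close>)
  then show ?thesis by blast
qed

text \<open>Dimension shifting in the second argument, along \<open>0 \<rightarrow> Z \<rightarrow> Q \<rightarrow> N \<rightarrow> 0\<close>.\<close>

lemma ext_vanishing_kernel:
  assumes P: "free_resolution A G P d e"
    and Q: "left_module A Q" and N: "left_module A N"
    and \<rho>: "\<rho> \<in> module_hom A Q N" "\<rho> ` carrier Q = carrier N"
    and ext: "ext_vanishing A P d Q (Suc n)" "ext_vanishing A P d N n"
  shows "ext_vanishing A P d (Q\<lparr>carrier := {x \<in> carrier Q. \<rho> x = \<zero>\<^bsub>N\<^esub>}\<rparr>) (Suc n)"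
  unfolding ext_vanishing_def
proof (intro ballI impI)
  interpret Q: left_module A Q by fact
  interpret N: left_module A N by fact
  let ?Z = "{x \<in> carrier Q. \<rho> x = \<zero>\<^bsub>N\<^esub>}"
  note P' = free_resolutionD[OF A.ring_axioms P]
  fix f assume f: "f \<in> module_hom A (P (Suc (Suc n))) (Q\<lparr>carrier := ?Z\<rparr>)"
    and "\<forall>x\<in>carrier (P (Suc (Suc (Suc n)))). f (d (Suc (Suc n)) x) = \<zero>\<^bsub>Q\<lparr>carrier := ?Z\<rparr>\<^esub>"
  then have cocycle: "\<forall>x\<in>carrier (P (Suc (Suc (Suc n)))). f (d (Suc (Suc n)) x) = \<zero>\<^bsub>Q\<^esub>"
    by simp
  have fQ: "f \<in> module_hom A (P (Suc (Suc n))) Q"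
    by (rule module_hom_extend_target[OF f]) blast
  have f0: "\<rho> (f x) = \<zero>\<^bsub>N\<^esub>" if "x \<in> carrier (P (Suc (Suc n)))" for x
    using module_hom_closed[OF f that] by simp
  obtain h where h: "h \<in> module_hom A (P (Suc n)) Q"
    "\<And>x. x \<in> carrier (P (Suc (Suc n))) \<Longrightarrow> f x = h (d (Suc n) x)"
    using ext_vanishingD[OF ext(1) fQ] cocycle by blast
  have "\<rho> (h (d (Suc n) x)) = \<zero>\<^bsub>N\<^esub>" if "x \<in> carrier (P (Suc (Suc n)))" for x
    using f0[OF that] h(2)[OF that] by simp
  then obtain l where l: "l \<in> module_hom A (P n) N"
    "\<And>x. x \<in> carrier (P (Suc n)) \<Longrightarrow> \<rho> (h x) = l (d n x)"
    using ext_vanishingD[OF ext(2) module_hom_comp[OF h(1) \<rho>(1)]] by blast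
  obtain p where p: "P n = free_module A p"
    using P'(1) by blast
  have "l ` carrier (free_module A p) \<subseteq> \<rho> ` carrier Q"
    unfolding \<rho>(2) using module_hom_closed[OF l(1)] p by auto
  then obtain k where "k \<in> module_hom A (free_module A p) Q"
    "\<And>v. v \<in> carrier (free_module A p) \<Longrightarrow> \<rho> (k v) = l v"
    using free_module_lift[OF Q N Q.submodule_carrier \<rho>(1) l(1)[unfolded p]] by blast
  then have k: "k \<in> module_hom A (P n) Q" "\<And>v. v \<in> carrier (P n) \<Longrightarrow> \<rho> (k v) = l v"
    unfolding p by blast+
  note dn = module_hom_closed[OF P'(3)]
  let ?g = "\<lambda>x. h x \<ominus>\<^bsub>Q\<^esub> k (d n x)"
  have kd: "(\<lambda>x. k (d n x)) \<in> module_hom A (P (Suc n)) Q"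
    by (rule module_hom_comp[OF P'(3) k(1)])
  have g: "?g \<in> module_hom A (P (Suc n)) Q"
    by (rule module_hom_diff[OF h(1) kd P'(2) Q])
  have "\<rho> (?g x) = \<zero>\<^bsub>N\<^esub>" if x: "x \<in> carrier (P (Suc n))" for x
  proof -
    have "\<rho> (?g x) = \<rho> (h x) \<ominus>\<^bsub>N\<^esub> \<rho> (k (d n x))"
      by (rule module_hom_minus[OF \<rho>(1) Q N module_hom_closed[OF h(1) x] module_hom_closed[OF kd x]])
    also have "\<dots> = \<zero>\<^bsub>N\<^esub>"
      using l(2)[OF x] k(2)[OF dn[OF x]] module_hom_closed[OF l(1) dn[OF x]]
      by (simp add: N.minus_self)
    finally show ?thesis .
  qed
  then have "?g \<in> module_hom A (P (Suc n)) (Q\<lparr>carrier := ?Z\<rparr>)"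
    using module_hom_closed[OF g] by (intro module_hom_restrict_target[OF g]) blast
  moreover have "f x = ?g (d (Suc n) x)" if x: "x \<in> carrier (P (Suc (Suc n)))" for x
  proof -
    have "d (Suc n) x \<in> {x \<in> carrier (P (Suc n)). d n x = \<zero>\<^bsub>P n\<^esub>}"
      unfolding P'(7)[symmetric] using x by blast
    then have "k (d n (d (Suc n) x)) = \<zero>\<^bsub>Q\<^esub>"
      using module_hom_zero[OF k(1) P'(2) Q] by simp
    then show ?thesis
      using h(2)[OF x] module_hom_closed[OF h(1) dn[OF x]] by (simp add: Q.minus_zero_right)
  qed
  ultimately show "\<exists>g\<in>module_hom A (P (Suc n)) (Q\<lparr>carrier := ?Z\<rparr>).
      \<forall>x\<in>carrier (P (Suc (Suc n))). f x = g (d (Suc n) x)"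
    by (intro bexI[of _ ?g] ballI)
qed

text \<open>
  One step of the comparison of two resolutions: \<open>Z \<subseteq> M\<close> and \<open>S \<subseteq> M'\<close> are syzygies with covers \<open>\<rho>\<close>
  and \<open>\<delta>\<close>.  The maps \<open>a\<close> and \<open>b\<close> between them are homotopic to the identity on \<open>Z\<close> in one of the two
  directions, and this carries over to the next syzygies.
\<close>

lemma comparison_step:
  fixes M :: "('a, 'm) module" and M' :: "('a, 'n) module" and r p
  defines "F \<equiv> free_module A r" and "P \<equiv> free_module A p"
  assumes M: "left_module A M" and M': "left_module A M'"
    and \<phi>: "\<phi> \<in> module_hom A F F" "\<And>x. x \<in> carrier F \<Longrightarrow> \<phi> (\<phi> x) = \<phi> x"
    and \<rho>: "\<rho> \<in> module_hom A F M" "\<And>x. x \<in> carrier F \<Longrightarrow> \<rho> (\<phi> x) = \<rho> x" "\<rho> ` carrier F = Z"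
    and \<delta>: "\<delta> \<in> module_hom A P M'" "\<delta> ` carrier P = S"
    and a: "a \<in> module_hom A M M'" "\<And>z. z \<in> Z \<Longrightarrow> a z \<in> S"
    and b: "b \<in> module_hom A M' M" "\<And>x. x \<in> S \<Longrightarrow> b x \<in> Z"
    and t: "t \<in> module_hom A M F" "\<And>x. x \<in> carrier M \<Longrightarrow> t x \<in> \<phi> ` carrier F"
    and homotopy: "\<And>z. z \<in> Z \<Longrightarrow> z = b (a z) \<oplus>\<^bsub>M\<^esub> \<rho> (t z)"
    and Z': "Z' = {x \<in> \<phi> ` carrier F. \<rho> x = \<zero>\<^bsub>M\<^esub>}"
    and S': "S' = {x \<in> carrier P. \<delta> x = \<zero>\<^bsub>M'\<^esub>}"
  shows "\<exists>a' b' s. a' \<in> module_hom A F P \<and> b' \<in> module_hom A P F \<and> s \<in> module_hom A F F \<and>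
    (\<forall>z\<in>Z'. a' z \<in> S') \<and> (\<forall>x\<in>S'. b' x \<in> Z') \<and> (\<forall>x\<in>carrier F. s x \<in> Z') \<and>
    (\<forall>z\<in>Z'. z = b' (a' z) \<oplus>\<^bsub>F\<^esub> s z)"
proof -
  interpret M: left_module A M by fact
  interpret M': left_module A M' by fact
  have F: "left_module A F" and P: "left_module A P"
    unfolding F_def P_def by (rule left_module_free)+
  interpret F: left_module A F by (rule F)
  interpret P: left_module A P by (rule P)
  have \<phi>F: "submodule (\<phi> ` carrier F) A F"
    by (rule submodule_image[OF \<phi>(1) F F F.submodule_carrier])
  have \<phi>F': "\<phi> ` carrier F \<subseteq> carrier F"
    using module_hom_closed[OF \<phi>(1)] by blast
  have \<rho>Z: "\<rho> x \<in> Z" if "x \<in> carrier F" for x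
    using that \<rho>(3) by blast
  have \<rho>\<phi>: "\<rho> ` \<phi> ` carrier F = Z"
    unfolding \<rho>(3)[symmetric] image_image using \<rho>(2) by (rule image_cong[OF refl])
  have "(\<lambda>x. a (\<rho> x)) ` carrier F \<subseteq> \<delta> ` carrier P"
    unfolding \<delta>(2) using a(2) \<rho>Z by blast
  then obtain a' where a': "a' \<in> module_hom A F P" "\<And>x. x \<in> carrier F \<Longrightarrow> \<delta> (a' x) = a (\<rho> x)"
    using free_module_lift[OF P M' P.submodule_carrier \<delta>(1)
        module_hom_comp[OF \<rho>(1) a(1), unfolded F_def]] unfolding F_def by blast
  have "(\<lambda>x. b (\<delta> x)) ` carrier P \<subseteq> \<rho> ` \<phi> ` carrier F"
    unfolding \<rho>\<phi> using b(2) \<delta>(2) by blast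
  then obtain b' where b': "b' \<in> module_hom A P F" "\<And>x. x \<in> carrier P \<Longrightarrow> b' x \<in> \<phi> ` carrier F"
    "\<And>x. x \<in> carrier P \<Longrightarrow> \<rho> (b' x) = b (\<delta> x)"
    using free_module_lift[OF F M \<phi>F \<rho>(1) module_hom_comp[OF \<delta>(1) b(1), unfolded P_def]]
    unfolding P_def by blast
  note a'F = module_hom_closed[OF a'(1)] and b'P = module_hom_closed[OF b'(1)]
    and \<phi>C = module_hom_closed[OF \<phi>(1)] and \<rho>C = module_hom_closed[OF \<rho>(1)]
    and tC = module_hom_closed[OF t(1)]
  let ?u = "\<lambda>x. b' (a' (\<phi> x))" and ?v = "\<lambda>x. t (\<rho> x)"
  let ?s = "\<lambda>x. (\<phi> x \<ominus>\<^bsub>F\<^esub> ?u x) \<ominus>\<^bsub>F\<^esub> ?v x"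
  have u: "?u \<in> module_hom A F F"
    by (rule module_hom_comp[OF module_hom_comp[OF \<phi>(1) a'(1)] b'(1)])
  have v: "?v \<in> module_hom A F F"
    by (rule module_hom_comp[OF \<rho>(1) t(1)])
  note w = module_hom_diff[OF \<phi>(1) u F F]
  have s: "?s \<in> module_hom A F F"
    by (rule module_hom_diff[OF w v F F])
  show ?thesis
  proof (intro exI conjI ballI)
    show "a' \<in> module_hom A F P" "b' \<in> module_hom A P F" "?s \<in> module_hom A F F"
      by (rule a'(1) b'(1) s)+
  next
    fix z assume "z \<in> Z'"
    then have z: "z \<in> \<phi> ` carrier F" "\<rho> z = \<zero>\<^bsub>M\<^esub>"
      unfolding Z' by blast+
    have zF: "z \<in> carrier F"
      using z(1) \<phi>F' by blast
    have \<phi>z: "\<phi> z = z"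
      using z(1) \<phi>(2) by blast
    have "\<delta> (a' z) = \<zero>\<^bsub>M'\<^esub>"
      using a'(2)[OF zF] z(2) module_hom_zero[OF a(1) M M'] by simp
    then show "a' z \<in> S'"
      unfolding S' using a'F[OF zF] by blast
    have "?s z = z \<ominus>\<^bsub>F\<^esub> b' (a' z)"
      using zF z(2) \<phi>z module_hom_zero[OF t(1) M F] b'P[OF a'F[OF zF]]
      by (simp add: F.minus_zero_right)
    then show "z = b' (a' z) \<oplus>\<^bsub>F\<^esub> ?s z"
      using F.minus_add_cancel[OF zF b'P[OF a'F[OF zF]]] b'P[OF a'F[OF zF]] zF
      by (simp add: F.M.a_comm)
  next
    fix x assume "x \<in> S'"
    then have x: "x \<in> carrier P" "\<delta> x = \<zero>\<^bsub>M'\<^esub>"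
      unfolding S' by blast+
    have "\<rho> (b' x) = \<zero>\<^bsub>M\<^esub>"
      using b'(3)[OF x(1)] x(2) module_hom_zero[OF b(1) M' M] by simp
    then show "b' x \<in> Z'"
      unfolding Z' using b'(2)[OF x(1)] by blast
  next
    fix x assume x: "x \<in> carrier F"
    have sx: "?s x \<in> \<phi> ` carrier F"
      by (intro F.submodule_minus[OF \<phi>F] imageI x b'(2) a'F \<phi>C t(2) \<rho>C)
    have "\<rho> (?s x) = \<rho> (\<phi> x \<ominus>\<^bsub>F\<^esub> ?u x) \<ominus>\<^bsub>M\<^esub> \<rho> (?v x)"
      by (rule module_hom_minus[OF \<rho>(1) F M module_hom_closed[OF w x] module_hom_closed[OF v x]])
    also have "\<rho> (\<phi> x \<ominus>\<^bsub>F\<^esub> ?u x) = \<rho> (\<phi> x) \<ominus>\<^bsub>M\<^esub> \<rho> (?u x)"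
      by (rule module_hom_minus[OF \<rho>(1) F M \<phi>C[OF x] module_hom_closed[OF u x]])
    also have "\<rho> (\<phi> x) = \<rho> x"
      by (rule \<rho>(2)[OF x])
    also have "\<rho> (?u x) = b (a (\<rho> x))"
      using b'(3)[OF a'F[OF \<phi>C[OF x]]] a'(2)[OF \<phi>C[OF x]] \<rho>(2)[OF x] by simp
    finally have eq: "\<rho> (?s x) = (\<rho> x \<ominus>\<^bsub>M\<^esub> b (a (\<rho> x))) \<ominus>\<^bsub>M\<^esub> \<rho> (t (\<rho> x))" .
    have c: "\<rho> x \<in> carrier M" "b (a (\<rho> x)) \<in> carrier M" "\<rho> (t (\<rho> x)) \<in> carrier M"
      using \<rho>C[OF x] \<rho>C[OF tC[OF \<rho>C[OF x]]]
        module_hom_closed[OF b(1) module_hom_closed[OF a(1) \<rho>C[OF x]]] by auto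
    have "(\<rho> x \<ominus>\<^bsub>M\<^esub> b (a (\<rho> x))) = \<rho> (t (\<rho> x))"
    proof -
      have "\<rho> x = \<rho> (t (\<rho> x)) \<oplus>\<^bsub>M\<^esub> b (a (\<rho> x))"
        using homotopy[OF \<rho>Z[OF x]] c M.M.a_comm by metis
      then have "\<rho> x \<ominus>\<^bsub>M\<^esub> b (a (\<rho> x)) = (\<rho> (t (\<rho> x)) \<oplus>\<^bsub>M\<^esub> b (a (\<rho> x))) \<ominus>\<^bsub>M\<^esub> b (a (\<rho> x))"
        by (rule arg_cong)
      also have "\<dots> = \<rho> (t (\<rho> x))"
        using c by (simp add: a_minus_def M.M.a_assoc M.M.r_neg)
      finally show ?thesis .
    qed
    then have "\<rho> (?s x) = \<zero>\<^bsub>M\<^esub>"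
      unfolding eq using c(3) by (simp add: M.minus_self)
    then show "?s x \<in> Z'"
      unfolding Z' using sx by blast
  qed
qed

end

section \<open>Minimal resolutions\<close>

(* carriers of free modules stay folded from here on *)
declare direct_power_simps [simp del]

context fin_dim_algebra
begin

lemma minimal_cover_kernel:
  assumes "left_module A Y" "minimal_cover A r \<phi> \<rho> Y"
  shows "submodule {x \<in> \<phi> ` carrier (free_module A r). \<rho> x = \<zero>\<^bsub>Y\<^esub>} A (free_module A r)"
proof -
  have \<phi>: "\<phi> \<in> module_hom A (free_module A r) (free_module A r)"
    and \<rho>: "\<rho> \<in> module_hom A (free_module A r) Y"
    using assms(2) by (auto simp: minimal_cover_def)
  interpret F: left_module A "free_module A r" by (rule left_module_free)
  have "submodule (\<phi> ` carrier (free_module A r) \<inter>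
      {x \<in> carrier (free_module A r). \<rho> x = \<zero>\<^bsub>Y\<^esub>}) A (free_module A r)"
    by (intro F.submodule_Int submodule_image[OF \<phi>] submodule_kernel[OF \<rho>] left_module_free
        F.submodule_carrier assms(1))
  also have "\<phi> ` carrier (free_module A r) \<inter> {x \<in> carrier (free_module A r). \<rho> x = \<zero>\<^bsub>Y\<^esub>} =
      {x \<in> \<phi> ` carrier (free_module A r). \<rho> x = \<zero>\<^bsub>Y\<^esub>}"
    using module_hom_closed[OF \<phi>] by blast
  finally show ?thesis .
qed

lemma minimal_resolution_exists:
  assumes G: "left_module A G" "free_cover A G"
  obtains r \<phi> Z \<rho>0 \<rho> where "minimal_cover A (r 0) (\<phi> 0) \<rho>0 G"
    "Z 0 = {x \<in> \<phi> 0 ` carrier (free_module A (r 0)). \<rho>0 x = \<zero>\<^bsub>G\<^esub>}"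
    "\<forall>n. minimal_cover A (r (Suc n)) (\<phi> (Suc n)) (\<rho> n) ((free_module A (r n))\<lparr>carrier := Z n\<rparr>)"
    "\<forall>n. Z (Suc n) = {x \<in> \<phi> (Suc n) ` carrier (free_module A (r (Suc n))).
      \<rho> n x = \<zero>\<^bsub>free_module A (r n)\<^esub>}"
proof -
  obtain r0 \<phi>0 \<rho>0 where 0: "minimal_cover A r0 \<phi>0 \<rho>0 G"
    by (rule minimal_cover_exists[OF G])
  define Z0 where "Z0 = {x \<in> \<phi>0 ` carrier (free_module A r0). \<rho>0 x = \<zero>\<^bsub>G\<^esub>}"
  let ?good = "\<lambda>n (r, \<phi> :: (nat \<Rightarrow> 'a) \<Rightarrow> nat \<Rightarrow> 'a, Z). submodule Z A (free_module A r) \<and>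
    (n = (0::nat) \<longrightarrow> r = r0 \<and> \<phi> = \<phi>0 \<and> Z = Z0)"
  let ?next = "\<lambda>n :: nat. \<lambda>(r, \<phi> :: (nat \<Rightarrow> 'a) \<Rightarrow> nat \<Rightarrow> 'a, Z) (r', \<phi>', Z').
    \<exists>\<rho>. minimal_cover A r' \<phi>' \<rho> ((free_module A r)\<lparr>carrier := Z\<rparr>) \<and>
      Z' = {x \<in> \<phi>' ` carrier (free_module A r'). \<rho> x = \<zero>\<^bsub>free_module A r\<^esub>}"
  have "\<exists>f. \<forall>n. ?good n (f n) \<and> ?next n (f n) (f (Suc n))"
  proof (rule dependent_nat_choice)
    show "\<exists>x. ?good 0 x"
      using minimal_cover_kernel[OF G(1) 0]
      by (intro exI[of _ "(r0, \<phi>0, Z0)"]) (simp add: Z0_def)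
    fix x n assume x: "?good n x"
    obtain r \<phi> Z where rs: "x = (r, \<phi>, Z)"
      by (cases x)
    then have Z: "submodule Z A (free_module A r)"
      using x by simp
    have Y: "left_module A ((free_module A r)\<lparr>carrier := Z\<rparr>)"
      by (rule left_module.left_module_submodule[OF left_module_free Z])
    obtain r' \<phi>' \<rho>' where c: "minimal_cover A r' \<phi>' \<rho>' ((free_module A r)\<lparr>carrier := Z\<rparr>)"
      using minimal_cover_exists[OF Y free_cover_submodule[OF left_module_free free_cover_free Z]] .
    then show "\<exists>y. ?good (Suc n) y \<and> ?next n x y"
      using minimal_cover_kernel[OF Y c]
      by (intro exI[of _ "(r', \<phi>', {x \<in> \<phi>' ` carrier (free_module A r').
        \<rho>' x = \<zero>\<^bsub>free_module A r\<^esub>})"]) (auto simp: rs)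
  qed
  then obtain f where f': "\<forall>n. ?good n (f n) \<and> ?next n (f n) (f (Suc n))" ..
  note f = f'[THEN spec, THEN conjunct1] f'[THEN spec, THEN conjunct2]
  define r where "r n = fst (f n)" for n
  define \<phi> where "\<phi> n = fst (snd (f n))" for n
  define Z where "Z n = snd (snd (f n))" for n
  have init: "r 0 = r0" "\<phi> 0 = \<phi>0" "Z 0 = Z0"
    using f(1)[of 0] by (simp_all add: r_def \<phi>_def Z_def split_beta)
  have "\<forall>n. \<exists>\<rho>. minimal_cover A (r (Suc n)) (\<phi> (Suc n)) \<rho> ((free_module A (r n))\<lparr>carrier := Z n\<rparr>) \<and>
      Z (Suc n) = {x \<in> \<phi> (Suc n) ` carrier (free_module A (r (Suc n))).
        \<rho> x = \<zero>\<^bsub>free_module A (r n)\<^esub>}"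
  proof
    fix n
    show "\<exists>\<rho>. minimal_cover A (r (Suc n)) (\<phi> (Suc n)) \<rho> ((free_module A (r n))\<lparr>carrier := Z n\<rparr>) \<and>
      Z (Suc n) = {x \<in> \<phi> (Suc n) ` carrier (free_module A (r (Suc n))).
        \<rho> x = \<zero>\<^bsub>free_module A (r n)\<^esub>}"
      using f(2)[of n] by (simp add: r_def \<phi>_def Z_def split_beta)
  qed
  then obtain \<rho> where \<rho>: "\<forall>n. minimal_cover A (r (Suc n)) (\<phi> (Suc n)) (\<rho> n)
      ((free_module A (r n))\<lparr>carrier := Z n\<rparr>) \<and>
      Z (Suc n) = {x \<in> \<phi> (Suc n) ` carrier (free_module A (r (Suc n))).
        \<rho> n x = \<zero>\<^bsub>free_module A (r n)\<^esub>}"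
    by (rule choice[THEN exE])
  show thesis
    by (rule that[of r \<phi> \<rho>0 Z \<rho>]) (use 0 \<rho> in \<open>simp_all add: init Z0_def\<close>)
qed

end

text \<open>
  A minimal projective resolution \<open>(r, \<phi>, \<rho>)\<close> of \<open>G\<close>, with syzygies \<open>Z\<close>, next to the free resolution
  \<open>(P, d)\<close> by which Ext is computed; \<open>Z n\<close> is the syzygy of index \<open>n + 1\<close>.
\<close>

locale minimal_resolution = fin_dim_algebra K A
  for K :: "('k, 'c) ring_scheme" (structure) and A :: "('k, 'a, 'd) module_scheme" (structure) +
  fixes G :: "('a, 'g) module" and r :: "nat \<Rightarrow> nat"
    and \<phi> :: "nat \<Rightarrow> (nat \<Rightarrow> 'a) \<Rightarrow> nat \<Rightarrow> 'a" and Z :: "nat \<Rightarrow> (nat \<Rightarrow> 'a) set"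
    and \<rho>0 :: "(nat \<Rightarrow> 'a) \<Rightarrow> 'g" and \<rho> :: "nat \<Rightarrow> (nat \<Rightarrow> 'a) \<Rightarrow> nat \<Rightarrow> 'a"
    and P :: "nat \<Rightarrow> ('a, nat \<Rightarrow> 'a) module" and d :: "nat \<Rightarrow> (nat \<Rightarrow> 'a) \<Rightarrow> nat \<Rightarrow> 'a"
    and e :: "(nat \<Rightarrow> 'a) \<Rightarrow> 'g"
  assumes G: "left_module A G"
    and cover_0: "minimal_cover A (r 0) (\<phi> 0) \<rho>0 G"
    and Z_0: "Z 0 = {x \<in> \<phi> 0 ` carrier (free_module A (r 0)). \<rho>0 x = \<zero>\<^bsub>G\<^esub>}"
    and cover_Suc: "minimal_cover A (r (Suc n)) (\<phi> (Suc n)) (\<rho> n)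
      ((free_module A (r n))\<lparr>carrier := Z n\<rparr>)"
    and Z_Suc: "Z (Suc n) = {x \<in> \<phi> (Suc n) ` carrier (free_module A (r (Suc n))).
      \<rho> n x = \<zero>\<^bsub>free_module A (r n)\<^esub>}"
    and resolution: "free_resolution A G P d e"
    and ext_G: "ext_vanishing A P d G n"
    and ext_regular: "ext_vanishing A P d (regular_module A) n"
    and radical_cube: "a \<in> jacobson_radical A \<Longrightarrow> b \<in> jacobson_radical A \<Longrightarrow>
      c \<in> jacobson_radical A \<Longrightarrow> a \<otimes>\<^bsub>A\<^esub> (b \<otimes>\<^bsub>A\<^esub> c) = \<zero>\<^bsub>A\<^esub>"
begin

text \<open>
  \<open>Q n\<close> is the projective module in degree \<open>n\<close>, a direct summand of the free module \<open>F n\<close>; \<open>Y n\<close> is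
  the syzygy \<open>Z n\<close> as a module.
\<close>

abbreviation F :: "nat \<Rightarrow> ('a, nat \<Rightarrow> 'a) module" where
  "F n \<equiv> free_module A (r n)"

abbreviation Q :: "nat \<Rightarrow> ('a, nat \<Rightarrow> 'a) module" where
  "Q n \<equiv> (F n)\<lparr>carrier := \<phi> n ` carrier (F n)\<rparr>"

abbreviation Y :: "nat \<Rightarrow> ('a, nat \<Rightarrow> 'a) module" where
  "Y n \<equiv> (F n)\<lparr>carrier := Z n\<rparr>"

lemma F: "left_module A (F n)"
  by (rule left_module_free)

lemma \<phi>: "\<phi> n \<in> module_hom A (F n) (F n)" "x \<in> carrier (F n) \<Longrightarrow> \<phi> n (\<phi> n x) = \<phi> n x"
  using cover_0 cover_Suc[of "n - 1"] by (cases n; auto simp: minimal_cover_def)+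

lemma \<rho>0: "\<rho>0 \<in> module_hom A (F 0) G" "\<rho>0 ` carrier (F 0) = carrier G"
  "x \<in> carrier (F 0) \<Longrightarrow> \<rho>0 (\<phi> 0 x) = \<rho>0 x"
  using cover_0 by (auto simp: minimal_cover_def)

lemma Q_submodule: "submodule (\<phi> n ` carrier (F n)) A (F n)"
  by (rule submodule_image[OF \<phi>(1) F F left_module.submodule_carrier[OF F]])

lemma Z_submodule: "submodule (Z n) A (F n)"
proof (induction n)
  case 0
  show ?case
    using minimal_cover_kernel[OF G cover_0] by (simp only: Z_0)
next
  case (Suc n)
  have "left_module A (Y n)"
    by (rule left_module.left_module_submodule[OF F Suc])
  from minimal_cover_kernel[OF this cover_Suc] show ?case
    by (simp add: Z_Suc)
qed

lemma Z_subset: "Z n \<subseteq> \<phi> n ` carrier (F n)"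
  by (cases n) (auto simp: Z_0 Z_Suc)

lemma Q_subset: "\<phi> n ` carrier (F n) \<subseteq> carrier (F n)"
  using module_hom_closed[OF \<phi>(1)] by blast

lemma Z_subset_free: "Z n \<subseteq> carrier (F n)"
  using Z_subset Q_subset by blast

lemma \<phi>_Q: "x \<in> \<phi> n ` carrier (F n) \<Longrightarrow> \<phi> n x = x"
  using \<phi>(2) by blast

lemma Y: "left_module A (Y n)" "free_cover A (Y n)"
  by (rule left_module.left_module_submodule[OF F Z_submodule],
      rule free_cover_submodule[OF left_module_free free_cover_free Z_submodule])

lemma Q: "left_module A (Q n)" "free_cover A (Q n)"
  by (rule left_module.left_module_submodule[OF F Q_submodule],
      rule free_cover_submodule[OF left_module_free free_cover_free Q_submodule])

lemma \<rho>: "\<rho> n \<in> module_hom A (F (Suc n)) (Y n)" "\<rho> n \<in> module_hom A (F (Suc n)) (F n)"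
  "\<rho> n ` carrier (F (Suc n)) = Z n" "x \<in> carrier (F (Suc n)) \<Longrightarrow> \<rho> n (\<phi> (Suc n) x) = \<rho> n x"
proof -
  show 1: "\<rho> n \<in> module_hom A (F (Suc n)) (Y n)"
    using cover_Suc[of n] by (auto simp: minimal_cover_def)
  show "\<rho> n \<in> module_hom A (F (Suc n)) (F n)"
    by (rule module_hom_extend_target[OF 1 Z_subset_free])
  show "\<rho> n ` carrier (F (Suc n)) = Z n" "x \<in> carrier (F (Suc n)) \<Longrightarrow> \<rho> n (\<phi> (Suc n) x) = \<rho> n x"
    using cover_Suc[of n] by (auto simp: minimal_cover_def)
qed

lemma \<rho>_Q: "\<rho> n \<in> module_hom A (Q (Suc n)) (Y n)" "\<rho> n ` \<phi> (Suc n) ` carrier (F (Suc n)) = Z n"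
proof -
  show "\<rho> n \<in> module_hom A (Q (Suc n)) (Y n)"
    by (rule module_hom_restrict_source[OF \<rho>(1) Q_subset])
  show "\<rho> n ` \<phi> (Suc n) ` carrier (F (Suc n)) = Z n"
    unfolding \<rho>(3)[symmetric] image_image using \<rho>(4) by (rule image_cong[OF refl])
qed

lemma Z_radical: "z \<in> Z n \<Longrightarrow> i < r n \<Longrightarrow> z i \<in> jacobson_radical A"
  using cover_0 cover_Suc[of "n - 1"]
  by (cases n) (auto simp: minimal_cover_def Z_0 Z_Suc)

lemma Y_square:
  assumes "a \<in> jacobson_radical A" "b \<in> jacobson_radical A" "z \<in> carrier (Y n)"
  shows "a \<odot>\<^bsub>Y n\<^esub> (b \<odot>\<^bsub>Y n\<^esub> z) = \<zero>\<^bsub>Y n\<^esub>"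
  using radical_cube[OF assms(1,2) Z_radical[of z n]] assms(3)
  by (auto simp: direct_power_simps intro!: restrict_ext)

lemma ext_Q: "ext_vanishing A P d (Q n) k"
proof (rule ext_vanishing_retract[OF _ _ _ _ F Q(1)])
  show "ext_vanishing A P d (F n) k"
    by (rule ext_vanishing_direct_power[OF ext_regular left_module_regular_algebra])
  show "(\<lambda>x. x) \<in> module_hom A (Q n) (F n)"
    by (rule module_hom_extend_target[OF module_hom_id Q_subset])
  show "\<phi> n \<in> module_hom A (F n) (Q n)"
    by (rule module_hom_restrict_target[OF \<phi>(1) order_refl])
  show "\<phi> n x = x" if "x \<in> carrier (Q n)" for x
    by (rule \<phi>_Q) (use that in simp)
qed

lemma ext_Y: "n < k \<Longrightarrow> ext_vanishing A P d (Y n) k"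
proof (induction n arbitrary: k)
  case 0
  then obtain l where k: "k = Suc l" by (cases k) auto
  have "\<rho>0 \<in> module_hom A (Q 0) G"
    by (rule module_hom_restrict_source[OF \<rho>0(1) Q_subset])
  moreover have "\<rho>0 ` carrier (Q 0) = carrier G"
  proof -
    have "\<rho>0 ` \<phi> 0 ` carrier (F 0) = \<rho>0 ` carrier (F 0)"
      unfolding image_image using \<rho>0(3) by (rule image_cong[OF refl])
    then show ?thesis using \<rho>0(2) by simp
  qed
  ultimately have "ext_vanishing A P d ((Q 0)\<lparr>carrier := {x \<in> carrier (Q 0). \<rho>0 x = \<zero>\<^bsub>G\<^esub>}\<rparr>) (Suc l)"
    by (rule ext_vanishing_kernel[OF resolution Q(1) G _ _ ext_Q ext_G])
  then show ?case
    by (simp add: k Z_0)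
next
  case (Suc n)
  then obtain l where k: "k = Suc l" "n < l" by (cases k) auto
  have "ext_vanishing A P d
      ((Q (Suc n))\<lparr>carrier := {x \<in> carrier (Q (Suc n)). \<rho> n x = \<zero>\<^bsub>Y n\<^esub>}\<rparr>) (Suc l)"
    using \<rho>_Q by (intro ext_vanishing_kernel[OF resolution Q(1) Y(1) _ _ ext_Q Suc.IH[OF k(2)]])
      simp_all
  then show ?case
    by (simp add: k Z_Suc)
qed

text \<open>
  Comparison of the two resolutions at the syzygies \<open>Z n\<close> and \<open>d n ` P (n + 1)\<close>.  On \<open>Z n\<close> the map
  \<open>b \<circ> a\<close> differs from the identity by a map \<open>s\<close> that factors through the free module \<open>F n\<close>.
\<close>

lemma comparison:
  "\<exists>a b s. a \<in> module_hom A (F n) (P n) \<and> b \<in> module_hom A (P n) (F n) \<and>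
    s \<in> module_hom A (F n) (F n) \<and> (\<forall>z\<in>Z n. a z \<in> d n ` carrier (P (Suc n))) \<and>
    (\<forall>x\<in>d n ` carrier (P (Suc n)). b x \<in> Z n) \<and> (\<forall>x\<in>carrier (F n). s x \<in> Z n) \<and>
    (\<forall>z\<in>Z n. z = b (a z) \<oplus>\<^bsub>F n\<^esub> s z)"
proof (induction n)
  note P' = free_resolutionD[OF A.ring_axioms resolution]
  case 0
  interpret G: left_module A G by (rule G)
  obtain p where p: "P 0 = free_module A p"
    using P'(1) by blast
  have t: "\<zero>\<^bsub>F 0\<^esub> \<in> \<phi> 0 ` carrier (F 0)" if "x \<in> carrier G" for x
    using Q_submodule[of 0] by (simp add: left_module.submodule_iff[OF F])
  have homotopy: "z = z \<oplus>\<^bsub>G\<^esub> \<rho>0 \<zero>\<^bsub>F 0\<^esub>" if "z \<in> carrier G" for z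
    using that module_hom_zero[OF \<rho>0(1) F G] by simp
  show ?case
    unfolding p
    by (rule comparison_step[where M = G and M' = G and r = "r 0" and p = p and \<phi> = "\<phi> 0" and \<rho> = \<rho>0
          and Z = "carrier G" and \<delta> = e and S = "carrier G" and a = "\<lambda>x. x" and b = "\<lambda>x. x"
          and t = "\<lambda>_. \<zero>\<^bsub>F 0\<^esub>"])
      (rule G, rule G, rule \<phi>(1), erule \<phi>(2), rule \<rho>0(1), erule \<rho>0(3), rule \<rho>0(2),
        rule P'(4)[unfolded p], rule P'(5)[unfolded p], rule module_hom_id, assumption,
        rule module_hom_id, assumption, rule module_hom_zero_map[OF F], erule t, erule homotopy,
        rule Z_0, rule P'(6)[unfolded p])
next
  note P' = free_resolutionD[OF A.ring_axioms resolution]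
  case (Suc n)
  obtain a b s where ab': "a \<in> module_hom A (F n) (P n) \<and> b \<in> module_hom A (P n) (F n) \<and>
    s \<in> module_hom A (F n) (F n) \<and> (\<forall>z\<in>Z n. a z \<in> d n ` carrier (P (Suc n))) \<and>
    (\<forall>x\<in>d n ` carrier (P (Suc n)). b x \<in> Z n) \<and> (\<forall>x\<in>carrier (F n). s x \<in> Z n) \<and>
    (\<forall>z\<in>Z n. z = b (a z) \<oplus>\<^bsub>F n\<^esub> s z)"
    using Suc.IH by (elim exE)
  have ab: "a \<in> module_hom A (F n) (P n)" "b \<in> module_hom A (P n) (F n)"
    "s \<in> module_hom A (F n) (F n)" "\<And>z. z \<in> Z n \<Longrightarrow> a z \<in> d n ` carrier (P (Suc n))"
    "\<And>x. x \<in> d n ` carrier (P (Suc n)) \<Longrightarrow> b x \<in> Z n" "\<And>x. x \<in> carrier (F n) \<Longrightarrow> s x \<in> Z n"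
    "\<And>z. z \<in> Z n \<Longrightarrow> z = b (a z) \<oplus>\<^bsub>F n\<^esub> s z"
    using ab' by blast+
  obtain p where p: "P (Suc n) = free_module A p"
    using P'(1) by blast
  have "s ` carrier (F n) \<subseteq> \<rho> n ` \<phi> (Suc n) ` carrier (F (Suc n))"
    unfolding \<rho>_Q using ab(6) by blast
  then obtain t where t: "t \<in> module_hom A (F n) (F (Suc n))"
    "\<And>x. x \<in> carrier (F n) \<Longrightarrow> t x \<in> \<phi> (Suc n) ` carrier (F (Suc n))"
    "\<And>x. x \<in> carrier (F n) \<Longrightarrow> \<rho> n (t x) = s x"
    using free_module_lift[OF F F Q_submodule \<rho>(2) ab(3)] by blast
  have homotopy: "z = b (a z) \<oplus>\<^bsub>F n\<^esub> \<rho> n (t z)" if "z \<in> Z n" for z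
    using ab(7)[OF that] t(3) Z_subset_free that by (simp add: subset_iff)
  show ?case
    unfolding p
    by (rule comparison_step[where M = "F n" and M' = "P n" and r = "r (Suc n)" and p = p
          and \<phi> = "\<phi> (Suc n)" and \<rho> = "\<rho> n" and Z = "Z n" and \<delta> = "d n"
          and S = "d n ` carrier (free_module A p)" and a = a and b = b and t = t])
      (rule F, rule P'(2), rule \<phi>(1), erule \<phi>(2), rule \<rho>(2), erule \<rho>(4), rule \<rho>(3),
        rule P'(3)[of n, unfolded p], rule refl, rule ab(1), erule ab(4)[unfolded p], rule ab(2),
        erule ab(5)[unfolded p], rule t(1), erule t(2), erule homotopy, rule Z_Suc,
        rule P'(7)[of n, unfolded p])
qed

text \<open>
  Vanishing of Ext, read off in the minimal resolution: homomorphisms on \<open>Z n\<close> extend to the free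
  module around it.  With \<open>a\<close>, \<open>b\<close> and \<open>s\<close> from the comparison of the resolutions, and \<open>h\<close> an
  extension of \<open>g \<circ> b\<close>, the homomorphism \<open>h \<circ> a + g \<circ> s\<close> extends \<open>g\<close>.
\<close>

lemma extend_from_syzygy:
  assumes N: "left_module A N" and ext: "ext_vanishing A P d N n" and g: "g \<in> module_hom A (Y n) N"
  obtains h where "h \<in> module_hom A (F n) N" "\<And>z. z \<in> Z n \<Longrightarrow> h z = g z"
proof -
  note P' = free_resolutionD[OF A.ring_axioms resolution]
  interpret N: left_module A N by (rule N)
  obtain a b s where ab': "a \<in> module_hom A (F n) (P n) \<and> b \<in> module_hom A (P n) (F n) \<and>
    s \<in> module_hom A (F n) (F n) \<and> (\<forall>z\<in>Z n. a z \<in> d n ` carrier (P (Suc n))) \<and>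
    (\<forall>x\<in>d n ` carrier (P (Suc n)). b x \<in> Z n) \<and> (\<forall>x\<in>carrier (F n). s x \<in> Z n) \<and>
    (\<forall>z\<in>Z n. z = b (a z) \<oplus>\<^bsub>F n\<^esub> s z)"
    using comparison[of n] by (elim exE)
  have ab: "a \<in> module_hom A (F n) (P n)" "b \<in> module_hom A (P n) (F n)"
    "s \<in> module_hom A (F n) (F n)" "\<And>z. z \<in> Z n \<Longrightarrow> a z \<in> d n ` carrier (P (Suc n))"
    "\<And>x. x \<in> d n ` carrier (P (Suc n)) \<Longrightarrow> b x \<in> Z n" "\<And>x. x \<in> carrier (F n) \<Longrightarrow> s x \<in> Z n"
    "\<And>z. z \<in> Z n \<Longrightarrow> z = b (a z) \<oplus>\<^bsub>F n\<^esub> s z"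
    using ab' by blast+
  have bd: "(\<lambda>x. b (d n x)) \<in> module_hom A (P (Suc n)) (Y n)"
    using ab(5) by (intro module_hom_restrict_target[OF module_hom_comp[OF P'(3) ab(2)]]) blast
  have dd: "g (b (d n (d (Suc n) x))) = \<zero>\<^bsub>N\<^esub>" if x: "x \<in> carrier (P (Suc (Suc n)))" for x
  proof -
    have "d (Suc n) x \<in> {x \<in> carrier (P (Suc n)). d n x = \<zero>\<^bsub>P n\<^esub>}"
      unfolding P'(7)[symmetric] using x by blast
    then have "b (d n (d (Suc n) x)) = \<zero>\<^bsub>Y n\<^esub>"
      using module_hom_zero[OF ab(2) P'(2) F] by simp
    then show ?thesis
      using module_hom_zero[OF g Y(1) N] by simp
  qed
  obtain h where h: "h \<in> module_hom A (P n) N"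
    "\<And>x. x \<in> carrier (P (Suc n)) \<Longrightarrow> g (b (d n x)) = h (d n x)"
    using ext_vanishingD[OF ext module_hom_comp[OF bd g], OF dd] by blast
  have s: "s \<in> module_hom A (F n) (Y n)"
    using ab(6) by (intro module_hom_restrict_target[OF ab(3)]) blast
  show thesis
  proof (rule that)
    show "(\<lambda>x. h (a x) \<oplus>\<^bsub>N\<^esub> g (s x)) \<in> module_hom A (F n) N"
      by (rule module_hom_sum[OF module_hom_comp[OF ab(1) h(1)] module_hom_comp[OF s g] N])
    fix z assume z: "z \<in> Z n"
    obtain x where x: "x \<in> carrier (P (Suc n))" "a z = d n x"
      using ab(4)[OF z] by blast
    have "h (a z) = g (b (a z))"
      using h(2)[OF x(1)] x(2) by simp
    moreover have "g (b (a z) \<oplus>\<^bsub>Y n\<^esub> s z) = g (b (a z)) \<oplus>\<^bsub>N\<^esub> g (s z)"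
      using ab(5)[OF ab(4)[OF z]] ab(6) Z_subset_free z
      by (intro module_hom_add[OF g]) auto
    ultimately show "h (a z) \<oplus>\<^bsub>N\<^esub> g (s z) = g z"
      using ab(7)[OF z] by simp
  qed
qed

section \<open>Homomorphisms between syzygies\<close>

lemma radical_of_free_hom:
  assumes T: "left_module A T" and h: "h \<in> module_hom A (F n) T" and z: "z \<in> Z n"
  shows "h z \<in> radical_submodule A T"
  using Z_subset_free z Z_radical[OF z] by (intro module_hom_radical_coefficients[OF T h]) blast+

text \<open>
  If \<open>Z (n + 1) = 0\<close>, then the syzygy \<open>Z n\<close> is projective.  As Ext vanishes on projective modules,
  the identity of \<open>Z n\<close> extends to the free module around it, which puts \<open>Z n\<close> into its own radical.
\<close>

lemma syzygy_zero_pred: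
  assumes "Z (Suc n) = {\<zero>\<^bsub>F (Suc n)\<^esub>}"
  shows "Z n = {\<zero>\<^bsub>F n\<^esub>}"
proof -
  have inj: "inj_on (\<rho> n) (carrier (Q (Suc n)))"
  proof (rule module_hom_inj_onI[OF Q(1) Y(1) \<rho>_Q(1)])
    fix x assume "x \<in> carrier (Q (Suc n))" "\<rho> n x = \<zero>\<^bsub>Y n\<^esub>"
    then have "x \<in> Z (Suc n)"
      by (simp add: Z_Suc)
    then show "x = \<zero>\<^bsub>Q (Suc n)\<^esub>"
      using assms by simp
  qed
  have "(\<lambda>x. x) ` carrier (Y n) \<subseteq> \<rho> n ` carrier (Q (Suc n))"
    using \<rho>_Q(2) by simp
  then obtain i where i: "i \<in> module_hom A (Y n) (Q (Suc n))"
    "\<And>x. x \<in> carrier (Y n) \<Longrightarrow> \<rho> n (i x) = x"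
    using module_hom_factor_inj[OF Y(1) Q(1) Y(1) module_hom_id \<rho>_Q(1) inj] by blast
  have "ext_vanishing A P d (Y n) n"
    by (rule ext_vanishing_retract[OF ext_Q i(1) \<rho>_Q(1) i(2) Q(1) Y(1)])
  then obtain h where h: "h \<in> module_hom A (F n) (Y n)" "\<And>z. z \<in> Z n \<Longrightarrow> h z = z"
    using extend_from_syzygy[OF Y(1) _ module_hom_id] by blast
  have "carrier (Y n) \<subseteq> radical_submodule A (Y n)"
  proof
    fix z assume "z \<in> carrier (Y n)"
    then have "z \<in> Z n" by simp
    then show "z \<in> radical_submodule A (Y n)"
      using radical_of_free_hom[OF Y(1) h(1)] h(2) by fastforce
  qed
  from nakayama[OF Y(1) Y_square this] show ?thesis
    by simp
qed

text \<open>
  The homomorphisms \<open>f\<close> from \<open>Q (n + 1)\<close> to \<open>T\<close> that map \<open>Z (n + 1)\<close> into \<open>U = J T\<close> induce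
  homomorphisms from \<open>Z n\<close> to \<open>T/U\<close> as well as from \<open>Z (n + 1)\<close> to \<open>U\<close>, and all of these arise.
  The two kernels consist of the \<open>f\<close> with image in \<open>U\<close> and of the \<open>f\<close> that vanish on \<open>Z (n + 1)\<close>.
\<close>

lemma hom_len_comparison:
  fixes T :: "('a, 't) module"
  assumes T: "left_module A T" "free_cover A T"
    and sq: "\<And>a b x. a \<in> jacobson_radical A \<Longrightarrow> b \<in> jacobson_radical A \<Longrightarrow> x \<in> carrier T \<Longrightarrow>
      a \<odot>\<^bsub>T\<^esub> (b \<odot>\<^bsub>T\<^esub> x) = \<zero>\<^bsub>T\<^esub>"
    and ext: "ext_vanishing A P d T (Suc n)"
  defines "U \<equiv> radical_submodule A T" and "H \<equiv> hom_space K A (Q (Suc n)) T"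
  defines "V \<equiv> {f \<in> carrier H. \<forall>z\<in>Z (Suc n). f z = \<zero>\<^bsub>T\<^esub>}"
  shows "hom_len K A (Y n) (quotient_module T U) + len K H (homs_into A (Q (Suc n)) T U) =
      hom_len K A (Y (Suc n)) (T\<lparr>carrier := U\<rparr>) + len K H V"
    and "homs_into A (Q (Suc n)) T U \<subseteq> V" "submodule V K H" "finite_len K H V"
    "submodule (homs_into A (Q (Suc n)) T U) K H"
proof -
  let ?E = "homs_into A (Q (Suc n)) T U"
  interpret T: left_module A T by fact
  have U: "submodule U A T"
    unfolding U_def by (rule submodule_radical_submodule[OF T(1)])
  have UT: "U \<subseteq> carrier T"
    using U by (simp add: T.submodule_iff)
  let ?TU = "quotient_module T U"
  let ?q = "coset_rep T U"
  have TU: "left_module A ?TU"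
    by (rule T.left_module_quotient[OF U])
  note q = coset_rep_hom[OF T(1) U]
  have fcTU: "free_cover A ?TU"
    by (intro free_cover_image[OF T(2) q]) simp
  let ?HY = "hom_space K A (Y (Suc n)) T" and ?HQ = "hom_space K A (Q (Suc n)) ?TU"
    and ?HZ = "hom_space K A (Y n) ?TU"
  have H: "left_module K H"
    unfolding H_def by (rule left_module_hom_space[OF Q(1) T(1)])
  have HY: "left_module K ?HY"
    by (rule left_module_hom_space[OF Y(1) T(1)])
  have HQ: "left_module K ?HQ"
    by (rule left_module_hom_space[OF Q(1) TU])
  have HZ: "left_module K ?HZ"
    by (rule left_module_hom_space[OF Y(1) TU])
  interpret H: left_module K H by (rule H)
  have finH: "finite_len K H (carrier H)"
    unfolding H_def by (rule finite_len_hom_space[OF Q T])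
  have homH: "f \<in> module_hom A (Q (Suc n)) T" if "f \<in> carrier H" for f
    using that by (simp add: H_def)
  have ZQ: "x \<in> carrier (Q (Suc n))" if "x \<in> Z (Suc n)" for x
    using that Z_subset by auto
  let ?b = "\<lambda>f. \<lambda>x\<in>carrier (Y (Suc n)). f x"
  let ?p = "\<lambda>f. \<lambda>x\<in>carrier (Q (Suc n)). ?q (f x)"
  let ?c = "\<lambda>g. \<lambda>x\<in>carrier (Q (Suc n)). g (\<rho> n x)"
  have incl: "(\<lambda>x. x) \<in> module_hom A (Y (Suc n)) (Q (Suc n))"
    using Z_subset by (auto simp: module_hom_def)
  have b: "?b \<in> module_hom K H ?HY"
    unfolding H_def using precompose_hom[OF Y(1) incl] by simp
  have p: "?p \<in> module_hom K H ?HQ"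
    unfolding H_def by (rule postcompose_hom[OF Q(1) q])
  have c: "?c \<in> module_hom K ?HZ ?HQ"
    by (rule precompose_hom[OF Q(1) \<rho>_Q(1)])
  define W where "W = {f \<in> carrier H. ?b f \<in> homs_into A (Y (Suc n)) T U}"
  have W: "submodule W K H"
    unfolding W_def by (rule submodule_vimage[OF b H HY submodule_homs_into[OF Y(1) T(1) U]])
  have W_iff: "f \<in> W \<longleftrightarrow> f \<in> carrier H \<and> (\<forall>z\<in>Z (Suc n). f z \<in> U)" for f
  proof -
    have "?b f \<in> carrier ?HY" if "f \<in> carrier H"
      by (rule module_hom_closed[OF b that])
    then show ?thesis
      unfolding W_def homs_into_def by auto
  qed
  have finW: "finite_len K H W"
    by (rule finite_len_mono[OF finH _ H.submodule_carrier]) (auto simp: W_iff)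
  have E: "submodule ?E K H"
    unfolding H_def by (rule submodule_homs_into[OF Q(1) T(1) U])
  then show "submodule ?E K H" .
  have E_iff: "f \<in> ?E \<longleftrightarrow> f \<in> carrier H \<and> (\<forall>x\<in>carrier (Q (Suc n)). f x \<in> U)" for f
    unfolding homs_into_def H_def by auto
  have EW: "?E \<subseteq> W"
    unfolding subset_iff E_iff W_iff using ZQ by blast
  have "V = carrier H \<inter> {f \<in> carrier H. ?b f = \<zero>\<^bsub>?HY\<^esub>}"
    unfolding V_def by (auto simp: fun_eq_iff restrict_def)
  then show V: "submodule V K H"
    using H.submodule_Int[OF H.submodule_carrier submodule_kernel[OF b H HY]] by simp
  show "finite_len K H V"
    by (rule finite_len_mono[OF finH _ H.submodule_carrier]) (auto simp: V_def)
  show "?E \<subseteq> V"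
  proof
    fix f assume f: "f \<in> ?E"
    let ?U = "T\<lparr>carrier := U\<rparr>"
    have U': "left_module A ?U"
      by (rule T.left_module_submodule[OF U])
    have "f \<in> module_hom A (Q (Suc n)) ?U"
      using f by (intro module_hom_restrict_target) (auto simp: homs_into_def)
    moreover have "\<phi> (Suc n) \<in> module_hom A (F (Suc n)) (Q (Suc n))"
      by (rule module_hom_restrict_target[OF \<phi>(1) order_refl])
    ultimately have fp: "(\<lambda>x. f (\<phi> (Suc n) x)) \<in> module_hom A (F (Suc n)) ?U"
      by (rule module_hom_comp[rotated])
    have rad: "radical_submodule A ?U = {\<zero>\<^bsub>T\<^esub>}"
      using radical_submodule_trivial[OF U'] radical_kills_radical_submodule[OF T(1) sq]
      by (simp add: U_def)
    have "f z = \<zero>\<^bsub>T\<^esub>" if z: "z \<in> Z (Suc n)" for z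
    proof -
      have "\<phi> (Suc n) z = z"
        by (rule \<phi>_Q) (use z Z_subset in blast)
      then show ?thesis
        using radical_of_free_hom[OF U' fp z] rad by simp
    qed
    then show "f \<in> V"
      using f by (auto simp: V_def E_iff)
  qed
  then have VW: "V \<subseteq> W"
    using U by (auto simp: V_def W_iff T.submodule_iff)
  have "len K H W = len K H (W \<inter> {f \<in> carrier H. ?p f = \<zero>\<^bsub>?HQ\<^esub>}) + len K ?HQ (?p ` W)"
    by (rule len_kernel_image[OF H HQ p finW W])
  also have "W \<inter> {f \<in> carrier H. ?p f = \<zero>\<^bsub>?HQ\<^esub>} = ?E"
  proof -
    have "?p f = \<zero>\<^bsub>?HQ\<^esub> \<longleftrightarrow> (\<forall>x\<in>carrier (Q (Suc n)). f x \<in> U)" if f: "f \<in> carrier H" for f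
    proof -
      have "?p f = \<zero>\<^bsub>?HQ\<^esub> \<longleftrightarrow> (\<forall>x\<in>carrier (Q (Suc n)). ?q (f x) = ?q \<zero>\<^bsub>T\<^esub>)"
        by (auto simp: fun_eq_iff restrict_def)
      then show ?thesis
        using module_hom_closed[OF homH[OF f]] T.coset_rep_eq_zero[OF U] by blast
    qed
    then show ?thesis
      using EW by (auto simp: E_iff)
  qed
  also have "?p ` W = ?c ` carrier ?HZ"
  proof
    show "?p ` W \<subseteq> ?c ` carrier ?HZ"
    proof
      fix g assume "g \<in> ?p ` W"
      then obtain f where f: "f \<in> carrier H" "\<And>z. z \<in> Z (Suc n) \<Longrightarrow> f z \<in> U" "g = ?p f"
        by (auto simp: W_iff)
      have "?q (f x) = \<zero>\<^bsub>?TU\<^esub>" if "x \<in> carrier (Q (Suc n))" "\<rho> n x = \<zero>\<^bsub>Y n\<^esub>" for x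
      proof -
        have "x \<in> Z (Suc n)"
          using that by (simp add: Z_Suc)
        then show ?thesis
          using f(2) T.coset_rep_eq_zero[OF U, of "f x"] UT by auto
      qed
      moreover have "\<rho> n ` carrier (Q (Suc n)) = carrier (Y n)"
        using \<rho>_Q(2) by simp
      ultimately obtain h where h: "h \<in> module_hom A (Y n) ?TU"
        "\<And>x. x \<in> carrier (Q (Suc n)) \<Longrightarrow> h (\<rho> n x) = ?q (f x)"
        using module_hom_factor_surj[OF Q(1) Y(1) TU module_hom_comp[OF homH[OF f(1)] q] \<rho>_Q(1)]
        by blast
      have "g = ?c (restrict h (carrier (Y n)))"
        unfolding f(3) using h(2) module_hom_closed[OF \<rho>_Q(1)] by (intro restrict_ext) simp
      moreover have "restrict h (carrier (Y n)) \<in> carrier ?HZ"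
        using module_hom_restrict[OF Y(1) h(1)] by simp
      ultimately show "g \<in> ?c ` carrier ?HZ" by blast
    qed
    show "?c ` carrier ?HZ \<subseteq> ?p ` W"
    proof
      fix g assume "g \<in> ?c ` carrier ?HZ"
      then obtain h where h: "h \<in> module_hom A (Y n) ?TU" "g = ?c h"
        by auto
      have h\<rho>: "(\<lambda>x. h (\<rho> n x)) \<in> module_hom A (F (Suc n)) ?TU"
        by (rule module_hom_comp[OF \<rho>(1) h(1)])
      have "(\<lambda>x. h (\<rho> n x)) ` carrier (F (Suc n)) \<subseteq> ?q ` carrier T"
        using module_hom_closed[OF h\<rho>] by auto
      then obtain f where f: "f \<in> module_hom A (F (Suc n)) T"
        "\<And>x. x \<in> carrier (F (Suc n)) \<Longrightarrow> ?q (f x) = h (\<rho> n x)"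
        using free_module_lift[OF T(1) TU T.submodule_carrier q h\<rho>] by blast
      let ?f = "restrict f (carrier (Q (Suc n)))"
      have QF: "x \<in> carrier (F (Suc n))" if "x \<in> carrier (Q (Suc n))" for x
        using that Q_subset by auto
      have "?f \<in> carrier H"
        using module_hom_restrict[OF Q(1) module_hom_restrict_source[OF f(1) Q_subset]]
        by (simp add: H_def)
      moreover have "?f z \<in> U" if z: "z \<in> Z (Suc n)" for z
      proof -
        have zF: "z \<in> carrier (F (Suc n))"
          by (rule QF[OF ZQ[OF z]])
        have "\<rho> n z = \<zero>\<^bsub>Y n\<^esub>"
          using z by (simp add: Z_Suc)
        then have "?q (f z) = ?q \<zero>\<^bsub>T\<^esub>"
          using f(2)[OF zF] module_hom_zero[OF h(1) Y(1) TU] by simp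
        then show ?thesis
          using T.coset_rep_eq_zero[OF U module_hom_closed[OF f(1) zF]] ZQ[OF z] by simp
      qed
      ultimately have "?f \<in> W"
        by (simp add: W_iff)
      moreover have "g = ?p ?f"
        unfolding h(2) using f(2) QF by (intro restrict_ext) simp
      ultimately show "g \<in> ?p ` W" by blast
    qed
  qed
  also have "len K ?HQ (?c ` carrier ?HZ) = hom_len K A (Y n) ?TU"
    unfolding hom_len_def
  proof (rule finite_len_inj(2)[symmetric, OF HZ HQ c _ left_module.submodule_carrier[OF HZ]])
    show "finite_len K ?HQ (?c ` carrier ?HZ)"
      by (rule finite_len_image[OF HZ HQ c finite_len_hom_space[OF Y TU fcTU]
            left_module.submodule_carrier[OF HZ]])
    fix g assume g: "g \<in> carrier ?HZ" "?c g = \<zero>\<^bsub>?HQ\<^esub>"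
    have "g y = \<zero>\<^bsub>?TU\<^esub>" if "y \<in> carrier (Y n)" for y
    proof -
      have "y \<in> \<rho> n ` \<phi> (Suc n) ` carrier (F (Suc n))"
        using that unfolding \<rho>_Q(2) by simp
      then obtain x where "x \<in> \<phi> (Suc n) ` carrier (F (Suc n))" "y = \<rho> n x"
        by blast
      then show ?thesis
        using fun_cong[OF g(2), of x] by simp
    qed
    then show "g = \<zero>\<^bsub>?HZ\<^esub>"
      using g(1) by (intro extensionalityI[of _ "carrier (Y n)"]) simp_all
  qed
  finally have 1: "len K H W = len K H ?E + hom_len K A (Y n) ?TU" .
  have "len K H W = len K H (W \<inter> {f \<in> carrier H. ?b f = \<zero>\<^bsub>?HY\<^esub>}) + len K ?HY (?b ` W)"
    by (rule len_kernel_image[OF H HY b finW W])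
  also have "W \<inter> {f \<in> carrier H. ?b f = \<zero>\<^bsub>?HY\<^esub>} = V"
    using VW \<open>V = carrier H \<inter> {f \<in> carrier H. ?b f = \<zero>\<^bsub>?HY\<^esub>}\<close> by blast
  also have "?b ` W = homs_into A (Y (Suc n)) T U"
  proof
    show "?b ` W \<subseteq> homs_into A (Y (Suc n)) T U"
      by (auto simp: W_def)
    show "homs_into A (Y (Suc n)) T U \<subseteq> ?b ` W"
    proof
      fix g assume g: "g \<in> homs_into A (Y (Suc n)) T U"
      then have gT: "g \<in> module_hom A (Y (Suc n)) T"
        by (simp add: homs_into_def)
      obtain h where h: "h \<in> module_hom A (F (Suc n)) T" "\<And>z. z \<in> Z (Suc n) \<Longrightarrow> h z = g z"
        using extend_from_syzygy[OF T(1) ext gT] by blast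
      let ?f = "restrict h (carrier (Q (Suc n)))"
      have "?f \<in> carrier H"
        using module_hom_restrict[OF Q(1) module_hom_restrict_source[OF h(1) Q_subset]]
        by (simp add: H_def)
      moreover have "g = ?b ?f"
        using g h(2) ZQ by (intro extensionalityI[of _ "carrier (Y (Suc n))"])
          (auto simp: homs_into_def)
      ultimately show "g \<in> ?b ` W"
        using g unfolding W_def by blast
    qed
  qed
  also have "len K ?HY (homs_into A (Y (Suc n)) T U) = hom_len K A (Y (Suc n)) (T\<lparr>carrier := U\<rparr>)"
    by (rule len_homs_into[OF Y T U])
  finally show "hom_len K A (Y n) ?TU + len K H ?E =
      hom_len K A (Y (Suc n)) (T\<lparr>carrier := U\<rparr>) + len K H V"
    using 1 by simp
qed

lemma hom_len_syzygies_eq: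
  assumes "m < n"
  shows "hom_len K A (Y n) (quotient_module (Y m) (radical_submodule A (Y m))) =
    hom_len K A (Y (Suc n)) ((Y m)\<lparr>carrier := radical_submodule A (Y m)\<rparr>)"
proof -
  let ?U = "radical_submodule A (Y m)" and ?H = "hom_space K A (Q (Suc n)) (Y m)"
  let ?V = "{f \<in> carrier ?H. \<forall>z\<in>Z (Suc n). f z = \<zero>\<^bsub>Y m\<^esub>}"
  have ext: "ext_vanishing A P d (Y m) (Suc n)"
    using assms by (intro ext_Y) simp
  note cmp = hom_len_comparison[OF Y Y_square ext]
  \<comment> \<open>a homomorphism that vanishes on \<open>Z (n + 1)\<close> comes from \<open>Z n\<close> and extends to \<open>F n\<close>\<close>
  have "?V \<subseteq> homs_into A (Q (Suc n)) (Y m) ?U"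
  proof
    fix f assume f: "f \<in> ?V"
    then have fQ: "f \<in> module_hom A (Q (Suc n)) (Y m)" by simp
    have "f x = \<zero>\<^bsub>Y m\<^esub>" if "x \<in> carrier (Q (Suc n))" "\<rho> n x = \<zero>\<^bsub>Y n\<^esub>" for x
      using that f by (simp add: Z_Suc)
    moreover have "\<rho> n ` carrier (Q (Suc n)) = carrier (Y n)"
      using \<rho>_Q(2) by simp
    ultimately obtain g where g: "g \<in> module_hom A (Y n) (Y m)"
      "\<And>x. x \<in> carrier (Q (Suc n)) \<Longrightarrow> g (\<rho> n x) = f x"
      using module_hom_factor_surj[OF Q(1) Y(1) Y(1) fQ \<rho>_Q(1)] by blast
    obtain h where h: "h \<in> module_hom A (F n) (Y m)" "\<And>z. z \<in> Z n \<Longrightarrow> h z = g z"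
      using extend_from_syzygy[OF Y(1) ext_Y[OF assms] g(1)] by blast
    have "f x \<in> ?U" if x: "x \<in> carrier (Q (Suc n))" for x
    proof -
      have z: "\<rho> n x \<in> Z n"
        using \<rho>_Q(2)[of n] x by auto
      then show ?thesis
        using radical_of_free_hom[OF Y(1) h(1) z] h(2)[OF z] g(2)[OF x] by simp
    qed
    then show "f \<in> homs_into A (Q (Suc n)) (Y m) ?U"
      using f by (auto simp: homs_into_def)
  qed
  then have "?V = homs_into A (Q (Suc n)) (Y m) ?U"
    using cmp(2) by blast
  then show ?thesis
    using cmp(1) by simp
qed

text \<open>
  Here the cover \<open>\<rho> n\<close> itself vanishes on \<open>Z (n + 1)\<close> without having its image in the radical.
\<close>

lemma hom_len_syzygies_less:
  assumes "Z n \<noteq> {\<zero>\<^bsub>F n\<^esub>}"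
  shows "hom_len K A (Y (Suc n)) ((Y n)\<lparr>carrier := radical_submodule A (Y n)\<rparr>) <
    hom_len K A (Y n) (quotient_module (Y n) (radical_submodule A (Y n)))"
proof -
  let ?U = "radical_submodule A (Y n)" and ?H = "hom_space K A (Q (Suc n)) (Y n)"
  let ?V = "{f \<in> carrier ?H. \<forall>z\<in>Z (Suc n). f z = \<zero>\<^bsub>Y n\<^esub>}"
  have ext: "ext_vanishing A P d (Y n) (Suc n)"
    by (intro ext_Y) simp
  note cmp = hom_len_comparison[OF Y Y_square ext]
  let ?f = "restrict (\<rho> n) (carrier (Q (Suc n)))"
  have "?f \<in> ?V"
    using module_hom_restrict[OF Q(1) \<rho>_Q(1)] Z_subset[of "Suc n"] by (auto simp: Z_Suc)
  moreover have "?f \<notin> homs_into A (Q (Suc n)) (Y n) ?U"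
  proof
    assume "?f \<in> homs_into A (Q (Suc n)) (Y n) ?U"
    then have "\<rho> n ` \<phi> (Suc n) ` carrier (F (Suc n)) \<subseteq> ?U"
      by (auto simp: homs_into_def)
    then have "carrier (Y n) \<subseteq> ?U"
      unfolding \<rho>_Q(2) by simp
    from nakayama[OF Y(1) Y_square this] show False
      using assms by simp
  qed
  ultimately have lt: "homs_into A (Q (Suc n)) (Y n) ?U \<subset> ?V"
    using cmp(2) by blast
  have "len K ?H (homs_into A (Q (Suc n)) (Y n) ?U) < len K ?H ?V"
    by (rule len_less[OF cmp(4,5,3) lt])
  then show ?thesis
    using cmp(1) by linarith
qed

end

section \<open>Linear dependence\<close>

text \<open>
  More than \<open>card D\<close> vectors in a space of dimension \<open>card D\<close> cannot be triangular with respect to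
  linear functionals: some vector is a linear combination of later ones.
\<close>

lemma no_triangular_family:
  fixes w \<psi> :: "nat \<Rightarrow> 'i \<Rightarrow> real"
  assumes "finite D" "finite N" "card D < card N"
    and "\<And>m n. m \<in> N \<Longrightarrow> n \<in> N \<Longrightarrow> m < n \<Longrightarrow> (\<Sum>i\<in>D. \<psi> m i * w n i) = 0"
    and "\<And>m. m \<in> N \<Longrightarrow> (\<Sum>i\<in>D. \<psi> m i * w m i) \<noteq> 0"
  shows False
  using assms
proof (induction D arbitrary: N w rule: finite_induct)
  case empty
  then have "N \<noteq> {}" by auto
  then show ?case
    using empty.prems(4) by auto
next
  case (insert k D)
  show ?case
  proof (cases "\<forall>n\<in>N. w n k = 0")
    case True
    then show ?thesis
      using insert.prems insert.hyps by (intro insert.IH[of N w]) simp_all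
  next
    case False
    define p where "p = Max {n \<in> N. w n k \<noteq> 0}"
    have fin: "finite {n \<in> N. w n k \<noteq> 0}"
      using insert.prems(1) by simp
    have "p \<in> {n \<in> N. w n k \<noteq> 0}"
      unfolding p_def using False fin by (intro Max_in) auto
    then have p: "p \<in> N" "w p k \<noteq> 0" by auto
    have later: "w n k = 0" if "n \<in> N" "p < n" for n
      using Max_ge[OF fin, of n] that by (force simp: p_def)
    \<comment> \<open>clear the coordinate \<open>k\<close> by means of the last vector in which it is nonzero\<close>
    define w' where "w' n = (if n < p then \<lambda>i. w n i - w n k / w p k * w p i else w n)" for n
    have w'k: "w' n k = 0" if "n \<in> N - {p}" for n
      using that later[of n] p(2) by (auto simp: w'_def)
    have sum: "(\<Sum>i\<in>D. \<psi> m i * w' n i) = (\<Sum>i\<in>insert k D. \<psi> m i * w n i)"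
      if "m \<in> N" "n \<in> N - {p}" "m \<le> n" for m n
    proof -
      have "(\<Sum>i\<in>D. \<psi> m i * w' n i) = (\<Sum>i\<in>insert k D. \<psi> m i * w' n i)"
        using w'k[OF that(2)] insert.hyps by simp
      also have "\<dots> = (\<Sum>i\<in>insert k D. \<psi> m i * w n i)"
      proof (cases "n < p")
        case True
        then have "(\<Sum>i\<in>insert k D. \<psi> m i * w' n i) = (\<Sum>i\<in>insert k D. \<psi> m i * w n i) -
            w n k / w p k * (\<Sum>i\<in>insert k D. \<psi> m i * w p i)"
          unfolding sum_distrib_left sum_subtractf[symmetric]
          by (intro sum.cong) (simp_all add: w'_def algebra_simps)
        then show ?thesis
          using insert.prems(3)[of m p] that(1,3) p(1) True by simp
      qed (simp add: w'_def)
      finally show ?thesis .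
    qed
    have "card (N - {p}) = card N - 1"
      using p(1) by simp
    then show ?thesis
      using insert.prems insert.hyps
      by (intro insert.IH[of "N - {p}" w']) (simp_all add: sum)
  qed
qed

section \<open>Self-orthogonal generators\<close>

context minimal_resolution
begin

text \<open>
  The dimensions of the spaces \<open>Hom (Z n, S)\<close> and \<open>Hom (Z (n + 1), S)\<close>, with \<open>S\<close> ranging over finitely
  many simple modules, form vectors indexed by \<open>n\<close>.  The multiplicities of the simple modules in
  \<open>Z m/J Z m\<close> and \<open>J Z m\<close> define a functional that vanishes on the vector of \<open>n\<close> for \<open>n > m\<close> but not
  for \<open>n = m\<close>.
\<close>

lemma syzygy_zero: "Z 0 = {\<zero>\<^bsub>F 0\<^esub>}"
proof (rule ccontr)
  assume nz0: "Z 0 \<noteq> {\<zero>\<^bsub>F 0\<^esub>}"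
  have nz: "Z n \<noteq> {\<zero>\<^bsub>F n\<^esub>}" for n
    by (induction n) (use nz0 syzygy_zero_pred in auto)
  obtain S where S: "finite S" "\<And>I. I \<in> S \<Longrightarrow> maximal_left_ideal A I"
    "jacobson_radical A = carrier A \<inter> \<Inter>S"
    "\<And>I. I \<in> S \<Longrightarrow> \<not> carrier A \<inter> \<Inter>(S - {I}) \<subseteq> I"
    using radical_finite_Inter by blast
  let ?U = "\<lambda>m. radical_submodule A (Y m)"
  let ?top = "\<lambda>m. quotient_module (Y m) (?U m)" and ?rad = "\<lambda>m. (Y m)\<lparr>carrier := ?U m\<rparr>"
  define b where "b n I = hom_len K A (Y n) (quotient_module (regular_module A) I)" for n I
  have U: "submodule (?U m) A (Y m)" for m
    by (rule submodule_radical_submodule[OF Y(1)])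
  have top: "\<exists>\<mu> :: 'a set \<Rightarrow> nat. \<forall>n. hom_len K A (Y n) (?top m) = (\<Sum>I\<in>S. \<mu> I * b n I)" for m
  proof -
    interpret Ym: left_module A "Y m" by (rule Y)
    note q = coset_rep_hom[OF Y(1) U]
    have T: "left_module A (?top m)" "free_cover A (?top m)"
      by (rule Ym.left_module_quotient[OF U], intro free_cover_image[OF Y(2) q]) simp
    have "a \<odot>\<^bsub>?top m\<^esub> x = \<zero>\<^bsub>?top m\<^esub>"
      if a: "a \<in> jacobson_radical A" and x: "x \<in> carrier (?top m)" for a x
    proof -
      have x': "x \<in> carrier (Y m)"
        using x Ym.coset_rep(1)[OF U] by auto
      then have "a \<odot>\<^bsub>Y m\<^esub> x \<in> ?U m"
        by (rule radical_submodule.smult[OF a])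
      then show ?thesis
        using Ym.coset_rep_eq_zero[OF U Ym.smult_closed[OF radical_closed[OF a] x']] by simp
    qed
    then obtain \<mu> :: "'a set \<Rightarrow> nat" where
      "\<And>M :: ('a, nat \<Rightarrow> 'a) module. left_module A M \<Longrightarrow> free_cover A M \<Longrightarrow> hom_len K A M (?top m) =
        (\<Sum>I\<in>S. \<mu> I * hom_len K A M (quotient_module (regular_module A) I))"
      using hom_len_semisimple[OF S T] by blast
    then show ?thesis
      using Y unfolding b_def by blast
  qed
  have rad: "\<exists>\<nu> :: 'a set \<Rightarrow> nat. \<forall>n. hom_len K A (Y n) (?rad m) = (\<Sum>I\<in>S. \<nu> I * b n I)" for m
  proof -
    have T: "left_module A (?rad m)" "free_cover A (?rad m)"
      by (rule left_module.left_module_submodule[OF Y(1) U], rule free_cover_submodule[OF Y U])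
    have "a \<odot>\<^bsub>?rad m\<^esub> x = \<zero>\<^bsub>?rad m\<^esub>"
      if a: "a \<in> jacobson_radical A" and x: "x \<in> carrier (?rad m)" for a x
      using radical_kills_radical_submodule[where M = "Y m", OF Y(1) Y_square a] x by simp
    then obtain \<nu> :: "'a set \<Rightarrow> nat" where
      "\<And>M :: ('a, nat \<Rightarrow> 'a) module. left_module A M \<Longrightarrow> free_cover A M \<Longrightarrow> hom_len K A M (?rad m) =
        (\<Sum>I\<in>S. \<nu> I * hom_len K A M (quotient_module (regular_module A) I))"
      using hom_len_semisimple[OF S T] by blast
    then show ?thesis
      using Y unfolding b_def by blast
  qed
  obtain \<mu> :: "nat \<Rightarrow> 'a set \<Rightarrow> nat" where
    \<mu>: "\<And>m n. hom_len K A (Y n) (?top m) = (\<Sum>I\<in>S. \<mu> m I * b n I)"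
    using top by metis
  obtain \<nu> :: "nat \<Rightarrow> 'a set \<Rightarrow> nat" where
    \<nu>: "\<And>m n. hom_len K A (Y n) (?rad m) = (\<Sum>I\<in>S. \<nu> m I * b n I)"
    using rad by metis
  define w where "w n = (\<lambda>(I, t). real (if t then b n I else b (Suc n) I))" for n
  define \<psi> where "\<psi> m = (\<lambda>(I, t). if t then real (\<mu> m I) else - real (\<nu> m I))" for m
  let ?D = "S \<times> (UNIV :: bool set)"
  have sum: "(\<Sum>i\<in>?D. \<psi> m i * w n i) =
      real (hom_len K A (Y n) (?top m)) - real (hom_len K A (Y (Suc n)) (?rad m))" for m n
  proof -
    have "(\<Sum>i\<in>?D. \<psi> m i * w n i) = (\<Sum>I\<in>S. \<Sum>t\<in>UNIV. \<psi> m (I, t) * w n (I, t))"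
      by (simp add: sum.cartesian_product)
    also have "\<dots> = (\<Sum>I\<in>S. real (\<mu> m I * b n I) - real (\<nu> m I * b (Suc n) I))"
      by (intro sum.cong) (simp_all add: UNIV_bool \<psi>_def w_def)
    finally show ?thesis
      unfolding \<mu> \<nu> by (simp add: sum_subtractf)
  qed
  show False
  proof (rule no_triangular_family[of ?D "{..card ?D}" \<psi> w])
    show "finite ?D" using S(1) by simp
    show "(\<Sum>i\<in>?D. \<psi> m i * w n i) = 0" if "m < n" for m n
      unfolding sum using hom_len_syzygies_eq[OF that] by simp
    show "(\<Sum>i\<in>?D. \<psi> m i * w m i) \<noteq> 0" for m
      unfolding sum using hom_len_syzygies_less[OF nz[of m]] by simp
  qed simp_all
qed

lemma retract_of_free:
  obtains i where "i \<in> module_hom A G (F 0)" "\<And>x. x \<in> carrier G \<Longrightarrow> \<rho>0 (i x) = x"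
proof -
  have \<rho>Q: "\<rho>0 \<in> module_hom A (Q 0) G"
    by (rule module_hom_restrict_source[OF \<rho>0(1) Q_subset])
  have inj: "inj_on \<rho>0 (carrier (Q 0))"
  proof (rule module_hom_inj_onI[OF Q(1) G \<rho>Q])
    fix x assume "x \<in> carrier (Q 0)" "\<rho>0 x = \<zero>\<^bsub>G\<^esub>"
    then have "x \<in> Z 0"
      by (simp add: Z_0)
    then show "x = \<zero>\<^bsub>Q 0\<^esub>"
      using syzygy_zero by simp
  qed
  have "\<rho>0 ` \<phi> 0 ` carrier (F 0) = carrier G"
    unfolding \<rho>0(2)[symmetric] image_image using \<rho>0(3) by (rule image_cong[OF refl])
  then have "(\<lambda>x. x) ` carrier G \<subseteq> \<rho>0 ` carrier (Q 0)"
    by simp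
  then obtain i where i: "i \<in> module_hom A G (Q 0)" "\<And>x. x \<in> carrier G \<Longrightarrow> \<rho>0 (i x) = x"
    using module_hom_factor_inj[OF G Q(1) G module_hom_id \<rho>Q inj] by blast
  show thesis
    by (rule that[OF module_hom_extend_target[OF i(1) Q_subset] i(2)])
qed

end

theorem corollary4p1:
  fixes K :: "('k, 'c) ring_scheme"
    and A :: "('k, 'a) module"
    and G :: "('a, 'g) module"
  assumes "fin_dim_algebra K A"
    and "split_algebra K A"
    and "jacobson_radical A \<cdot>\<^bsub>A\<^esub> jacobson_radical A \<cdot>\<^bsub>A\<^esub> jacobson_radical A = {\<zero>\<^bsub>A\<^esub>}"
    and "left_module A G"
    and "finitely_generated A G"
    and "generator A G"
    and "self_orthogonal A G"
  shows "projective_module TYPE('x) TYPE('y) A G"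
proof -
  interpret fin_dim_algebra K A by fact
  have fc: "free_cover A G"
    by (rule free_cover_of_finitely_generated[OF assms(4,5)])
  obtain P d where Pd: "(P, d) = (SOME (P, d). \<exists>e. free_resolution A G P d e)"
    by (metis surj_pair)
  have "\<exists>x. case x of (P, d) \<Rightarrow> \<exists>e. free_resolution A G P d e"
    using free_resolution_exists[OF assms(4) fc] by auto
  from someI_ex[OF this] have "\<exists>e. free_resolution A G P d e"
    unfolding Pd[symmetric] by simp
  then obtain e where res: "free_resolution A G P d e" ..
  note P' = free_resolutionD[OF A.ring_axioms res]
  have ext_G: "ext_vanishing A P d G n" for n
  proof (rule ext_vanishing_of_trivial_cohomology[where P = P and d = d, OF _ _ assms(4)])
    show "left_module A (P k)" "d k \<in> module_hom A (P (Suc k)) (P k)" for k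
      by (rule P'(2), rule P'(3))
    have "Ext A (Suc n) G G = hom_cohomology A P d G (Suc n)"
      unfolding Ext_def Pd[symmetric] by simp
    then show "trivial_group (hom_cohomology A P d G (Suc n))"
      using assms(7) unfolding self_orthogonal_def by (metis zero_less_Suc)
  qed
  have ext_A: "ext_vanishing A P d (regular_module A) n" for n
  proof -
    obtain k where "direct_summand A (regular_module A) (direct_power G k)"
      using assms(6) unfolding generator_def in_add_def by blast
    then obtain i p where "i \<in> module_hom A (regular_module A) (direct_power G k)"
      "p \<in> module_hom A (direct_power G k) (regular_module A)"
      "\<And>x. x \<in> carrier (regular_module A) \<Longrightarrow> p (i x) = x"
      using retract_of_direct_summand[OF _ left_module_regular_algebra
          left_module_direct_power[OF assms(4)]] by blast
    then show ?thesis
      by (rule ext_vanishing_retract[OF ext_vanishing_direct_power[OF ext_G assms(4)] _ _ _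
            left_module_direct_power[OF assms(4)] left_module_regular_algebra])
  qed
  have cube: "a \<otimes>\<^bsub>A\<^esub> (b \<otimes>\<^bsub>A\<^esub> c) = \<zero>\<^bsub>A\<^esub>" if "a \<in> jacobson_radical A" "b \<in> jacobson_radical A"
    "c \<in> jacobson_radical A" for a b c
  proof -
    have "(a \<otimes>\<^bsub>A\<^esub> b) \<otimes>\<^bsub>A\<^esub> c \<in> jacobson_radical A \<cdot>\<^bsub>A\<^esub> jacobson_radical A \<cdot>\<^bsub>A\<^esub> jacobson_radical A"
      using that by (intro ideal_prod.prod)
    then show ?thesis
      using that assms(3) by (simp add: A.m_assoc radical_closed)
  qed
  obtain r \<phi> Z \<rho>0 \<rho> where min: "minimal_cover A (r 0) (\<phi> 0) \<rho>0 G"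
    "Z 0 = {x \<in> \<phi> 0 ` carrier (free_module A (r 0)). \<rho>0 x = \<zero>\<^bsub>G\<^esub>}"
    "\<forall>n. minimal_cover A (r (Suc n)) (\<phi> (Suc n)) (\<rho> n) ((free_module A (r n))\<lparr>carrier := Z n\<rparr>)"
    "\<forall>n. Z (Suc n) = {x \<in> \<phi> (Suc n) ` carrier (free_module A (r (Suc n))).
      \<rho> n x = \<zero>\<^bsub>free_module A (r n)\<^esub>}"
    by (rule minimal_resolution_exists[OF assms(4) fc])
  interpret minimal_resolution K A G r \<phi> Z \<rho>0 \<rho> P d e
    by (intro minimal_resolution.intro minimal_resolution_axioms.intro fin_dim_algebra_axioms
        assms(4) min(1,2) min(3,4)[THEN spec] res ext_G ext_A cube)
  obtain i where i: "i \<in> module_hom A G (free_module A (r 0))"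
    "\<And>x. x \<in> carrier G \<Longrightarrow> \<rho>0 (i x) = x"
    using retract_of_free by blast
  show ?thesis
    unfolding projective_module_def
  proof (intro conjI allI impI)
    show "left_module A G" by fact
    fix L :: "('a, 'x) module" and N :: "('a, 'y) module" and g f
    assume "left_module A L \<and> left_module A N \<and> g \<in> module_hom A L N \<and>
      g ` carrier L = carrier N \<and> f \<in> module_hom A G N"
    then have L: "left_module A L" and N: "left_module A N" and g: "g \<in> module_hom A L N"
      "g ` carrier L = carrier N" and f: "f \<in> module_hom A G N" by auto
    have f\<rho>: "(\<lambda>x. f (\<rho>0 x)) \<in> module_hom A (free_module A (r 0)) N"
      by (rule module_hom_comp[OF \<rho>0(1) f])
    have "(\<lambda>x. f (\<rho>0 x)) ` carrier (free_module A (r 0)) \<subseteq> g ` carrier L"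
      unfolding g(2) using module_hom_closed[OF f\<rho>] by blast
    then obtain h where h: "h \<in> module_hom A (free_module A (r 0)) L"
      "\<And>v. v \<in> carrier (free_module A (r 0)) \<Longrightarrow> g (h v) = f (\<rho>0 v)"
      using free_module_lift[OF L N left_module.submodule_carrier[OF L] g(1) f\<rho>] by blast
    show "\<exists>h\<in>module_hom A G L. \<forall>m\<in>carrier G. g (h m) = f m"
    proof (intro bexI[of _ "\<lambda>x. h (i x)"] ballI)
      show "(\<lambda>x. h (i x)) \<in> module_hom A G L"
        by (rule module_hom_comp[OF i(1) h(1)])
      show "g (h (i m)) = f m" if "m \<in> carrier G" for m
        using h(2)[OF module_hom_closed[OF i(1) that]] i(2)[OF that] by simp
    qed
  qed
qed

end
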